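(* Let $G$ be a finite abelian group with character group $A$ and let $n\ge 2$ be an integer. The homomorphism $\tilde\psi:\widetilde{\mathbf{T}}\to\mathcal{B}_n(G)$ factors through the quotient of $\widetilde{\mathbf{T}}$ by the subdivision relations, and the induced homomorphism $$\widetilde{\mathbf{T}}/(\text{subdivision relations})\to\mathcal{B}_n(G)$$ is an isomorphism.
   Context: Write the character group $A$ of $G$ additively. Let $\mathcal{S}_n(G)$ be the free abelian group generated by symbols $[a_1,\ldots,a_n]$, taken up to permutation of the entries, where $a_1,\ldots,a_n\in A$ generate $A$. The group $\mathcal{B}_n(G)$ is the quotient of $\mathcal{S}_n(G)$ by the relations, for all symbols $[a_1,a_2,b_1,\ldots,b_{n-2}]$: $$[a_1,a_2,b_1,\ldots,b_{n-2}]=[a_1,a_2-a_1,b_1,\ldots,b_{n-2}]+[a_1-a_2,a_2,b_1,\ldots,b_{n-2}]\quad\text{if } a_1\ne a_2,$$ $$[a_1,a_1,b_1,\ldots,b_{n-2}]=[0,a_1,b_1,\ldots,b_{n-2}]\quad\text{if } a_1=a_2.$$ Consider triples $(\mathbf{L},\chi,\Lambda')$, where $\mathbf{L}\simeq\mathbb{Z}^n$ is a lattice of rank $n$; $\chi\in\mathbf{L}\otimes A$ is an element whose induced homomorphism $\mathbf{L}^\vee\to A$ is surjective; and $\Lambda'\subset\mathbf{L}\otimes\mathbb{R}$ is a smooth cone of arbitrary dimension (i.e., a cone spanned by part of a basis of $\mathbf{L}$) such that, with $\mathbf{L}'$ the sublattice of $\mathbf{L}$ spanned by the lattice generators of $\Lambda'$,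 one has $\chi\in\mathrm{Im}(\mathbf{L}'\otimes A\to\mathbf{L}\otimes A)$. A basic cone is a cone spanned by a full basis of $\mathbf{L}$. Let $\widetilde{\mathbf{T}}$ be the free abelian group on such triples modulo identifying triples that differ by the action of $\mathrm{GL}_n(\mathbb{Z})$ (i.e., isomorphic triples). The map $\widetilde{\mathbf{T}}\to\mathcal{S}_n(G)$ sends $(\mathbf{L},\chi,\Lambda')$ to $[a_1,\ldots,a_n]$, where $e_1,\ldots,e_n$ is a basis of $\mathbf{L}$ extending the set of lattice generators of $\Lambda'$ and $\chi=\sum_{i=1}^n e_i\otimes a_i$ (so $a_i=0$ for those $e_i$ not in $\Lambda'$; the symbol does not depend on the choice of extension). The map $\tilde\psi$ is the composition of this map with the projection $\mathcal{S}_n(G)\to\mathcal{B}_n(G)$. The subdivision relations on $\widetilde{\mathbf{T}}$ are the following two families. (1) For a triple $(\mathbf{L},\chi,\Lambda')$ with $\Lambda'=\mathbb{R}_{\ge 0}\langle e_1,\ldots,e_s\rangle$ and a face $\Lambda''=\mathbb{R}_{\ge 0}\langle e_1,\ldots,e_r\rangle$ of $\Lambda'$ of dimension $r\ge 2$ (where $e_1,\ldots,e_s$ is part of a basis of $\mathbf{L}$), let $\Sigma^*_{\Lambda'}(\Lambda'')$ be the set of the $2^r-1$ cones spanned by $e_1+\cdots+e_r$, $e_{r+1},\ldots,e_s$, together with a proper (possibly empty) subset of $\{e_1,\ldots,e_r\}$. Then $$(\mathbf{L},\chi,\Lambda')=\sum_{\widetilde\Lambda'}(-1)^{\dim(\Lambda')-\dim(\widetilde\Lambda')}(\mathbf{L},\chi,\widetilde\Lambda'),$$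 where the sum is over those $\widetilde\Lambda'\in\Sigma^*_{\Lambda'}(\Lambda'')$ for which $\chi\in\mathrm{Im}(\widetilde{\mathbf{L}}'\otimes A\to\mathbf{L}\otimes A)$, with $\widetilde{\mathbf{L}}'$ the sublattice spanned by the lattice generators of $\widetilde\Lambda'$. (2) $(\mathbf{L},\chi,\Lambda')=(\mathbf{L},\chi,\Lambda)$ for every basic cone $\Lambda$ having $\Lambda'$ as a face. *)

theory Defs
  imports
    "HOL-Analysis.Analysis"
    "HOL-Algebra.Free_Abelian_Groups"
    "HOL-Algebra.Generated_Groups"
    "HOL-Algebra.Elementary_Groups"
    "HOL-Library.Multiset"
begin

section \<open>The character group\<close>

definition complex_units :: "complex monoid"
  where "complex_units = \<lparr>carrier = UNIV - {0}, monoid.mult = (*), one = 1\<rparr>"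

text \<open>
  HOL-Algebra groups carry multiplicative notation, so the additive expressions \<open>0\<close> and
  \<open>a - b\<close> in the character group are rendered below as \<open>\<one>\<close> and \<open>a \<otimes> inv b\<close>.
\<close>

definition character_group :: "('g, 'm) monoid_scheme \<Rightarrow> ('g \<Rightarrow> complex) monoid"
  where "character_group G =
    \<lparr>carrier = hom G complex_units \<inter> extensional (carrier G),
     monoid.mult = (\<lambda>\<phi> \<psi>. restrict (\<lambda>x. \<phi> x * \<psi> x) (carrier G)),
     one = restrict (\<lambda>x. 1) (carrier G)\<rparr>"


section \<open>The groups \<open>\<S>\<^sub>n\<close> and \<open>\<B>\<^sub>n\<close>\<close>

definition symbols :: "nat \<Rightarrow> ('c, 'm) monoid_scheme \<Rightarrow> 'c multiset set"
  where "symbols n A =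
    {M. size M = n \<and> set_mset M \<subseteq> carrier A \<and> generate A (set_mset M) = carrier A}"

definition symbol_group :: "nat \<Rightarrow> ('c, 'm) monoid_scheme \<Rightarrow> ('c multiset \<Rightarrow>\<^sub>0 int) monoid"
  where "symbol_group n A = free_Abelian_group (symbols n A)"

definition symbol_relators :: "nat \<Rightarrow> ('c, 'm) monoid_scheme \<Rightarrow> ('c multiset \<Rightarrow>\<^sub>0 int) set"
  where "symbol_relators n A =
    {frag_of ({#a\<^sub>1, a\<^sub>2#} + N)
       - (frag_of ({#a\<^sub>1, a\<^sub>2 \<otimes>\<^bsub>A\<^esub> inv\<^bsub>A\<^esub> a\<^sub>1#} + N) + frag_of ({#a\<^sub>1 \<otimes>\<^bsub>A\<^esub> inv\<^bsub>A\<^esub> a\<^sub>2, a\<^sub>2#} + N))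
     | a\<^sub>1 a\<^sub>2 N. {#a\<^sub>1, a\<^sub>2#} + N \<in> symbols n A \<and> a\<^sub>1 \<noteq> a\<^sub>2}
    \<union> {frag_of ({#a, a#} + N) - frag_of ({#\<one>\<^bsub>A\<^esub>, a#} + N)
       | a N. {#a, a#} + N \<in> symbols n A}"

definition symbol_relations :: "nat \<Rightarrow> ('c, 'm) monoid_scheme \<Rightarrow> ('c multiset \<Rightarrow>\<^sub>0 int) set"
  where "symbol_relations n A = generate (symbol_group n A) (symbol_relators n A)"

definition B_group :: "nat \<Rightarrow> ('c, 'm) monoid_scheme \<Rightarrow> ('c multiset \<Rightarrow>\<^sub>0 int) set monoid"
  where "B_group n A = symbol_group n A Mod symbol_relations n A"


section \<open>Tensor products of abelian groups\<close>

definition tensor_relators ::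
    "('b, 'm) monoid_scheme \<Rightarrow> ('c, 'k) monoid_scheme \<Rightarrow> ('b \<times> 'c \<Rightarrow>\<^sub>0 int) set"
  where "tensor_relators M N =
    {frag_of (x \<otimes>\<^bsub>M\<^esub> y, a) - (frag_of (x, a) + frag_of (y, a))
     | x y a. x \<in> carrier M \<and> y \<in> carrier M \<and> a \<in> carrier N}
    \<union> {frag_of (x, a \<otimes>\<^bsub>N\<^esub> b) - (frag_of (x, a) + frag_of (x, b))
     | x a b. x \<in> carrier M \<and> a \<in> carrier N \<and> b \<in> carrier N}"

definition tensor_relations ::
    "('b, 'm) monoid_scheme \<Rightarrow> ('c, 'k) monoid_scheme \<Rightarrow> ('b \<times> 'c \<Rightarrow>\<^sub>0 int) set"
  where "tensor_relations M N =
    generate (free_Abelian_group (carrier M \<times> carrier N)) (tensor_relators M N)"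

definition tensor_group ::
    "('b, 'm) monoid_scheme \<Rightarrow> ('c, 'k) monoid_scheme \<Rightarrow> ('b \<times> 'c \<Rightarrow>\<^sub>0 int) set monoid"
  where "tensor_group M N =
    free_Abelian_group (carrier M \<times> carrier N) Mod tensor_relations M N"

definition pure_tensor ::
    "('b, 'm) monoid_scheme \<Rightarrow> ('c, 'k) monoid_scheme \<Rightarrow> 'b \<Rightarrow> 'c \<Rightarrow> ('b \<times> 'c \<Rightarrow>\<^sub>0 int) set"
  where "pure_tensor M N x a =
    tensor_relations M N #>\<^bsub>free_Abelian_group (carrier M \<times> carrier N)\<^esub> frag_of (x, a)"

text \<open>
  For a homomorphism \<open>f\<close> from an abelian group into \<open>M\<close>, this is the map induced by \<open>f\<close> on
  tensor products with \<open>N\<close>: applied to a coset, it saturates the image of the coset by the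
  relations of the target, which again gives a single coset.
\<close>

definition tensor_map ::
    "('a \<Rightarrow> 'b) \<Rightarrow> ('b, 'm) monoid_scheme \<Rightarrow> ('c, 'k) monoid_scheme
      \<Rightarrow> ('a \<times> 'c \<Rightarrow>\<^sub>0 int) set \<Rightarrow> ('b \<times> 'c \<Rightarrow>\<^sub>0 int) set"
  where "tensor_map f M N X =
    tensor_relations M N <#>\<^bsub>free_Abelian_group (carrier M \<times> carrier N)\<^esub>
      (frag_extend (\<lambda>(x, a). frag_of (f x, a)) ` X)"

text \<open>
  The map \<open>M\<^sup>\<or> \<rightarrow> N\<close> induced by an element of \<open>M \<otimes> N\<close>: the class of \<open>\<Sum> k\<^sub>i (x\<^sub>i, a\<^sub>i)\<close> sends
  \<open>\<phi>\<close> to \<open>\<Sum> k\<^sub>i \<phi>(x\<^sub>i) a\<^sub>i\<close>, a value that is the same for all representatives.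
\<close>

definition tensor_eval ::
    "('c, 'k) monoid_scheme \<Rightarrow> ('b \<times> 'c \<Rightarrow>\<^sub>0 int) set \<Rightarrow> ('b \<Rightarrow> int) \<Rightarrow> 'c"
  where "tensor_eval N \<xi> \<phi> = the_elem
    ((\<lambda>u. \<Otimes>\<^bsub>N\<^esub>p\<in>Poly_Mapping.keys u.
        snd p [^]\<^bsub>N\<^esub> (Poly_Mapping.lookup u p * \<phi> (fst p))) ` \<xi>)"


section \<open>Lattices and smooth cones\<close>

text \<open>
  A lattice \<open>L\<close> of rank \<open>n\<close> is a full-rank lattice in \<open>\<real>\<^sup>n\<close>, so that \<open>L \<otimes> \<real>\<close> is the
  ambient space; every abstract lattice of rank \<open>n\<close> is isomorphic to one of these. Every basis
  over the integers of such a lattice is linearly independent over the reals.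
\<close>

definition int_span :: "'v::real_vector set \<Rightarrow> 'v set"
  where "int_span B = {\<Sum>v\<in>B. of_int (c v) *\<^sub>R v | c :: 'v \<Rightarrow> int. True}"

definition lattice_basis :: "(real^'n) set \<Rightarrow> (real^'n) set \<Rightarrow> bool"
  where "lattice_basis L B \<longleftrightarrow>
    finite B \<and> card B = CARD('n) \<and> independent B \<and> L = int_span B"

definition is_lattice :: "(real^'n) set \<Rightarrow> bool"
  where "is_lattice L \<longleftrightarrow> (\<exists>B. lattice_basis L B)"

definition lattice_group :: "'v::real_vector set \<Rightarrow> 'v monoid"
  where "lattice_group L = \<lparr>carrier = L, monoid.mult = (+), one = 0\<rparr>"

definition part_of_basis :: "(real^'n) set \<Rightarrow> (real^'n) set \<Rightarrow> bool"
  where "part_of_basis L E \<longleftrightarrow> (\<exists>B. lattice_basis L B \<and> E \<subseteq> B)"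

definition smooth_cone :: "(real^'n) set \<Rightarrow> (real^'n) set \<Rightarrow> bool"
  where "smooth_cone L \<Lambda> \<longleftrightarrow> (\<exists>E. part_of_basis L E \<and> \<Lambda> = convex_cone hull E)"

definition basic_cone :: "(real^'n) set \<Rightarrow> (real^'n) set \<Rightarrow> bool"
  where "basic_cone L \<Lambda> \<longleftrightarrow> (\<exists>B. lattice_basis L B \<and> \<Lambda> = convex_cone hull B)"

text \<open>
  The generators of a smooth cone are unique: they are the primitive vectors of \<open>L\<close> on its
  extremal rays.
\<close>

definition lattice_generators :: "(real^'n) set \<Rightarrow> (real^'n) set \<Rightarrow> (real^'n) set"
  where "lattice_generators L \<Lambda> = (THE E. part_of_basis L E \<and> \<Lambda> = convex_cone hull E)"

definition cone_sublattice :: "(real^'n) set \<Rightarrow> (real^'n) set \<Rightarrow> (real^'n) set"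
  where "cone_sublattice L \<Lambda> = int_span (lattice_generators L \<Lambda>)"

definition supported_on ::
    "('c, 'k) monoid_scheme \<Rightarrow> (real^'n) set \<Rightarrow> ((real^'n) \<times> 'c \<Rightarrow>\<^sub>0 int) set
      \<Rightarrow> (real^'n) set \<Rightarrow> bool"
  where "supported_on A L \<xi> \<Lambda> \<longleftrightarrow>
    \<xi> \<in> tensor_map (\<lambda>x. x) (lattice_group L) A
          ` carrier (tensor_group (lattice_group (cone_sublattice L \<Lambda>)) A)"


section \<open>Triples\<close>

type_synonym ('n, 'c) triple =
  "(real^'n) set \<times> ((real^'n) \<times> 'c \<Rightarrow>\<^sub>0 int) set \<times> (real^'n) set"

definition triples :: "('c, 'k) monoid_scheme \<Rightarrow> ('n::finite, 'c) triple set"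
  where "triples A = {(L, \<xi>, \<Lambda>). is_lattice L
    \<and> \<xi> \<in> carrier (tensor_group (lattice_group L) A)
    \<and> tensor_eval A \<xi> ` hom (lattice_group L) integer_group = carrier A
    \<and> smooth_cone L \<Lambda> \<and> supported_on A L \<xi> \<Lambda>}"

definition triple_iso :: "('c, 'k) monoid_scheme \<Rightarrow> ('n::finite, 'c) triple rel"
  where "triple_iso A = {((L\<^sub>1, \<xi>\<^sub>1, \<Lambda>\<^sub>1), (L\<^sub>2, \<xi>\<^sub>2, \<Lambda>\<^sub>2)).
    (L\<^sub>1, \<xi>\<^sub>1, \<Lambda>\<^sub>1) \<in> triples A \<and> (L\<^sub>2, \<xi>\<^sub>2, \<Lambda>\<^sub>2) \<in> triples A
    \<and> (\<exists>g. linear g \<and> bij g \<and> g ` L\<^sub>1 = L\<^sub>2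
          \<and> tensor_map g (lattice_group L\<^sub>2) A \<xi>\<^sub>1 = \<xi>\<^sub>2 \<and> g ` \<Lambda>\<^sub>1 = \<Lambda>\<^sub>2)}"

definition triple_class ::
    "('c, 'k) monoid_scheme \<Rightarrow> ('n::finite, 'c) triple \<Rightarrow> ('n, 'c) triple set"
  where "triple_class A t = triple_iso A `` {t}"

definition T_group ::
    "'n::finite itself \<Rightarrow> ('c, 'k) monoid_scheme \<Rightarrow> (('n, 'c) triple set \<Rightarrow>\<^sub>0 int) monoid"
  where "T_group _ A = free_Abelian_group (triples A // triple_iso A)"


section \<open>The map to symbols\<close>

definition triple_symbol ::
    "('c, 'k) monoid_scheme \<Rightarrow> ('n::finite, 'c) triple \<Rightarrow> 'c multiset"
  where "triple_symbol A = (\<lambda>(L, \<xi>, \<Lambda>). THE M. \<exists>B a.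
    lattice_basis L B \<and> lattice_generators L \<Lambda> \<subseteq> B \<and> a \<in> B \<rightarrow> carrier A
    \<and> \<xi> = (\<Otimes>\<^bsub>tensor_group (lattice_group L) A\<^esub>e\<in>B. pure_tensor (lattice_group L) A e (a e))
    \<and> M = image_mset a (mset_set B))"

definition symbol_map ::
    "('c, 'k) monoid_scheme \<Rightarrow> (('n::finite, 'c) triple set \<Rightarrow>\<^sub>0 int) \<Rightarrow> ('c multiset \<Rightarrow>\<^sub>0 int)"
  where "symbol_map A = frag_extend (\<lambda>C. frag_of (the_elem (triple_symbol A ` C)))"

definition psi_tilde ::
    "('c, 'k) monoid_scheme \<Rightarrow> (('n::finite, 'c) triple set \<Rightarrow>\<^sub>0 int)
      \<Rightarrow> ('c multiset \<Rightarrow>\<^sub>0 int) set"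
  where "psi_tilde A x =
    symbol_relations CARD('n) A #>\<^bsub>symbol_group CARD('n) A\<^esub> symbol_map A x"


section \<open>Subdivision relations\<close>

text \<open>
  Here \<open>E\<close> is the set of generators of the cone and \<open>F\<close> the subset generating the face.
\<close>

definition star_subdivision :: "(real^'n) set \<Rightarrow> (real^'n) set \<Rightarrow> (real^'n) set set"
  where "star_subdivision E F =
    {convex_cone hull (insert (\<Sum>F) ((E - F) \<union> F')) | F'. F' \<subset> F}"

definition subdivision_relators ::
    "'n::finite itself \<Rightarrow> ('c, 'k) monoid_scheme \<Rightarrow> (('n, 'c) triple set \<Rightarrow>\<^sub>0 int) set"
  where "subdivision_relators _ A =
    {frag_of (triple_class A (L, \<xi>, \<Lambda>'))
       - (\<Sum>\<Lambda> \<in> {\<Lambda> \<in> star_subdivision E F. supported_on A L \<xi> \<Lambda>}.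
            frag_cmul ((-1) ^ (dim \<Lambda>' - dim \<Lambda>)) (frag_of (triple_class A (L, \<xi>, \<Lambda>))))
     | L \<xi> \<Lambda>' E F. (L, \<xi>, \<Lambda>') \<in> triples A
         \<and> part_of_basis L E \<and> \<Lambda>' = convex_cone hull E \<and> F \<subseteq> E \<and> 2 \<le> card F}
    \<union> {frag_of (triple_class A (L, \<xi>, \<Lambda>')) - frag_of (triple_class A (L, \<xi>, \<Lambda>))
     | L \<xi> \<Lambda>' \<Lambda>. (L, \<xi>, \<Lambda>') \<in> triples A \<and> basic_cone L \<Lambda> \<and> \<Lambda>' face_of \<Lambda>}"

definition subdivision_relations ::
    "'n::finite itself \<Rightarrow> ('c, 'k) monoid_scheme \<Rightarrow> (('n, 'c) triple set \<Rightarrow>\<^sub>0 int) set"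
  where "subdivision_relations T A = generate (T_group T A) (subdivision_relators T A)"

end

theory Submission
  imports Defs
begin

text \<open>
  By the relations (2) every triple is equivalent to any basic cone containing it, and isomorphism
  classes of triples with a basic cone correspond to symbols; so modulo (2) the group of triples is
  \<open>\<S>\<^sub>n\<close>. In \<open>\<S>\<^sub>n\<close> the relation (1) becomes, after cancellation of the signs over
  the faces on which \<open>\<chi>\<close> has a constant coefficient,
  \<open>[a\<^sub>1, \<dots>, a\<^sub>r, b] = \<Sum> [x, (a\<^sub>i - x)\<^sub>i, b]\<close>, the sum being over the distinct values
  \<open>x\<close> among the \<open>a\<^sub>i\<close> and one entry equal to \<open>x\<close> being kept as the first one. For \<open>r = 2\<close> this is
  exactly the defining relation of \<open>\<B>\<^sub>n\<close>, and the case of general \<open>r\<close> follows from \<open>r = 2\<close> by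
  induction.
\<close>

section \<open>Lattice bases and smooth cones\<close>

text \<open>The obstacle is that none of the data comes in coordinates: \<open>\<chi>\<close> is a
  coset, cone generators and symbols are definite descriptions, and a triple does not single out a
  basis of its lattice. Everything is therefore referred to a basis \<open>B\<close> containing the
  cone generators \<open>E\<close>. There the tensor has unique coefficients \<open>a\<close>,
  surjectivity says that they generate the group, and the support condition says that they are
  trivial off \<open>E\<close>. Passing to a cone of the star subdivision replaces some
  \<open>f\<close> in \<open>F\<close> by \<open>\<Sum>F\<close> and subtracts the coefficient of
  \<open>f\<close> from those of the other members of \<open>F\<close>; this is the origin of the
  differences in the relations of \<open>\<B>\<^sub>n\<close>. The two directions use the relations
  differently. Well-definedness concerns faces of every dimension. Injectivity uses only
  two-dimensional faces of basic cones: they already lift all defining relators of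
  \<open>\<B>\<^sub>n\<close>, and what remains, an element with zero image in
  \<open>\<S>\<^sub>n\<close>, is absorbed by the relations (2) through a section that sends a
  symbol to its basic triple.\<close>

lemma representation_sum_scaleR:
  fixes B :: "'v::real_vector set"
  assumes "independent B" "finite B"
  shows "representation B (\<Sum>b\<in>B. c b *\<^sub>R b) = (\<lambda>b. if b \<in> B then c b else 0)"
proof -
  have "representation B (\<Sum>b\<in>B. c b *\<^sub>R b) = (\<lambda>x. \<Sum>b\<in>B. c b * (if x = b then 1 else 0))"
    using assms by (subst real_vector.representation_sum)
      (auto simp: real_vector.representation_scale real_vector.representation_basis span_base span_scale)
  also have "\<dots> = (\<lambda>b. if b \<in> B then c b else 0)"
    using assms(2) by (auto simp: if_distrib[of "(*) _"] cong: if_cong)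
  finally show ?thesis .
qed

text \<open>Independence makes the coordinates unique, so membership in the cone becomes a sign
  condition on each of them; the later arguments on generators and faces use it in this
  form.\<close>

lemma convex_cone_hull_eq_representation:
  fixes B :: "'v::real_vector set"
  assumes "independent B" "finite B"
  shows "convex_cone hull B = {x \<in> span B. \<forall>b. 0 \<le> representation B x b}"
proof
  show "convex_cone hull B \<subseteq> {x \<in> span B. \<forall>b. 0 \<le> representation B x b}"
  proof (rule hull_minimal)
    show "convex_cone {x \<in> span B. \<forall>b. 0 \<le> representation B x b}"
      using assms by (auto simp: convex_cone_iff span_zero span_add span_scale
          real_vector.representation_zero real_vector.representation_add real_vector.representation_scale)
  qed (use assms in \<open>auto simp: real_vector.representation_basis span_base\<close>)
next
  show "{x \<in> span B. \<forall>b. 0 \<le> representation B x b} \<subseteq> convex_cone hull B"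
  proof clarify
    fix x assume x: "x \<in> span B" "\<forall>b. 0 \<le> representation B x b"
    have "(\<Sum>b\<in>C. representation B x b *\<^sub>R b) \<in> convex_cone hull B" if "finite C" "C \<subseteq> B" for C
      using that x(2)
      by (induction C rule: finite_induct)
        (auto simp: convex_cone_hull_contains_0 convex_cone_hull_add convex_cone_hull_mul hull_inc)
    from this[OF assms(2) subset_refl]
    show "x \<in> convex_cone hull B"
      using real_vector.sum_representation_eq[of B x B] assms x by simp
  qed
qed

lemma int_span_eq_representation:
  fixes B :: "'v::real_vector set"
  assumes "independent B" "finite B"
  shows "int_span B = {x \<in> span B. \<forall>b. representation B x b \<in> \<int>}"
proof
  show "int_span B \<subseteq> {x \<in> span B. \<forall>b. representation B x b \<in> \<int>}"
  proof
    fix x assume "x \<in> int_span B"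
    then obtain c :: "'v \<Rightarrow> int" where x: "x = (\<Sum>v\<in>B. of_int (c v) *\<^sub>R v)"
      by (auto simp: int_span_def)
    have "x \<in> span B"
      unfolding x by (intro span_sum span_scale span_base)
    then show "x \<in> {x \<in> span B. \<forall>b. representation B x b \<in> \<int>}"
      using assms by (simp add: x representation_sum_scaleR)
  qed
next
  show "{x \<in> span B. \<forall>b. representation B x b \<in> \<int>} \<subseteq> int_span B"
  proof clarify
    fix x assume x: "x \<in> span B" "\<forall>b. representation B x b \<in> \<int>"
    \<comment> \<open>The coordinates are integers, so floors change nothing; they only supply the
      integer-valued coefficient function that \<open>int_span\<close> asks for.\<close>
    have "(\<Sum>b\<in>B. of_int \<lfloor>representation B x b\<rfloor> *\<^sub>R b) = x"
      using x real_vector.sum_representation_eq[of B x B] assms by simp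
    then show "x \<in> int_span B"
      unfolding int_span_def by (auto intro!: exI[of _ "\<lambda>b. \<lfloor>representation B x b\<rfloor>"])
  qed
qed

lemma int_span_base:
  assumes "finite B" "b \<in> B"
  shows "b \<in> int_span B"
proof -
  have "(\<Sum>v\<in>B. of_int (if v = b then 1 else 0) *\<^sub>R v) = (\<Sum>v\<in>B. if v = b then b else 0)"
    by (intro sum.cong) auto
  then have "b = (\<Sum>v\<in>B. of_int (if v = b then 1 else 0) *\<^sub>R v)"
    using assms by simp
  then show ?thesis
    unfolding int_span_def by (auto intro!: exI[of _ "\<lambda>v. if v = b then 1 else 0"])
qed

lemma int_span_zero: "0 \<in> int_span B"
  unfolding int_span_def by (auto intro!: exI[of _ "\<lambda>_. 0"])

lemma int_span_add: "x \<in> int_span B \<Longrightarrow> y \<in> int_span B \<Longrightarrow> x + y \<in> int_span B"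
  unfolding int_span_def by (auto simp: sum.distrib[symmetric] scaleR_left_distrib[symmetric]
      simp flip: of_int_add)

lemma int_span_scale: "x \<in> int_span B \<Longrightarrow> of_int k *\<^sub>R x \<in> int_span B"
  unfolding int_span_def by (auto simp: scaleR_sum_right simp flip: of_int_mult)

lemma int_span_minus: "x \<in> int_span B \<Longrightarrow> - x \<in> int_span B"
  using int_span_scale[of x B "-1"] by simp

lemma int_span_sum: "(\<And>i. i \<in> I \<Longrightarrow> f i \<in> int_span B) \<Longrightarrow> sum f I \<in> int_span B"
  by (induction I rule: infinite_finite_induct) (auto simp: int_span_zero int_span_add)

lemma int_span_subset:
  assumes "B \<subseteq> int_span C"
  shows "int_span B \<subseteq> int_span C"
  using assms unfolding int_span_def[of B] by (auto intro!: int_span_sum int_span_scale)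

lemma int_span_mono: "finite C \<Longrightarrow> B \<subseteq> C \<Longrightarrow> int_span B \<subseteq> int_span C"
  by (meson int_span_base int_span_subset subset_iff)

section \<open>Lattice bases and the uniqueness of cone generators\<close>

lemma lattice_basisD:
  fixes B :: "(real^'n) set"
  assumes "lattice_basis L B"
  shows "finite B" "independent B" "card B = CARD('n)" "L = int_span B" "B \<subseteq> L" "span B = UNIV"
proof -
  show *: "finite B" "independent B" "card B = CARD('n)" "L = int_span B"
    using assms by (auto simp: lattice_basis_def)
  then show "B \<subseteq> L"
    using int_span_base by blast
  show "span B = UNIV"
    using * independent_span_bound card_eq_dim[of B UNIV] by auto
qed

text \<open>A generator \<open>e\<close> of the first cone spans an extremal ray, so every generator
  \<open>f\<close> of the second cone that enters its nonnegative expansion is a multiple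
  \<open>t\<close> of \<open>e\<close>. Both vectors are members of bases of the same lattice, which
  leaves only \<open>t = 1\<close>.\<close>

lemma convex_cone_hull_subset_imp_generators_subset:
  assumes B: "lattice_basis L B" "E \<subseteq> B" and B': "lattice_basis L B'" "E' \<subseteq> B'"
    and eq: "convex_cone hull E = convex_cone hull E'"
  shows "E \<subseteq> E'"
proof
  fix e assume e: "e \<in> E"
  note B = B lattice_basisD[OF B(1)] and B' = B' lattice_basisD[OF B'(1)]
  have fin: "finite E" "finite E'"
    using B(2,3) B'(2,3) finite_subset by blast+
  have ind: "independent E" "independent E'"
    using B(2,4) B'(2,4) real_vector.dependent_mono by blast+
  note cone = convex_cone_hull_eq_representation[OF ind(1) fin(1)]
    convex_cone_hull_eq_representation[OF ind(2) fin(2)]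
  define c where "c = representation E' e"
  have eE': "e \<in> convex_cone hull E'"
    using e eq hull_inc by metis
  then have c: "c f \<ge> 0" for f
    by (auto simp: cone c_def)
  have e_eq: "e = (\<Sum>f\<in>E'. c f *\<^sub>R f)"
    using eE' real_vector.sum_representation_eq[of E' e E'] ind fin by (auto simp: cone c_def)
  have E'_cone: "f \<in> span E" "0 \<le> representation E f b" if "f \<in> E'" for f b
    using that eq hull_inc[of f E' convex_cone] by (auto simp: cone(1))
  have "representation E e = (\<lambda>b. \<Sum>f\<in>E'. c f * representation E f b)"
    unfolding e_eq using E'_cone ind
    by (subst real_vector.representation_sum) (auto simp: real_vector.representation_scale span_scale)
  then have rep: "(if b = e then 1 else 0) = (\<Sum>f\<in>E'. c f * representation E f b)" for b
    by (metis e ind(1) real_vector.representation_basis)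
  have "e \<noteq> 0"
    using e ind(1) real_vector.dependent_zero by blast
  then obtain f where f: "f \<in> E'" "c f \<noteq> 0"
    using e_eq by (metis (no_types, lifting) scale_eq_0_iff sum.neutral)
  \<comment> \<open>The sum is zero and all its terms are nonnegative, so each term vanishes; the
    factor \<open>c f\<close> does not.\<close>
  have zero: "representation E f b = 0" if "b \<noteq> e" for b
  proof -
    have "(\<Sum>f\<in>E'. c f * representation E f b) = 0"
      using rep[of b] that by simp
    then have "c f * representation E f b = 0"
      using sum_nonneg_eq_0_iff[OF fin(2), of "\<lambda>f. c f * representation E f b"] f(1) c E'_cone by simp
    then show ?thesis
      using f(2) by simp
  qed
  define t where "t = representation E f e"
  have "f = (\<Sum>b\<in>E. representation E f b *\<^sub>R b)"
    using real_vector.sum_representation_eq[of E f E] E'_cone f ind fin by simp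
  also have "\<dots> = (\<Sum>b\<in>E. if b = e then t *\<^sub>R e else 0)"
    by (intro sum.cong) (auto simp: zero t_def)
  finally have f_eq: "f = t *\<^sub>R e"
    using e fin by simp
  have "f \<noteq> 0"
    using f ind(2) real_vector.dependent_zero by blast
  then have "t \<noteq> 0"
    using f_eq by auto
  moreover have "t \<ge> 0"
    using E'_cone f by (simp add: t_def)
  \<comment> \<open>\<open>t\<close> is the coordinate of \<open>f\<close> at \<open>e\<close> in
    the basis \<open>B\<close>, and \<open>1 / t\<close> below is the coordinate of \<open>e\<close>
    at \<open>f\<close> in the basis \<open>B'\<close>. Both vectors lie in \<open>L\<close>, so
    both numbers are integers.\<close>
  moreover have "t \<in> \<int>"
  proof -
    have "representation B f e = t"
      using e B by (subst f_eq) (auto simp: real_vector.representation_scale real_vector.representation_basis subset_iff)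
    moreover have "f \<in> int_span B"
      using f B B' by auto
    then have "representation B f e \<in> \<int>"
      using B int_span_eq_representation[of B] by blast
    ultimately show ?thesis by simp
  qed
  moreover have "1 / t \<in> \<int>"
  proof -
    have "e = (1 / t) *\<^sub>R f"
      using f_eq \<open>t \<noteq> 0\<close> by simp
    then have "representation B' e f = 1 / t"
      using f B' by (auto simp: real_vector.representation_scale real_vector.representation_basis subset_iff)
    moreover have "e \<in> int_span B'"
      using e B B' by auto
    then have "representation B' e f \<in> \<int>"
      using B' int_span_eq_representation[of B'] by blast
    ultimately show ?thesis by simp
  qed
  ultimately have "t = 1"
    by (elim Ints_cases) (auto simp: field_simps pos_zmult_eq_1_iff simp flip: of_int_mult)
  then show "e \<in> E'"
    using f_eq f by simp
qed

lemma part_of_basis_eq_if_cone_eq: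
  assumes "part_of_basis L E" "part_of_basis L E'" "convex_cone hull E = convex_cone hull E'"
  shows "E = E'"
  using assms convex_cone_hull_subset_imp_generators_subset
  unfolding part_of_basis_def by (metis subset_antisym)

lemma lattice_generators_convex_cone_hull:
  assumes "part_of_basis L E"
  shows "lattice_generators L (convex_cone hull E) = E"
  unfolding lattice_generators_def
  by (rule the_equality) (use assms part_of_basis_eq_if_cone_eq in auto)

section \<open>Dimension and faces of cones over independent sets\<close>

lemma dim_convex_cone_hull:
  fixes E :: "'v::euclidean_space set"
  assumes "independent E"
  shows "dim (convex_cone hull E) = card E"
proof -
  have "E \<subseteq> convex_cone hull E"
    by (rule hull_subset)
  moreover have "convex_cone hull E \<subseteq> span E"
    by (intro hull_minimal span_superset convex_cone_span)
  ultimately show ?thesis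
    using assms by (metis dim_eq_card_independent dim_span dim_subset order_antisym)
qed

text \<open>The smaller cone is cut out of the larger one by the vanishing of the coordinates
  outside \<open>E\<close>, and a combination of nonnegative numbers with positive weights vanishes
  only if each of them does.\<close>

lemma convex_cone_hull_face_of:
  fixes B :: "'v::euclidean_space set"
  assumes B: "independent B" and E: "E \<subseteq> B"
  shows "convex_cone hull E face_of convex_cone hull B"
proof -
  have fin: "finite B" "finite E"
    using independent_imp_finite[OF B] finite_subset[OF E] by simp_all
  have ind: "independent E"
    using B E real_vector.dependent_mono by blast
  note cone = convex_cone_hull_eq_representation[OF B fin(1)]
  have cone_E: "x \<in> convex_cone hull E \<longleftrightarrow> x \<in> convex_cone hull B \<and> (\<forall>b. b \<notin> E \<longrightarrow> representation B x b = 0)" for x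
  proof (intro iffI conjI)
    assume x: "x \<in> convex_cone hull E"
    then show "x \<in> convex_cone hull B"
      using E hull_mono by blast
    have "x \<in> span E"
      using x by (simp add: convex_cone_hull_eq_representation fin ind)
    then show "\<forall>b. b \<notin> E \<longrightarrow> representation B x b = 0"
      using real_vector.representation_extend[OF B _ E] real_vector.representation_ne_zero by metis
  next
    assume x: "x \<in> convex_cone hull B \<and> (\<forall>b. b \<notin> E \<longrightarrow> representation B x b = 0)"
    have "x = (\<Sum>b\<in>B. representation B x b *\<^sub>R b)"
      using real_vector.sum_representation_eq[of B x B] x B fin by (simp add: cone)
    also have "\<dots> = (\<Sum>b\<in>E. representation B x b *\<^sub>R b)"
      by (rule sum.mono_neutral_right) (use x E fin in auto)
    finally have eq: "x = (\<Sum>b\<in>E. representation B x b *\<^sub>R b)" .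
    then have "representation E x = (\<lambda>b. if b \<in> E then representation B x b else 0)"
      using representation_sum_scaleR[OF ind fin(2), of "representation B x"] by simp
    moreover have "x \<in> span E"
      by (subst eq) (intro span_sum span_scale span_base)
    ultimately show "x \<in> convex_cone hull E"
      using x fin ind by (simp add: convex_cone_hull_eq_representation cone)
  qed
  show ?thesis
    unfolding face_of_def
  proof (intro conjI ballI impI)
    show "convex_cone hull E \<subseteq> convex_cone hull B"
      using E hull_mono by blast
    show "convex (convex_cone hull E)"
      by (rule convex_convex_cone_hull)
    fix x y z
    assume x: "x \<in> convex_cone hull B" and y: "y \<in> convex_cone hull B"
      and z: "z \<in> convex_cone hull E" "z \<in> open_segment x y"
    obtain u where u: "0 < u" "u < 1" "z = (1 - u) *\<^sub>R x + u *\<^sub>R y"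
      using z(2) by (auto simp: in_segment)
    have "representation B x b = 0 \<and> representation B y b = 0" if "b \<notin> E" for b
    proof -
      have "representation B z b = (1 - u) * representation B x b + u * representation B y b"
        using x y B unfolding u(3)
        by (simp add: cone real_vector.representation_add real_vector.representation_scale span_scale)
      moreover have "representation B z b = 0"
        using z(1) that cone_E by blast
      moreover have "0 \<le> representation B x b" "0 \<le> representation B y b"
        using x y by (auto simp: cone)
      ultimately show ?thesis
        using u(1,2) by (simp add: add_nonneg_eq_0_iff)
    qed
    then show "x \<in> convex_cone hull E" "y \<in> convex_cone hull E"
      using x y cone_E by auto
  qed
qed

text \<open>If a point of the face has a positive coordinate at \<open>b\<close>, it is the midpoint
  of a positive multiple of \<open>b\<close> and of twice the remainder of its expansion, so the
  face property puts \<open>b\<close> into \<open>C\<close>. The assumption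
  \<open>convex_cone C\<close> rules out the empty face.\<close>

lemma face_of_convex_cone_hull_eq:
  fixes B :: "'v::euclidean_space set"
  assumes B: "independent B" and face: "C face_of convex_cone hull B" and C: "convex_cone C"
  shows "C = convex_cone hull (B \<inter> C)"
proof
  show "convex_cone hull (B \<inter> C) \<subseteq> C"
    by (rule hull_minimal) (use C in auto)
next
  have fin: "finite B"
    using B by (rule independent_imp_finite)
  note cone = convex_cone_hull_eq_representation[OF B fin(1)]
  show "C \<subseteq> convex_cone hull (B \<inter> C)"
  proof
    fix x assume x: "x \<in> C"
    then have xB: "x \<in> convex_cone hull B"
      using face face_of_imp_subset by blast
    define c where "c = representation B x"
    have c: "c b \<ge> 0" for b
      using xB by (auto simp: cone c_def)
    have x_eq: "x = (\<Sum>b\<in>B. c b *\<^sub>R b)"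
      using real_vector.sum_representation_eq[of B x B] xB B fin by (simp add: cone c_def)
    have pos: "b \<in> C" if b: "b \<in> B" "c b > 0" for b
    proof -
      define y where "y = (2 * c b) *\<^sub>R b"
      define z where "z = 2 *\<^sub>R (\<Sum>b\<in>B - {b}. c b *\<^sub>R b)"
      have y: "y \<in> convex_cone hull B"
        unfolding y_def using b by (intro convex_cone_hull_mul hull_inc) auto
      have "(\<Sum>b\<in>D. c b *\<^sub>R b) \<in> convex_cone hull B" if "finite D" "D \<subseteq> B" for D
        using that
        by (induction D rule: finite_induct)
          (auto simp: convex_cone_hull_contains_0 convex_cone_hull_add convex_cone_hull_mul hull_inc c)
      then have z: "z \<in> convex_cone hull B"
        unfolding z_def using fin by (intro convex_cone_hull_mul) auto
      have x_mid: "x = midpoint y z"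
        unfolding x_eq y_def z_def midpoint_def using b fin by (simp add: sum.remove scaleR_right_distrib)
      \<comment> \<open>For \<open>y = z\<close> there is no open segment to which the face property
        could apply, but then \<open>y\<close> is \<open>x\<close> itself.\<close>
      have "y \<in> C"
      proof (cases "y = z")
        case True
        then show ?thesis using x x_mid by simp
      next
        case False
        then have "x \<in> open_segment y z"
          by (simp add: x_mid)
        then show ?thesis
          using face_ofD[OF face] y z x by blast
      qed
      then have "(1 / (2 * c b)) *\<^sub>R y \<in> C"
        using C b by (intro convex_cone_scaleR) auto
      then show ?thesis
        using b by (simp add: y_def)
    qed
    have "(\<Sum>b\<in>D. c b *\<^sub>R b) \<in> convex_cone hull (B \<inter> C)" if "finite D" "D \<subseteq> B" for D
      using that
    proof (induction D rule: finite_induct)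
      case (insert d D)
      have "c d *\<^sub>R d \<in> convex_cone hull (B \<inter> C)"
      proof (cases "c d = 0")
        case True
        then show ?thesis by (simp add: convex_cone_hull_contains_0)
      next
        case False
        then have "d \<in> B \<inter> C"
          using pos[of d] c[of d] insert by auto
        then show ?thesis
          using c by (intro convex_cone_hull_mul hull_inc) auto
      qed
      then show ?case
        using insert by (simp add: convex_cone_hull_add)
    qed (auto simp: convex_cone_hull_contains_0)
    then show "x \<in> convex_cone hull (B \<inter> C)"
      using x_eq fin by auto
  qed
qed

text \<open>A basis vector has a single nonzero coordinate, the sum has one for each member of
  \<open>F\<close>. Hence the ray inserted by a star subdivision is new, and later case distinctions
  on \<open>e = \<Sum>F\<close> do not clash with members of \<open>B\<close>.\<close>

lemma sum_notin_independent:
  fixes B :: "'v::real_vector set"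
  assumes B: "independent B" "finite B" and F: "F \<subseteq> B" "2 \<le> card F"
  shows "\<Sum>F \<notin> B"
proof
  assume *: "\<Sum>F \<in> B"
  have "(\<Sum>b\<in>B. (if b \<in> F then 1 else 0) *\<^sub>R b) = \<Sum>F"
    using assms by (simp add: if_distrib[of "\<lambda>c. c *\<^sub>R _"] sum.inter_restrict[symmetric] Int_absorb1 cong: if_cong)
  then have "representation B (\<Sum>F) = (\<lambda>b. if b \<in> B then if b \<in> F then 1 else 0 else 0)"
    using representation_sum_scaleR[OF B] by metis
  then have "(if b = \<Sum>F then 1 else 0 :: real) = (if b \<in> F then 1 else 0)" for b
    using real_vector.representation_basis[OF B(1) *] F by (metis subset_iff)
  then have "b = \<Sum>F" if "b \<in> F" for b
    using that by (metis zero_neq_one)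
  then have "F \<subseteq> {\<Sum>F}"
    by blast
  then have "card F \<le> 1"
    using card_mono[of "{\<Sum>F}" F] by simp
  then show False
    using F by simp
qed

text \<open>The exchange is invertible over the integers: \<open>f\<close> is the sum minus the
  other members of \<open>F\<close>.\<close>

lemma lattice_basis_replace_sum:
  fixes B :: "(real^'n) set"
  assumes B: "lattice_basis L B" and F: "F \<subseteq> B" "2 \<le> card F" "f \<in> F"
  shows "lattice_basis L (insert (\<Sum>F) (B - {f}))"
proof -
  note B' = lattice_basisD[OF B]
  let ?B = "insert (\<Sum>F) (B - {f})"
  have fF: "finite F"
    using F B' by (auto intro: finite_subset)
  have notin: "\<Sum>F \<notin> B"
    using sum_notin_independent B' F by blast
  have card: "card ?B = CARD('n)"
    using notin B' F by (metis DiffD1 card.insert_remove finite_Diff insert_Diff_single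
        card_insert_disjoint insert_Diff subset_iff)
  have f_eq: "f = \<Sum>F + (\<Sum>e\<in>F - {f}. - e)"
    using F fF by (simp add: sum.remove sum_negf)
  have span: "span ?B = UNIV"
  proof -
    have "f \<in> span ?B"
    proof (subst f_eq, rule span_add)
      show "\<Sum>F \<in> span ?B" by (intro span_base) simp
      show "(\<Sum>e\<in>F - {f}. - e) \<in> span ?B"
        using F by (intro span_sum span_neg span_base) auto
    qed
    then have "B \<subseteq> span ?B"
      by (auto intro: span_base)
    then show ?thesis
      using B' by (metis span_mono span_span top.extremum_uniqueI)
  qed
  have "independent ?B"
    using card span B' by (intro card_le_dim_spanning[of _ UNIV]) auto
  moreover have "int_span ?B = int_span B"
  proof
    show "int_span ?B \<subseteq> int_span B"
      using F B' by (intro int_span_subset) (auto intro!: int_span_sum[of _ "\<lambda>x. x"] int_span_base)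
    have "f \<in> int_span ?B"
    proof (subst f_eq, rule int_span_add)
      show "\<Sum>F \<in> int_span ?B" using B' by (intro int_span_base) auto
      show "(\<Sum>e\<in>F - {f}. - e) \<in> int_span ?B"
        using F B' by (intro int_span_sum int_span_minus int_span_base) auto
    qed
    then show "int_span B \<subseteq> int_span ?B"
      using B' by (intro int_span_subset) (auto intro: int_span_base)
  qed
  ultimately show ?thesis
    using card B' by (simp add: lattice_basis_def)
qed

lemma lattice_basis_linear_image:
  fixes g :: "real^'n \<Rightarrow> real^'n"
  assumes "lattice_basis L B" "linear g" "inj g"
  shows "lattice_basis (g ` L) (g ` B)"
proof -
  note B = lattice_basisD[OF assms(1)]
  have "inj_on g B"
    using assms(3) inj_on_subset by blast
  have "g ` int_span B = int_span (g ` B)"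
  proof (rule subset_antisym; rule subsetI)
    fix y assume "y \<in> g ` int_span B"
    then obtain c :: "_ \<Rightarrow> int" where "y = g (\<Sum>v\<in>B. of_int (c v) *\<^sub>R v)"
      by (auto simp: int_span_def)
    then have "y = (\<Sum>v\<in>g ` B. of_int (c (inv_into B g v)) *\<^sub>R v)"
      using assms \<open>inj_on g B\<close> by (simp add: linear_sum linear_cmul sum.reindex)
    then show "y \<in> int_span (g ` B)"
      unfolding int_span_def by (intro CollectI exI[of _ "\<lambda>v. c (inv_into B g v)"]) simp
  next
    fix y assume "y \<in> int_span (g ` B)"
    then obtain c :: "_ \<Rightarrow> int" where "y = (\<Sum>v\<in>g ` B. of_int (c v) *\<^sub>R v)"
      by (auto simp: int_span_def)
    then have "y = g (\<Sum>v\<in>B. of_int (c (g v)) *\<^sub>R v)"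
      using assms \<open>inj_on g B\<close> by (simp add: linear_sum linear_cmul sum.reindex)
    moreover have "(\<Sum>v\<in>B. of_int (c (g v)) *\<^sub>R v) \<in> int_span B"
      unfolding int_span_def by (intro CollectI exI[of _ "\<lambda>v. c (g v)"]) simp
    ultimately show "y \<in> g ` int_span B"
      by blast
  qed
  then show ?thesis
    using B assms \<open>inj_on g B\<close>
      linear_independent_injective_image[OF assms(2) B(2)] inj_on_subset[OF assms(3)]
    by (simp add: lattice_basis_def card_image)
qed

section \<open>Subgroups of free abelian groups and their cosets\<close>

context
  fixes R :: "('s \<Rightarrow>\<^sub>0 int) set" and S
  assumes R: "subgroup R (free_Abelian_group S)"
begin

lemma frag_subgroup_zero: "0 \<in> R"
  using subgroup.one_closed[OF R] by simp

lemma frag_subgroup_add: "x \<in> R \<Longrightarrow> y \<in> R \<Longrightarrow> x + y \<in> R"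
  using subgroup.m_closed[OF R] by simp

lemma frag_subgroup_minus: "x \<in> R \<Longrightarrow> - x \<in> R"
  using subgroup.m_inv_closed[OF R] subgroup.mem_carrier[OF R] by fastforce

lemma frag_subgroup_diff: "x \<in> R \<Longrightarrow> y \<in> R \<Longrightarrow> x - y \<in> R"
  using frag_subgroup_add[OF _ frag_subgroup_minus] by simp

lemma frag_subgroup_sum: "(\<And>i. i \<in> I \<Longrightarrow> f i \<in> R) \<Longrightarrow> sum f I \<in> R"
  by (induction I rule: infinite_finite_induct) (auto simp: frag_subgroup_zero frag_subgroup_add)

lemma frag_subgroup_cancel: "x - y \<in> R \<Longrightarrow> y \<in> R \<longleftrightarrow> x \<in> R"
  using frag_subgroup_add[of "x - y" y] frag_subgroup_diff[of x "x - y"] by auto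

lemma frag_subgroup_trans: "x - y \<in> R \<Longrightarrow> y - z \<in> R \<Longrightarrow> x - z \<in> R"
  using frag_subgroup_add[of "x - y" "y - z"] by simp

lemma frag_subgroup_sym: "x - y \<in> R \<Longrightarrow> y - x \<in> R"
  using frag_subgroup_minus[of "x - y"] by simp

lemma frag_subgroup_sum_diff:
  assumes "\<And>i. i \<in> I \<Longrightarrow> f i - g i \<in> R"
  shows "sum f I - sum g I \<in> R"
  using frag_subgroup_sum[of I "\<lambda>i. f i - g i"] assms by (simp add: sum_subtractf)

text \<open>The coset may be formed in the free group on any \<open>S'\<close>, since the operation
  is addition of finitely supported functions whatever the set of generators.\<close>

lemma frag_coset_eq_iff:
  "R #>\<^bsub>free_Abelian_group S'\<^esub> x = R #>\<^bsub>free_Abelian_group S'\<^esub> y \<longleftrightarrow> x - y \<in> R"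
proof -
  have mem: "z \<in> R #>\<^bsub>free_Abelian_group S'\<^esub> u \<longleftrightarrow> z - u \<in> R" for z u
    unfolding r_coset_def by (auto simp: algebra_simps intro: bexI[of _ "z - u"])
  show ?thesis
  proof
    assume "R #>\<^bsub>free_Abelian_group S'\<^esub> x = R #>\<^bsub>free_Abelian_group S'\<^esub> y"
    then have "x \<in> R #>\<^bsub>free_Abelian_group S'\<^esub> y"
      using mem[of x x] frag_subgroup_zero by simp
    then show "x - y \<in> R" by (simp add: mem)
  next
    assume *: "x - y \<in> R"
    have "z - x \<in> R \<longleftrightarrow> z - y \<in> R" for z
      using frag_subgroup_cancel[of "z - y" "z - x"] * by simp
    then show "R #>\<^bsub>free_Abelian_group S'\<^esub> x = R #>\<^bsub>free_Abelian_group S'\<^esub> y"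
      by (auto simp: mem)
  qed
qed

end

lemma mem_frag_coset_iff: "z \<in> R #>\<^bsub>free_Abelian_group S\<^esub> u \<longleftrightarrow> z - u \<in> R"
  unfolding r_coset_def by (auto simp: algebra_simps intro: bexI[of _ "z - u"])

lemma frag_extend_frag_of_hom:
  assumes "\<And>x. x \<in> S \<Longrightarrow> f x \<in> carrier (free_Abelian_group T)"
  shows "frag_extend f \<in> hom (free_Abelian_group S) (free_Abelian_group T)"
proof (rule homI)
  fix x assume "x \<in> carrier (free_Abelian_group S)"
  then show "frag_extend f x \<in> carrier (free_Abelian_group T)"
    using keys_frag_extend[of f x] assms by fastforce
qed (simp add: frag_extend_add)

text \<open>Reduces the check that a homomorphism respects relations to the relators that generate
  them.\<close>

lemma frag_hom_generate_subset:
  assumes h: "h \<in> hom (free_Abelian_group S) G" and G: "group G"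
    and X: "X \<subseteq> carrier (free_Abelian_group S)" and R: "subgroup R G" and hX: "h ` X \<subseteq> R"
  shows "h ` generate (free_Abelian_group S) X \<subseteq> R"
proof -
  interpret group_hom "free_Abelian_group S" G h
    using h G by (simp add: group_hom_def group_hom_axioms_def)
  have "h ` generate (free_Abelian_group S) X = generate G (h ` X)"
    by (rule generate_img[OF X, symmetric])
  also have "\<dots> \<subseteq> R"
    by (rule group.generate_subgroup_incl[OF G hX R])
  finally show ?thesis .
qed

section \<open>Tensor products with a lattice\<close>

lemma tensor_relators_subset:
  assumes "monoid M" "monoid N"
  shows "tensor_relators M N \<subseteq> carrier (free_Abelian_group (carrier M \<times> carrier N))"
  unfolding tensor_relators_def
  using monoid.m_closed[OF assms(1)] monoid.m_closed[OF assms(2)]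
  by (auto dest!: subsetD[OF keys_diff] subsetD[OF keys_add] simp: keys_frag_of)

lemma subgroup_tensor_relations:
  assumes "monoid M" "monoid N"
  shows "subgroup (tensor_relations M N) (free_Abelian_group (carrier M \<times> carrier N))"
  unfolding tensor_relations_def
  by (intro group.generate_is_subgroup tensor_relators_subset assms group_free_Abelian_group)

lemma tensor_relation_left:
  assumes "x \<in> carrier M" "y \<in> carrier M" "a \<in> carrier N"
  shows "frag_of (x \<otimes>\<^bsub>M\<^esub> y, a) - (frag_of (x, a) + frag_of (y, a)) \<in> tensor_relations M N"
  unfolding tensor_relations_def tensor_relators_def using assms by (intro generate.incl) blast

lemma tensor_relation_right:
  assumes "x \<in> carrier M" "a \<in> carrier N" "b \<in> carrier N"
  shows "frag_of (x, a \<otimes>\<^bsub>N\<^esub> b) - (frag_of (x, a) + frag_of (x, b)) \<in> tensor_relations M N"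
  unfolding tensor_relations_def tensor_relators_def using assms by (intro generate.incl) blast

text \<open>A homomorphism carries bilinearity relators to relations, so two representatives of a
  coset have images that differ by relations; saturating the image then gives one coset, that of the
  image of any representative.\<close>

lemma tensor_map_coset:
  assumes M: "monoid M" "monoid M'" and N: "monoid N" and f: "f \<in> hom M' M"
    and u: "u \<in> carrier (free_Abelian_group (carrier M' \<times> carrier N))"
  shows "tensor_map f M N (tensor_relations M' N #>\<^bsub>free_Abelian_group (carrier M' \<times> carrier N)\<^esub> u) =
    tensor_relations M N #>\<^bsub>free_Abelian_group (carrier M \<times> carrier N)\<^esub>
      frag_extend (\<lambda>(x, a). frag_of (f x, a)) u"
proof -
  let ?F' = "free_Abelian_group (carrier M' \<times> carrier N)" and ?F = "free_Abelian_group (carrier M \<times> carrier N)"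
  let ?h = "frag_extend (\<lambda>(x, a). frag_of (f x, a))"
  let ?R' = "tensor_relations M' N" and ?R = "tensor_relations M N"
  note R = subgroup_tensor_relations[OF M(1) N]
  have fM: "f x \<in> carrier M" if "x \<in> carrier M'" for x
    using f that by (rule hom_in_carrier)
  have h: "?h \<in> hom ?F' ?F"
    by (rule frag_extend_frag_of_hom) (auto simp: fM)
  have "?h ` tensor_relators M' N \<subseteq> ?R"
    unfolding tensor_relators_def
    using tensor_relation_left[of _ M _ _ N] tensor_relation_right[of _ M _ N] fM hom_mult[OF f]
    by (auto simp: frag_extend_diff frag_extend_add)
  then have hR: "?h ` ?R' \<subseteq> ?R"
    unfolding tensor_relations_def[of M']
    by (intro frag_hom_generate_subset[OF h _ tensor_relators_subset[OF M(2) N] R]) simp_all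
  show ?thesis
    unfolding tensor_map_def
  proof (rule subset_antisym; rule subsetI)
    fix z assume "z \<in> ?R <#>\<^bsub>?F\<^esub> ?h ` (?R' #>\<^bsub>?F'\<^esub> u)"
    then obtain r v where r: "r \<in> ?R" and v: "v - u \<in> ?R'" and z: "z = r + ?h v"
      unfolding set_mult_def by (auto simp: mem_frag_coset_iff)
    have "?h v - ?h u \<in> ?R"
      using hR v by (auto simp flip: frag_extend_diff)
    then have "r + (?h v - ?h u) \<in> ?R"
      by (intro frag_subgroup_add[OF R] r)
    then show "z \<in> ?R #>\<^bsub>?F\<^esub> ?h u"
      by (simp add: z mem_frag_coset_iff algebra_simps)
  next
    fix z assume "z \<in> ?R #>\<^bsub>?F\<^esub> ?h u"
    then have "z - ?h u \<in> ?R"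
      by (simp add: mem_frag_coset_iff)
    moreover have "u \<in> ?R' #>\<^bsub>?F'\<^esub> u"
      using frag_subgroup_zero[OF subgroup_tensor_relations[OF M(2) N]] by (simp add: mem_frag_coset_iff)
    ultimately show "z \<in> ?R <#>\<^bsub>?F\<^esub> ?h ` (?R' #>\<^bsub>?F'\<^esub> u)"
      unfolding set_mult_def by (auto intro!: bexI[of _ "z - ?h u"] bexI[of _ u])
  qed
qed

lemma lattice_group_simps [simp]:
  "carrier (lattice_group L) = L" "x \<otimes>\<^bsub>lattice_group L\<^esub> y = x + y" "\<one>\<^bsub>lattice_group L\<^esub> = 0"
  by (simp_all add: lattice_group_def)

lemma group_lattice_group_int_span: "group (lattice_group (int_span B))"
  by (rule groupI) (auto simp: int_span_zero int_span_add add.assoc intro!: bexI[of _ "- x" for x] int_span_minus)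

text \<open>Closure is required only under differences, the form that induction on free abelian
  groups also has; negatives arise as \<open>0 - x\<close> and sums as
  \<open>x - (- y)\<close>.\<close>

lemma int_span_induct [consumes 1, case_names zero base diff]:
  assumes "x \<in> int_span B" "P 0" "\<And>b. b \<in> B \<Longrightarrow> P b"
    and diff: "\<And>x y. x \<in> int_span B \<Longrightarrow> y \<in> int_span B \<Longrightarrow> P x \<Longrightarrow> P y \<Longrightarrow> P (x - y)"
    and fin: "finite B"
  shows "P x"
proof -
  have minus: "P (- x)" if "x \<in> int_span B" "P x" for x
    using diff[OF int_span_zero that(1) \<open>P 0\<close> that(2)] by simp
  have add: "P (x + y)" if "x \<in> int_span B" "y \<in> int_span B" "P x" "P y" for x y
    using diff[OF that(1) int_span_minus[OF that(2)] that(3) minus[OF that(2,4)]] by simp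
  have nat: "P (of_nat n *\<^sub>R b)" if "b \<in> B" for n b
  proof (induction n)
    case (Suc n)
    have "of_nat n *\<^sub>R b \<in> int_span B"
      using int_span_scale[of b B "int n"] int_span_base[OF fin that] by simp
    then show ?case
      using add[of b "of_nat n *\<^sub>R b"] Suc assms(3) that int_span_base[OF fin that]
      by (simp add: scaleR_left_distrib)
  qed (simp add: \<open>P 0\<close>)
  have int: "P (of_int k *\<^sub>R b)" if "b \<in> B" for k b
  proof (cases k rule: int_cases2)
    case (nonneg n)
    then show ?thesis using nat that by simp
  next
    case (nonpos n)
    then show ?thesis
      using minus[of "of_nat n *\<^sub>R b"] nat that int_span_scale[of b B "int n"] int_span_base[OF fin that] by simp
  qed
  obtain c :: "_ \<Rightarrow> int" where x: "x = (\<Sum>v\<in>B. of_int (c v) *\<^sub>R v)"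
    using assms(1) by (auto simp: int_span_def)
  have "P (\<Sum>v\<in>C. of_int (c v) *\<^sub>R v)" if "finite C" "C \<subseteq> B" for C
    using that
  proof (induction C rule: finite_induct)
    case (insert b C)
    then show ?case
      using fin by (auto intro!: add int int_span_sum int_span_scale int_span_base)
  qed (simp add: \<open>P 0\<close>)
  then show ?thesis
    using fin x by simp
qed

section \<open>Expansion of tensors along generators of the lattice\<close>

locale coefficient_group = A: comm_group A for A :: "('c, 'k) monoid_scheme"
begin

abbreviation tensor_rel :: "'v::real_vector set \<Rightarrow> ('v \<times> 'c \<Rightarrow>\<^sub>0 int) set"
  where "tensor_rel L \<equiv> tensor_relations (lattice_group L) A"

abbreviation tensor_frags :: "'v::real_vector set \<Rightarrow> ('v \<times> 'c \<Rightarrow>\<^sub>0 int) monoid"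
  where "tensor_frags L \<equiv> free_Abelian_group (L \<times> carrier A)"

definition expansion :: "'v set \<Rightarrow> ('v \<Rightarrow> 'c) \<Rightarrow> 'v \<times> 'c \<Rightarrow>\<^sub>0 int"
  where "expansion B a = (\<Sum>e\<in>B. frag_of (e, a e))"

text \<open>The sum of the tensors of \<open>e\<close> with \<open>a e\<close>, kept as one coset so
  that congruences can be computed on representatives; \<open>tensor_sum_finprod\<close> identifies
  it with the product of pure tensors in \<open>triple_symbol\<close>.\<close>

definition tensor_sum :: "'v::real_vector set \<Rightarrow> 'v set \<Rightarrow> ('v \<Rightarrow> 'c) \<Rightarrow> ('v \<times> 'c \<Rightarrow>\<^sub>0 int) set"
  where "tensor_sum L B a = tensor_rel L #>\<^bsub>tensor_frags L\<^esub> expansion B a"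

lemma expansion_closed:
  assumes "B \<subseteq> L" "a \<in> B \<rightarrow> carrier A"
  shows "expansion B a \<in> carrier (tensor_frags L)"
  unfolding expansion_def
  by (rule sum_closed_free_Abelian_group) (use assms in auto)

lemma expansion_cong: "(\<And>e. e \<in> B \<Longrightarrow> a e = b e) \<Longrightarrow> expansion B a = expansion B b"
  unfolding expansion_def by simp

context
  fixes L :: "'v::real_vector set" and C :: "'v set"
  assumes L: "L = int_span C" and C: "finite C"
begin

lemma subgroup_tensor_rel: "subgroup (tensor_rel L) (tensor_frags L)"
  using subgroup_tensor_relations[of "lattice_group L" A] group_lattice_group_int_span[of C]
  by (simp add: L group.is_monoid)

lemma tensor_rel_left:
  "x \<in> L \<Longrightarrow> y \<in> L \<Longrightarrow> a \<in> carrier A \<Longrightarrow> frag_of (x + y, a) - (frag_of (x, a) + frag_of (y, a)) \<in> tensor_rel L"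
  using tensor_relation_left[of x "lattice_group L" y a A] by simp

lemma tensor_rel_right:
  "x \<in> L \<Longrightarrow> a \<in> carrier A \<Longrightarrow> b \<in> carrier A \<Longrightarrow>
    frag_of (x, a \<otimes>\<^bsub>A\<^esub> b) - (frag_of (x, a) + frag_of (x, b)) \<in> tensor_rel L"
  using tensor_relation_right[of x "lattice_group L" a A b] by simp

text \<open>Additivity in the second argument at the pair of neutral elements gives a relator that
  collapses to minus the generator.\<close>

lemma tensor_rel_one: "x \<in> L \<Longrightarrow> frag_of (x, \<one>\<^bsub>A\<^esub>) \<in> tensor_rel L"
  using frag_subgroup_minus[OF subgroup_tensor_rel tensor_rel_right[of x "\<one>\<^bsub>A\<^esub>" "\<one>\<^bsub>A\<^esub>"]] by simp

lemma tensor_rel_zero: "a \<in> carrier A \<Longrightarrow> frag_of (0, a) \<in> tensor_rel L"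
  using frag_subgroup_minus[OF subgroup_tensor_rel tensor_rel_left[of 0 0 a]] int_span_zero[of C] by (simp add: L)

lemma tensor_rel_right_diff:
  assumes "x \<in> L" "a \<in> carrier A" "b \<in> carrier A"
  shows "frag_of (x, a \<otimes>\<^bsub>A\<^esub> inv\<^bsub>A\<^esub> b) - (frag_of (x, a) - frag_of (x, b)) \<in> tensor_rel L"
proof -
  have "a \<otimes>\<^bsub>A\<^esub> inv\<^bsub>A\<^esub> b \<otimes>\<^bsub>A\<^esub> b = a"
    using assms by (simp add: A.m_assoc)
  then show ?thesis
    using frag_subgroup_minus[OF subgroup_tensor_rel tensor_rel_right[of x "a \<otimes>\<^bsub>A\<^esub> inv\<^bsub>A\<^esub> b" b]] assms
    by (simp add: algebra_simps)
qed

lemma tensor_rel_left_diff: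
  assumes "x \<in> L" "y \<in> L" "a \<in> carrier A"
  shows "frag_of (x - y, a) - (frag_of (x, a) - frag_of (y, a)) \<in> tensor_rel L"
proof -
  have "x - y \<in> L"
    using assms int_span_add[of x C "- y"] int_span_minus[of y C] by (simp add: L)
  then show ?thesis
    using frag_subgroup_minus[OF subgroup_tensor_rel tensor_rel_left[of "x - y" y a]] assms
    by (simp add: algebra_simps)
qed

lemma tensor_rel_sum_left:
  assumes "finite F" "F \<subseteq> L" "a \<in> carrier A"
  shows "frag_of (\<Sum>F, a) - (\<Sum>e\<in>F. frag_of (e, a)) \<in> tensor_rel L"
  using assms
proof (induction F rule: finite_induct)
  case empty
  then show ?case using tensor_rel_zero by simp
next
  case (insert x F)
  have "\<Sum>F \<in> L"
    using insert.prems int_span_sum[of F "\<lambda>x. x" C] by (auto simp: L)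
  then have "frag_of (x + \<Sum>F, a) - (frag_of (x, a) + frag_of (\<Sum>F, a)) \<in> tensor_rel L"
    using insert.prems by (intro tensor_rel_left) auto
  from frag_subgroup_add[OF subgroup_tensor_rel this insert.IH] insert.prems show ?case
    using insert.hyps by (simp add: algebra_simps)
qed

lemma expansion_diff:
  assumes "B \<subseteq> L" "a \<in> B \<rightarrow> carrier A" "b \<in> B \<rightarrow> carrier A"
  shows "expansion B (\<lambda>e. a e \<otimes>\<^bsub>A\<^esub> inv\<^bsub>A\<^esub> b e) - (expansion B a - expansion B b) \<in> tensor_rel L"
  unfolding expansion_def sum_subtractf[symmetric]
  by (intro frag_subgroup_sum[OF subgroup_tensor_rel] tensor_rel_right_diff) (use assms in auto)

lemma expansion_restrict:
  assumes "finite B" "B \<subseteq> L" "E \<subseteq> B" "\<And>e. e \<in> B - E \<Longrightarrow> a e = \<one>\<^bsub>A\<^esub>"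
  shows "expansion B a - expansion E a \<in> tensor_rel L"
proof -
  have "expansion B a - expansion E a = (\<Sum>e\<in>B - E. frag_of (e, a e))"
    unfolding expansion_def using sum.subset_diff[OF assms(3,1), of "\<lambda>e. frag_of (e, a e)"] by simp
  also have "\<dots> \<in> tensor_rel L"
    by (intro frag_subgroup_sum[OF subgroup_tensor_rel]) (use assms tensor_rel_one in auto)
  finally show ?thesis .
qed

text \<open>The elements with such an expansion are closed under congruence and differences, which
  leaves a single generator \<open>(x, c)\<close>, treated by induction on \<open>x\<close> in the
  integer span. This is existence only; uniqueness over a basis is
  \<open>tensor_sum_eqD\<close>.\<close>

lemma tensor_expansion_exists:
  assumes "u \<in> carrier (tensor_frags L)"
  obtains a where "a \<in> C \<rightarrow> carrier A" "u - expansion C a \<in> tensor_rel L"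
proof -
  define Q where "Q u \<longleftrightarrow> (\<exists>a\<in>C \<rightarrow> carrier A. u - expansion C a \<in> tensor_rel L)" for u
  have CL: "C \<subseteq> L"
    using L C int_span_base by blast
  have Q_cong: "Q v" if "Q u" "v - u \<in> tensor_rel L" for u v
    using that frag_subgroup_trans[OF subgroup_tensor_rel] unfolding Q_def by blast
  have Q_diff: "Q (u - v)" if uv: "Q u" "Q v" for u v
  proof -
    obtain a b where a: "a \<in> C \<rightarrow> carrier A" "u - expansion C a \<in> tensor_rel L"
      and b: "b \<in> C \<rightarrow> carrier A" "v - expansion C b \<in> tensor_rel L"
      using uv by (auto simp: Q_def)
    have "(u - expansion C a) - (v - expansion C b)
        - (expansion C (\<lambda>e. a e \<otimes>\<^bsub>A\<^esub> inv\<^bsub>A\<^esub> b e) - (expansion C a - expansion C b)) \<in> tensor_rel L"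
      using a b CL by (intro frag_subgroup_diff[OF subgroup_tensor_rel _ expansion_diff]
          frag_subgroup_diff[OF subgroup_tensor_rel a(2) b(2)])
    then have "u - v - expansion C (\<lambda>e. a e \<otimes>\<^bsub>A\<^esub> inv\<^bsub>A\<^esub> b e) \<in> tensor_rel L"
      by (simp add: algebra_simps)
    moreover have "(\<lambda>e. a e \<otimes>\<^bsub>A\<^esub> inv\<^bsub>A\<^esub> b e) \<in> C \<rightarrow> carrier A"
      using a(1) b(1) by auto
    ultimately show ?thesis
      unfolding Q_def by (rule rev_bexI[rotated])
  qed
  have Q_zero: "Q 0"
    using expansion_restrict[OF C CL, of "{}" "\<lambda>_. \<one>\<^bsub>A\<^esub>"] frag_subgroup_minus[OF subgroup_tensor_rel]
    unfolding Q_def by (intro bexI[of _ "\<lambda>_. \<one>\<^bsub>A\<^esub>"]) (auto simp: expansion_def)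
  have Q_base: "Q (frag_of (x, c))" if x: "x \<in> int_span C" and c: "c \<in> carrier A" for x c
    using x
  proof (induction rule: int_span_induct)
    case zero
    then show ?case
      using Q_cong[OF Q_zero] tensor_rel_zero c by simp
  next
    case (base b)
    let ?a = "\<lambda>e. if e = b then c else \<one>\<^bsub>A\<^esub>"
    have "expansion C ?a - expansion {b} ?a \<in> tensor_rel L"
      using base by (intro expansion_restrict C CL) auto
    then have "frag_of (b, c) - expansion C ?a \<in> tensor_rel L"
      using frag_subgroup_sym[OF subgroup_tensor_rel] by (simp add: expansion_def)
    then show ?case
      unfolding Q_def using c by (intro bexI[of _ ?a]) auto
  next
    case (diff x y)
    then show ?case
      using Q_cong[OF Q_diff tensor_rel_left_diff] c by (simp add: L)
  qed (rule C)
  have "Q u"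
    by (rule free_Abelian_group_induct[of u "L \<times> carrier A"])
      (use assms Q_zero Q_diff Q_base in \<open>auto simp: L\<close>)
  then show ?thesis
    using that by (auto simp: Q_def)
qed

end

end

section \<open>Evaluation of tensors at integer-valued maps\<close>

context coefficient_group
begin

text \<open>The value at one representative; \<open>tensor_eval\<close> extracts the common value
  over a whole coset.\<close>

definition tensor_value :: "('v \<Rightarrow> int) \<Rightarrow> ('v \<times> 'c \<Rightarrow>\<^sub>0 int) \<Rightarrow> 'c"
  where "tensor_value \<phi> u =
    (\<Otimes>\<^bsub>A\<^esub>p\<in>Poly_Mapping.keys u. snd p [^]\<^bsub>A\<^esub> (Poly_Mapping.lookup u p * \<phi> (fst p)))"

text \<open>Keys can cancel under addition, so products are compared over a common finite set of
  pairs, where the additional factors have exponent zero.\<close>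

lemma tensor_value_superset:
  assumes "finite T" "Poly_Mapping.keys u \<subseteq> T" "T \<subseteq> UNIV \<times> carrier A"
  shows "tensor_value \<phi> u = (\<Otimes>\<^bsub>A\<^esub>p\<in>T. snd p [^]\<^bsub>A\<^esub> (Poly_Mapping.lookup u p * \<phi> (fst p)))"
  unfolding tensor_value_def
  by (rule A.finprod_mono_neutral_cong_left) (use assms in \<open>auto simp: in_keys_iff\<close>)

lemma tensor_value_add:
  assumes "Poly_Mapping.keys u \<subseteq> UNIV \<times> carrier A" "Poly_Mapping.keys v \<subseteq> UNIV \<times> carrier A"
  shows "tensor_value \<phi> (u + v) = tensor_value \<phi> u \<otimes>\<^bsub>A\<^esub> tensor_value \<phi> v"
proof -
  let ?T = "Poly_Mapping.keys u \<union> Poly_Mapping.keys v"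
  have T: "finite ?T" "?T \<subseteq> UNIV \<times> carrier A" "Poly_Mapping.keys (u + v) \<subseteq> ?T"
    using assms keys_add[of u v] by auto
  have val: "tensor_value \<phi> w = (\<Otimes>\<^bsub>A\<^esub>p\<in>?T. snd p [^]\<^bsub>A\<^esub> (Poly_Mapping.lookup w p * \<phi> (fst p)))"
    if "Poly_Mapping.keys w \<subseteq> ?T" for w
    using tensor_value_superset[OF T(1) that T(2)] .
  have "(\<Otimes>\<^bsub>A\<^esub>p\<in>?T. snd p [^]\<^bsub>A\<^esub> (Poly_Mapping.lookup (u + v) p * \<phi> (fst p))) =
      (\<Otimes>\<^bsub>A\<^esub>p\<in>?T. snd p [^]\<^bsub>A\<^esub> (Poly_Mapping.lookup u p * \<phi> (fst p))
        \<otimes>\<^bsub>A\<^esub> snd p [^]\<^bsub>A\<^esub> (Poly_Mapping.lookup v p * \<phi> (fst p)))"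
    using T(2) by (intro A.finprod_cong') (auto simp: lookup_add A.int_pow_mult[symmetric] distrib_right)
  also have "\<dots> = (\<Otimes>\<^bsub>A\<^esub>p\<in>?T. snd p [^]\<^bsub>A\<^esub> (Poly_Mapping.lookup u p * \<phi> (fst p)))
        \<otimes>\<^bsub>A\<^esub> (\<Otimes>\<^bsub>A\<^esub>p\<in>?T. snd p [^]\<^bsub>A\<^esub> (Poly_Mapping.lookup v p * \<phi> (fst p)))"
    using T(2) by (intro A.finprod_multf) auto
  finally show ?thesis
    using val T by simp
qed

lemma tensor_value_hom: "tensor_value \<phi> \<in> hom (tensor_frags L) A"
proof (rule homI)
  fix u assume "u \<in> carrier (tensor_frags L)"
  then show "tensor_value \<phi> u \<in> carrier A"
    unfolding tensor_value_def by (intro A.finprod_closed) auto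
next
  fix u v assume "u \<in> carrier (tensor_frags L)" "v \<in> carrier (tensor_frags L)"
  then show "tensor_value \<phi> (u \<otimes>\<^bsub>tensor_frags L\<^esub> v) = tensor_value \<phi> u \<otimes>\<^bsub>A\<^esub> tensor_value \<phi> v"
    by (simp, intro tensor_value_add) auto
qed

lemma group_hom_tensor_value: "group_hom (tensor_frags L) A (tensor_value \<phi>)"
  using tensor_value_hom by (simp add: group_hom_def group_hom_axioms_def A.is_group)

lemma tensor_value_frag_of:
  "a \<in> carrier A \<Longrightarrow> tensor_value \<phi> (frag_of (x, a)) = a [^]\<^bsub>A\<^esub> \<phi> x"
  unfolding tensor_value_def by simp

lemma tensor_value_diff:
  assumes "u \<in> carrier (tensor_frags L)" "v \<in> carrier (tensor_frags L)"
  shows "tensor_value \<phi> (u - v) = tensor_value \<phi> u \<otimes>\<^bsub>A\<^esub> inv\<^bsub>A\<^esub> tensor_value \<phi> v"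
proof -
  interpret h: group_hom "tensor_frags L" A "tensor_value \<phi>"
    by (rule group_hom_tensor_value)
  have "tensor_value \<phi> (u \<otimes>\<^bsub>tensor_frags L\<^esub> inv\<^bsub>tensor_frags L\<^esub> v)
      = tensor_value \<phi> u \<otimes>\<^bsub>A\<^esub> inv\<^bsub>A\<^esub> tensor_value \<phi> v"
    by (simp only: h.hom_mult[OF assms(1) h.G.inv_closed[OF assms(2)]] h.hom_inv[OF assms(2)])
  moreover have "u \<otimes>\<^bsub>tensor_frags L\<^esub> inv\<^bsub>tensor_frags L\<^esub> v = u - v"
    using assms(2) by simp
  ultimately show ?thesis by simp
qed

lemma tensor_value_expansion:
  fixes B :: "'v::real_vector set"
  assumes "a \<in> B \<rightarrow> carrier A" "finite B"
  shows "tensor_value \<phi> (expansion B a) = (\<Otimes>\<^bsub>A\<^esub>e\<in>B. a e [^]\<^bsub>A\<^esub> \<phi> e)"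
  using assms(2,1)
proof (induction B rule: finite_induct)
  case empty
  then show ?case by (simp add: expansion_def tensor_value_def)
next
  case (insert e B)
  have "expansion B a \<in> carrier (tensor_frags (UNIV :: 'v set))"
    using insert.prems by (intro expansion_closed) auto
  then have "tensor_value \<phi> (frag_of (e, a e) + expansion B a) =
      tensor_value \<phi> (frag_of (e, a e)) \<otimes>\<^bsub>A\<^esub> tensor_value \<phi> (expansion B a)"
    using insert.prems by (intro tensor_value_add) auto
  moreover have "expansion (insert e B) a = frag_of (e, a e) + expansion B a"
    using insert.hyps by (simp add: expansion_def)
  ultimately show ?case
    using insert by (simp add: tensor_value_frag_of Pi_def)
qed

lemma tensor_sum_finprod:
  assumes L: "L = int_span C" and B: "finite B" "B \<subseteq> L" "a \<in> B \<rightarrow> carrier A"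
  shows "(\<Otimes>\<^bsub>tensor_group (lattice_group L) A\<^esub>e\<in>B. pure_tensor (lattice_group L) A e (a e)) = tensor_sum L B a"
proof -
  let ?F = "tensor_frags L" and ?R = "tensor_rel L"
  have R: "subgroup ?R ?F"
    using subgroup_tensor_relations[of "lattice_group L" A] group_lattice_group_int_span[of C]
    by (simp add: L group.is_monoid)
  interpret F: comm_group ?F by (rule abelian_free_Abelian_group)
  interpret N: normal ?R ?F
    using R by (simp add: F.normal_iff_subgroup)
  interpret T: comm_group "tensor_group (lattice_group L) A"
    unfolding tensor_group_def using F.abelian_FactGroup[OF R] by simp
  have carr: "carrier (tensor_group (lattice_group L) A) = (\<lambda>u. ?R #>\<^bsub>?F\<^esub> u) ` carrier ?F"
    by (simp add: tensor_group_def carrier_FactGroup)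
  show ?thesis
    using B
  proof (induction B rule: finite_induct)
    case empty
    have "\<one>\<^bsub>tensor_group (lattice_group L) A\<^esub> = ?R"
      by (simp add: tensor_group_def)
    moreover have "?R #>\<^bsub>?F\<^esub> 0 = ?R"
      using F.coset_mult_one[OF N.subset] by simp
    ultimately show ?case
      by (simp add: tensor_sum_def expansion_def)
  next
    case (insert e B)
    have pure: "pure_tensor (lattice_group L) A x (a x) = ?R #>\<^bsub>?F\<^esub> frag_of (x, a x)" for x
      by (simp add: pure_tensor_def)
    have "(\<lambda>x. pure_tensor (lattice_group L) A x (a x)) \<in> insert e B \<rightarrow> carrier (tensor_group (lattice_group L) A)"
      unfolding carr pure using insert.prems by (auto intro!: imageI)
    then have "(\<Otimes>\<^bsub>tensor_group (lattice_group L) A\<^esub>e\<in>insert e B. pure_tensor (lattice_group L) A e (a e))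
        = (?R #>\<^bsub>?F\<^esub> frag_of (e, a e)) \<otimes>\<^bsub>tensor_group (lattice_group L) A\<^esub> tensor_sum L B a"
      using insert by (subst T.finprod_insert) (auto simp: pure Pi_def)
    also have "\<dots> = ?R #>\<^bsub>?F\<^esub> (frag_of (e, a e) \<otimes>\<^bsub>?F\<^esub> expansion B a)"
      unfolding tensor_sum_def tensor_group_def
      using insert.prems expansion_closed[of B L a] by (simp add: N.rcos_sum)
    also have "\<dots> = tensor_sum L (insert e B) a"
      using insert.hyps by (simp add: tensor_sum_def expansion_def)
    finally show ?case .
  qed
qed

section \<open>Coordinates of a tensor in a lattice basis\<close>

lemma tensor_sum_cong:
  "(\<And>e. e \<in> E \<Longrightarrow> a e = b e) \<Longrightarrow> tensor_sum L E a = tensor_sum L E b"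
  unfolding tensor_sum_def using expansion_cong[of E a b] by simp

context
  fixes L :: "(real^'n) set" and B
  assumes basis: "lattice_basis L B"
begin

private lemmas LB = lattice_basisD[OF basis]

lemma subgroup_tensor_rel_basis: "subgroup (tensor_rel L) (tensor_frags L)"
  using subgroup_tensor_rel[OF LB(4,1)] .

lemma tensor_sum_closed:
  "E \<subseteq> L \<Longrightarrow> a \<in> E \<rightarrow> carrier A \<Longrightarrow> tensor_sum L E a \<in> carrier (tensor_group (lattice_group L) A)"
  using expansion_closed[of E L a] by (auto simp: tensor_sum_def tensor_group_def carrier_FactGroup)

lemma tensor_sum_exists:
  assumes "\<xi> \<in> carrier (tensor_group (lattice_group L) A)"
  obtains a where "a \<in> B \<rightarrow> carrier A" "\<xi> = tensor_sum L B a"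
proof -
  obtain u where u: "u \<in> carrier (tensor_frags L)" "\<xi> = tensor_rel L #>\<^bsub>tensor_frags L\<^esub> u"
    using assms by (auto simp: tensor_group_def carrier_FactGroup)
  obtain a where a: "a \<in> B \<rightarrow> carrier A" "u - expansion B a \<in> tensor_rel L"
    using tensor_expansion_exists[OF LB(4,1) u(1)] .
  then show ?thesis
    using that u(2) frag_coset_eq_iff[OF subgroup_tensor_rel_basis] by (simp add: tensor_sum_def)
qed

text \<open>Additivity of \<open>\<phi>\<close> kills the relators in the first argument, and
  distributivity of powers over products in the commutative group \<open>A\<close> kills those in
  the second.\<close>

lemma tensor_value_relation:
  assumes \<phi>: "\<phi> \<in> hom (lattice_group L) integer_group" and u: "u \<in> tensor_rel L"
  shows "tensor_value \<phi> u = \<one>\<^bsub>A\<^esub>"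
proof -
  interpret h: group_hom "tensor_frags L" A "tensor_value \<phi>"
    by (rule group_hom_tensor_value)
  have \<phi>_add: "\<phi> (x + y) = \<phi> x + \<phi> y" if "x \<in> L" "y \<in> L" for x y
    using hom_mult[OF \<phi>] that by simp
  have add_closed: "x + y \<in> L" if "x \<in> L" "y \<in> L" for x y
    using that int_span_add by (simp add: LB(4))
  have val: "tensor_value \<phi> (u - (v + w)) = \<one>\<^bsub>A\<^esub>"
    if "u \<in> carrier (tensor_frags L)" "v \<in> carrier (tensor_frags L)" "w \<in> carrier (tensor_frags L)"
      "tensor_value \<phi> u = tensor_value \<phi> v \<otimes>\<^bsub>A\<^esub> tensor_value \<phi> w" for u v w
  proof -
    have vw: "v + w \<in> carrier (tensor_frags L)" "tensor_value \<phi> (v + w) = tensor_value \<phi> v \<otimes>\<^bsub>A\<^esub> tensor_value \<phi> w"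
      using h.G.m_closed[OF that(2,3)] h.hom_mult[OF that(2,3)] by simp_all
    show ?thesis
      using that vw h.hom_closed[OF that(2)] h.hom_closed[OF that(3)] by (subst tensor_value_diff) auto
  qed
  have "tensor_value \<phi> ` tensor_relators (lattice_group L) A \<subseteq> {\<one>\<^bsub>A\<^esub>}"
  proof clarify
    fix r assume "r \<in> tensor_relators (lattice_group L) A"
    then consider x y a where "x \<in> L" "y \<in> L" "a \<in> carrier A"
        "r = frag_of (x + y, a) - (frag_of (x, a) + frag_of (y, a))"
      | x a b where "x \<in> L" "a \<in> carrier A" "b \<in> carrier A"
        "r = frag_of (x, a \<otimes>\<^bsub>A\<^esub> b) - (frag_of (x, a) + frag_of (x, b))"
      by (auto simp: tensor_relators_def)
    then show "tensor_value \<phi> r = \<one>\<^bsub>A\<^esub>"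
    proof cases
      case 1
      then show ?thesis
        using add_closed by (auto intro!: val simp: tensor_value_frag_of \<phi>_add A.int_pow_mult)
    next
      case 2
      then show ?thesis
        by (auto intro!: val simp: tensor_value_frag_of A.int_pow_distrib)
    qed
  qed
  then have "tensor_value \<phi> ` tensor_rel L \<subseteq> {\<one>\<^bsub>A\<^esub>}"
    unfolding tensor_relations_def
    using frag_hom_generate_subset[OF tensor_value_hom A.is_group _ A.triv_subgroup]
      tensor_relators_subset[of "lattice_group L" A] group_lattice_group_int_span[of B]
    by (simp add: LB(4) group.is_monoid)
  then show ?thesis
    using u by auto
qed

lemma tensor_eval_tensor_sum:
  assumes \<phi>: "\<phi> \<in> hom (lattice_group L) integer_group"
    and a: "E \<subseteq> L" "finite E" "a \<in> E \<rightarrow> carrier A"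
  shows "tensor_eval A (tensor_sum L E a) \<phi> = (\<Otimes>\<^bsub>A\<^esub>e\<in>E. a e [^]\<^bsub>A\<^esub> \<phi> e)"
proof -
  have "tensor_value \<phi> v = tensor_value \<phi> (expansion E a)" if "v \<in> tensor_sum L E a" for v
  proof -
    have r: "v - expansion E a \<in> tensor_rel L"
      using that by (simp add: tensor_sum_def mem_frag_coset_iff)
    have "tensor_value \<phi> ((v - expansion E a) + expansion E a) =
        tensor_value \<phi> (v - expansion E a) \<otimes>\<^bsub>A\<^esub> tensor_value \<phi> (expansion E a)"
      using subgroup.mem_carrier[OF subgroup_tensor_rel_basis r] expansion_closed[OF a(1,3)]
      by (intro tensor_value_add) auto
    then show ?thesis
      using tensor_value_relation[OF \<phi> r] hom_in_carrier[OF tensor_value_hom expansion_closed[OF a(1,3)]]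
      by simp
  qed
  moreover have "expansion E a \<in> tensor_sum L E a"
    using frag_subgroup_zero[OF subgroup_tensor_rel_basis] by (simp add: tensor_sum_def mem_frag_coset_iff)
  ultimately have "tensor_value \<phi> ` tensor_sum L E a = {tensor_value \<phi> (expansion E a)}"
    by blast
  then show ?thesis
    using tensor_value_expansion[OF a(3,2), of \<phi>]
    by (simp add: tensor_eval_def tensor_value_def[abs_def])
qed

text \<open>The homomorphism on \<open>L\<close> with prescribed values \<open>c\<close> on the
  basis \<open>B\<close>; on \<open>L\<close> the real coordinates are integers, and floors give
  them integer type.\<close>

definition coordinate_hom :: "((real^'n) \<Rightarrow> int) \<Rightarrow> real^'n \<Rightarrow> int"
  where "coordinate_hom c x = (\<Sum>b\<in>B. \<lfloor>representation B x b\<rfloor> * c b)"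

lemma coordinate_hom: "coordinate_hom c \<in> hom (lattice_group L) integer_group"
proof (rule homI)
  fix x y assume "x \<in> carrier (lattice_group L)" "y \<in> carrier (lattice_group L)"
  then have "\<forall>b. representation B x b \<in> \<int>" "\<forall>b. representation B y b \<in> \<int>"
    by (simp_all add: LB(4) int_span_eq_representation[OF LB(2,1)])
  moreover have "representation B (x + y) = (\<lambda>b. representation B x b + representation B y b)"
    using LB by (simp add: real_vector.representation_add)
  ultimately have "\<lfloor>representation B (x + y) b\<rfloor> = \<lfloor>representation B x b\<rfloor> + \<lfloor>representation B y b\<rfloor>" for b
    by (metis floor_add2)
  then show "coordinate_hom c (x \<otimes>\<^bsub>lattice_group L\<^esub> y) = coordinate_hom c x \<otimes>\<^bsub>integer_group\<^esub> coordinate_hom c y"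
    by (simp add: coordinate_hom_def distrib_right sum.distrib)
qed simp

lemma coordinate_hom_basis:
  assumes "e \<in> B"
  shows "coordinate_hom c e = c e"
proof -
  have "coordinate_hom c e = (\<Sum>b\<in>B. if b = e then c e else 0)"
    unfolding coordinate_hom_def using assms LB
    by (intro sum.cong) (auto simp: real_vector.representation_basis)
  then show ?thesis
    using assms LB by simp
qed

text \<open>Evaluation at the member of the dual basis belonging to \<open>e\<close> reads off the
  coefficient at \<open>e\<close>.\<close>

lemma tensor_sum_eqD:
  assumes "a \<in> B \<rightarrow> carrier A" "b \<in> B \<rightarrow> carrier A" "tensor_sum L B a = tensor_sum L B b" "e \<in> B"
  shows "a e = b e"
proof -
  let ?\<phi> = "coordinate_hom (\<lambda>b. if b = e then 1 else 0)"
  have "tensor_eval A (tensor_sum L B c) ?\<phi> = c e" if c: "c \<in> B \<rightarrow> carrier A" for c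
  proof -
    have "tensor_eval A (tensor_sum L B c) ?\<phi> = (\<Otimes>\<^bsub>A\<^esub>b\<in>B. c b [^]\<^bsub>A\<^esub> ?\<phi> b)"
      by (rule tensor_eval_tensor_sum[OF coordinate_hom LB(5,1) c])
    also have "\<dots> = (\<Otimes>\<^bsub>A\<^esub>b\<in>B. if e = b then c b else \<one>\<^bsub>A\<^esub>)"
      using c by (intro A.finprod_cong') (auto simp: coordinate_hom_basis Pi_def)
    also have "\<dots> = c e"
      using c assms(4) LB by (intro A.finprod_singleton) auto
    finally show ?thesis .
  qed
  then show ?thesis
    using assms by metis
qed

text \<open>Here surjectivity of the map induced by a tensor becomes the generation condition on
  symbols: homomorphisms take arbitrary integer values on \<open>B\<close>, so the image consists of
  all integer monomials in the \<open>a e\<close>, and these form the generated subgroup.\<close>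

lemma tensor_eval_image:
  assumes a: "a \<in> B \<rightarrow> carrier A"
  shows "tensor_eval A (tensor_sum L B a) ` hom (lattice_group L) integer_group = generate A (a ` B)"
proof -
  have aA: "a ` B \<subseteq> carrier A"
    using a by auto
  have gen: "subgroup (generate A (a ` B)) A"
    by (rule A.generate_is_subgroup[OF aA])
  have *: "(\<Otimes>\<^bsub>A\<^esub>e\<in>D. a e [^]\<^bsub>A\<^esub> (c e :: int)) \<in> generate A (a ` B)" if "finite D" "D \<subseteq> B" for c D
    using that
  proof (induction D rule: finite_induct)
    case empty
    then show ?case using subgroup.one_closed[OF gen] by simp
  next
    case (insert e D)
    have "a e [^]\<^bsub>A\<^esub> c e \<in> generate A (a ` B)"
      using insert.prems by (intro A.subgroup_int_pow_closed[OF gen] generate.incl) auto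
    then have "a e [^]\<^bsub>A\<^esub> c e \<otimes>\<^bsub>A\<^esub> (\<Otimes>\<^bsub>A\<^esub>e\<in>D. a e [^]\<^bsub>A\<^esub> (c e :: int)) \<in> generate A (a ` B)"
      using insert by (intro subgroup.m_closed[OF gen]) auto
    moreover have "(\<lambda>e. a e [^]\<^bsub>A\<^esub> c e) \<in> D \<rightarrow> carrier A" "a e [^]\<^bsub>A\<^esub> c e \<in> carrier A"
      using insert.prems a by auto
    ultimately show ?case
      using insert.hyps by simp
  qed
  let ?V = "(\<lambda>c. \<Otimes>\<^bsub>A\<^esub>e\<in>B. a e [^]\<^bsub>A\<^esub> (c e :: int)) ` UNIV"
  have pow: "(\<lambda>e. a e [^]\<^bsub>A\<^esub> (c e :: int)) \<in> B \<rightarrow> carrier A" for c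
    using a by auto
  have V: "tensor_eval A (tensor_sum L B a) ` hom (lattice_group L) integer_group = ?V"
  proof
    show "tensor_eval A (tensor_sum L B a) ` hom (lattice_group L) integer_group \<subseteq> ?V"
      using tensor_eval_tensor_sum[OF _ LB(5,1) a] by auto
    show "?V \<subseteq> tensor_eval A (tensor_sum L B a) ` hom (lattice_group L) integer_group"
    proof clarify
      fix c :: "_ \<Rightarrow> int"
      have "(\<Otimes>\<^bsub>A\<^esub>e\<in>B. a e [^]\<^bsub>A\<^esub> c e) = tensor_eval A (tensor_sum L B a) (coordinate_hom c)"
        unfolding tensor_eval_tensor_sum[OF coordinate_hom LB(5,1) a]
        using a by (intro A.finprod_cong') (auto simp: coordinate_hom_basis)
      then show "(\<Otimes>\<^bsub>A\<^esub>e\<in>B. a e [^]\<^bsub>A\<^esub> c e) \<in> tensor_eval A (tensor_sum L B a) ` hom (lattice_group L) integer_group"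
        using coordinate_hom by blast
    qed
  qed
  have "?V = generate A (a ` B)"
  proof
    show "?V \<subseteq> generate A (a ` B)"
      using *[OF LB(1) order_refl] by auto
    have "subgroup ?V A"
    proof (rule A.subgroupI)
      fix x assume "x \<in> ?V"
      then obtain c where x: "x = (\<Otimes>\<^bsub>A\<^esub>e\<in>B. a e [^]\<^bsub>A\<^esub> (c e :: int))" by auto
      have "x \<otimes>\<^bsub>A\<^esub> (\<Otimes>\<^bsub>A\<^esub>e\<in>B. a e [^]\<^bsub>A\<^esub> (- c e)) = (\<Otimes>\<^bsub>A\<^esub>e\<in>B. a e [^]\<^bsub>A\<^esub> c e \<otimes>\<^bsub>A\<^esub> a e [^]\<^bsub>A\<^esub> (- c e))"
        unfolding x using pow[of c] pow[of "\<lambda>e. - c e"] by (simp add: A.finprod_multf)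
      also have "\<dots> = \<one>\<^bsub>A\<^esub>"
        using a by (intro A.finprod_one_eqI) (auto simp: A.int_pow_neg Pi_def)
      finally have "inv\<^bsub>A\<^esub> x = (\<Otimes>\<^bsub>A\<^esub>e\<in>B. a e [^]\<^bsub>A\<^esub> (- c e))"
        using pow[of c] pow[of "\<lambda>e. - c e"] x
        by (metis A.finprod_closed A.inv_equality A.m_comm)
      then show "inv\<^bsub>A\<^esub> x \<in> ?V" by auto
    next
      fix x y assume "x \<in> ?V" "y \<in> ?V"
      then obtain c d where x: "x = (\<Otimes>\<^bsub>A\<^esub>e\<in>B. a e [^]\<^bsub>A\<^esub> (c e :: int))"
        and y: "y = (\<Otimes>\<^bsub>A\<^esub>e\<in>B. a e [^]\<^bsub>A\<^esub> (d e :: int))" by auto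
      have "x \<otimes>\<^bsub>A\<^esub> y = (\<Otimes>\<^bsub>A\<^esub>e\<in>B. a e [^]\<^bsub>A\<^esub> c e \<otimes>\<^bsub>A\<^esub> a e [^]\<^bsub>A\<^esub> d e)"
        unfolding x y using pow[of c] pow[of d] by (simp add: A.finprod_multf)
      also have "\<dots> = (\<Otimes>\<^bsub>A\<^esub>e\<in>B. a e [^]\<^bsub>A\<^esub> (c e + d e))"
        using a by (intro A.finprod_cong') (auto simp: A.int_pow_mult Pi_def)
      finally show "x \<otimes>\<^bsub>A\<^esub> y \<in> ?V" by auto
    qed (use pow in auto)
    moreover have "a ` B \<subseteq> ?V"
    proof clarify
      fix e assume e: "e \<in> B"
      have "(\<Otimes>\<^bsub>A\<^esub>b\<in>B. a b [^]\<^bsub>A\<^esub> (if b = e then 1 else 0 :: int)) = (\<Otimes>\<^bsub>A\<^esub>b\<in>B. if e = b then a b else \<one>\<^bsub>A\<^esub>)"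
        using a by (intro A.finprod_cong') (auto simp: Pi_def)
      also have "\<dots> = a e"
        using a e LB by (intro A.finprod_singleton) auto
      finally show "a e \<in> ?V"
        using rangeI[of "\<lambda>c. \<Otimes>\<^bsub>A\<^esub>b\<in>B. a b [^]\<^bsub>A\<^esub> (c b :: int)" "\<lambda>b. if b = e then 1 else 0"] by simp
    qed
    ultimately show "generate A (a ` B) \<subseteq> ?V"
      by (intro A.generate_subgroup_incl)
  qed
  with V show ?thesis by simp
qed

lemma tensor_sum_restrict:
  assumes "E \<subseteq> B" "\<And>e. e \<in> B - E \<Longrightarrow> a e = \<one>\<^bsub>A\<^esub>"
  shows "tensor_sum L B a = tensor_sum L E a"
  unfolding tensor_sum_def frag_coset_eq_iff[OF subgroup_tensor_rel_basis]
  by (rule expansion_restrict[OF LB(4,1,1,5) assms])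

text \<open>The tensors coming from the sublattice of the cone are those with an expansion along
  \<open>E\<close> alone. Uniqueness of coefficients in the full basis then forces the remaining
  ones to be trivial.\<close>

lemma supported_on_iff:
  assumes E: "E \<subseteq> B" and a: "a \<in> B \<rightarrow> carrier A"
  shows "supported_on A L (tensor_sum L B a) (convex_cone hull E) \<longleftrightarrow> (\<forall>e\<in>B - E. a e = \<one>\<^bsub>A\<^esub>)"
proof -
  let ?K = "int_span E"
  have "part_of_basis L E"
    using basis E by (auto simp: part_of_basis_def)
  then have K: "cone_sublattice L (convex_cone hull E) = ?K"
    by (simp add: cone_sublattice_def lattice_generators_convex_cone_hull)
  have fin: "finite E"
    using E LB finite_subset by blast
  have KL: "?K \<subseteq> L" "E \<subseteq> ?K"
    using int_span_mono[OF LB(1) E] int_span_base[OF fin] by (auto simp: LB(4))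
  have mon: "monoid (lattice_group L)" "monoid (lattice_group ?K)"
    using group_lattice_group_int_span[of B] group_lattice_group_int_span[of E]
    by (simp_all add: LB(4) group.is_monoid)
  have hom: "(\<lambda>x. x) \<in> hom (lattice_group ?K) (lattice_group L)"
    by (rule homI) (use KL in auto)
  have id: "frag_extend (\<lambda>(x, a). frag_of (x, a)) u = u" for u :: "(real^'n) \<times> 'c \<Rightarrow>\<^sub>0 int"
    using frag_expansion[of u] by (simp add: case_prod_eta[of frag_of, unfolded curry_def] split_def)
  have map: "tensor_map (\<lambda>x. x) (lattice_group L) A (tensor_rel ?K #>\<^bsub>tensor_frags ?K\<^esub> u) =
      tensor_rel L #>\<^bsub>tensor_frags L\<^esub> u" if "u \<in> carrier (tensor_frags ?K)" for u
    using tensor_map_coset[OF mon A.is_monoid hom, of u] that by (simp add: id)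
  have supp: "supported_on A L \<xi> (convex_cone hull E) \<longleftrightarrow> (\<exists>c\<in>E \<rightarrow> carrier A. \<xi> = tensor_sum L E c)" for \<xi>
  proof
    assume "supported_on A L \<xi> (convex_cone hull E)"
    then obtain u where u: "u \<in> carrier (tensor_frags ?K)"
      and \<xi>: "\<xi> = tensor_map (\<lambda>x. x) (lattice_group L) A (tensor_rel ?K #>\<^bsub>tensor_frags ?K\<^esub> u)"
      by (auto simp: supported_on_def K tensor_group_def carrier_FactGroup)
    obtain c where c: "c \<in> E \<rightarrow> carrier A" "u - expansion E c \<in> tensor_rel ?K"
      using tensor_expansion_exists[OF refl fin u] .
    have "tensor_rel ?K #>\<^bsub>tensor_frags ?K\<^esub> u = tensor_rel ?K #>\<^bsub>tensor_frags ?K\<^esub> expansion E c"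
      using c frag_coset_eq_iff[OF subgroup_tensor_rel[OF refl fin]] by blast
    then have "\<xi> = tensor_sum L E c"
      unfolding \<xi> tensor_sum_def using map expansion_closed[OF KL(2) c(1)] by metis
    then show "\<exists>c\<in>E \<rightarrow> carrier A. \<xi> = tensor_sum L E c"
      using c by blast
  next
    assume "\<exists>c\<in>E \<rightarrow> carrier A. \<xi> = tensor_sum L E c"
    then obtain c where c: "c \<in> E \<rightarrow> carrier A" "\<xi> = tensor_sum L E c" by blast
    then have "\<xi> = tensor_map (\<lambda>x. x) (lattice_group L) A (tensor_rel ?K #>\<^bsub>tensor_frags ?K\<^esub> expansion E c)"
      using map[OF expansion_closed[OF KL(2)]] by (simp add: tensor_sum_def)
    then show "supported_on A L \<xi> (convex_cone hull E)"
      unfolding supported_on_def K using expansion_closed[OF KL(2) c(1)]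
      by (auto simp: tensor_group_def carrier_FactGroup)
  qed
  show ?thesis
  proof
    assume "supported_on A L (tensor_sum L B a) (convex_cone hull E)"
    then obtain c where c: "c \<in> E \<rightarrow> carrier A" "tensor_sum L B a = tensor_sum L E c"
      using supp by blast
    \<comment> \<open>The expansion along \<open>E\<close> is padded with the neutral element so
      that it can be compared with \<open>a\<close> over the same basis \<open>B\<close>.\<close>
    let ?c = "\<lambda>e. if e \<in> E then c e else \<one>\<^bsub>A\<^esub>"
    have "tensor_sum L B ?c = tensor_sum L E c"
      using tensor_sum_restrict[OF E, of ?c] tensor_sum_cong[of E ?c c] by simp
    then show "\<forall>e\<in>B - E. a e = \<one>\<^bsub>A\<^esub>"
      using tensor_sum_eqD[OF a, of ?c] c by (auto simp: Pi_def)
  next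
    assume "\<forall>e\<in>B - E. a e = \<one>\<^bsub>A\<^esub>"
    then have "tensor_sum L B a = tensor_sum L E a"
      by (intro tensor_sum_restrict E) auto
    moreover have "a \<in> E \<rightarrow> carrier A"
      using a E by auto
    ultimately show "supported_on A L (tensor_sum L B a) (convex_cone hull E)"
      using supp by blast
  qed
qed

lemma tensor_map_tensor_sum:
  fixes g :: "real^'n \<Rightarrow> real^'n"
  assumes g: "linear g" "inj g" and a: "a \<in> B \<rightarrow> carrier A"
  shows "tensor_map g (lattice_group (g ` L)) A (tensor_sum L B a) =
    tensor_sum (g ` L) (g ` B) (\<lambda>e. a (inv_into B g e))"
proof -
  have inj: "inj_on g B"
    using g inj_on_subset by blast
  have gL: "g ` L = int_span (g ` B)"
    using lattice_basisD(4)[OF lattice_basis_linear_image[OF basis g]] .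
  have mon: "monoid (lattice_group (g ` L))" "monoid (lattice_group L)"
    unfolding gL using group_lattice_group_int_span[of B] group_lattice_group_int_span[of "g ` B"]
    by (simp_all add: LB(4) group.is_monoid)
  have hom: "g \<in> hom (lattice_group L) (lattice_group (g ` L))"
    by (rule homI) (auto simp: linear_add[OF g(1)])
  have "frag_extend (\<lambda>(x, a). frag_of (g x, a)) (expansion B a) = (\<Sum>e\<in>B. frag_of (g e, a e))"
    unfolding expansion_def using LB(1) by (simp add: frag_extend_sum o_def)
  also have "\<dots> = expansion (g ` B) (\<lambda>e. a (inv_into B g e))"
    unfolding expansion_def using inj by (simp add: sum.reindex)
  finally show ?thesis
    unfolding tensor_sum_def
    using tensor_map_coset[OF mon A.is_monoid hom, of "expansion B a"] expansion_closed[OF LB(5) a] by simp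
qed

text \<open>The change of coordinates behind star subdivision. Additively, and writing
  \<open>e.a\<close> for a pure tensor: the sum of \<open>e.a(e)\<close> over \<open>F\<close> is
  \<open>(\<Sum>F).a(f)\<close> plus the sum of \<open>e.(a(e) - a(f))\<close> over
  \<open>F - {f}\<close>.\<close>

lemma tensor_sum_replace_sum:
  assumes F: "F \<subseteq> B" "2 \<le> card F" "f \<in> F" and a: "a \<in> B \<rightarrow> carrier A"
  shows "tensor_sum L B a = tensor_sum L (insert (\<Sum>F) (B - {f}))
    (\<lambda>e. if e = \<Sum>F then a f else if e \<in> F then a e \<otimes>\<^bsub>A\<^esub> inv\<^bsub>A\<^esub> a f else a e)" (is "_ = tensor_sum L ?B ?a")
proof -
  have notin: "\<Sum>F \<notin> B"
    using sum_notin_independent[OF LB(2,1) F(1,2)] .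
  have fin: "finite F"
    using F LB finite_subset by blast
  have FL: "F \<subseteq> L" using F LB by blast
  note R = subgroup_tensor_rel[OF LB(4,1)]
  have af: "a e \<in> carrier A" if "e \<in> F" for e using that F a by auto
  have B_eq: "B = (B - F) \<union> insert f (F - {f})"
    using F by auto
  have 1: "expansion B a = expansion (B - F) a + frag_of (f, a f) + (\<Sum>e\<in>F - {f}. frag_of (e, a e))"
  proof -
    have "expansion B a = expansion (B - F) a + (\<Sum>e\<in>F. frag_of (e, a e))"
      unfolding expansion_def by (rule sum.subset_diff[OF F(1) LB(1)])
    then show ?thesis
      using F fin by (simp add: sum.remove)
  qed
  have 2: "expansion ?B ?a = frag_of (\<Sum>F, a f) + expansion (B - F) a
      + (\<Sum>e\<in>F - {f}. frag_of (e, a e \<otimes>\<^bsub>A\<^esub> inv\<^bsub>A\<^esub> a f))"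
  proof -
    have "expansion ?B ?a = frag_of (\<Sum>F, a f) + expansion (B - {f}) ?a"
      unfolding expansion_def using notin LB by simp
    also have "expansion (B - {f}) ?a = expansion (B - F) ?a + expansion (F - {f}) ?a"
      unfolding expansion_def using F fin LB
      by (subst sum.union_disjoint[symmetric]) (auto intro!: sum.cong)
    also have "expansion (B - F) ?a = expansion (B - F) a"
      using notin by (intro expansion_cong) auto
    also have "expansion (F - {f}) ?a = (\<Sum>e\<in>F - {f}. frag_of (e, a e \<otimes>\<^bsub>A\<^esub> inv\<^bsub>A\<^esub> a f))"
      unfolding expansion_def using notin F by (intro sum.cong) auto
    finally show ?thesis by (simp add: add.assoc)
  qed
  have 3: "(\<Sum>e\<in>F. frag_of (e, a f)) = frag_of (f, a f) + (\<Sum>e\<in>F - {f}. frag_of (e, a f))"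
    using F fin by (simp add: sum.remove)
  have 4: "(\<Sum>e\<in>F - {f}. frag_of (e, a e \<otimes>\<^bsub>A\<^esub> inv\<^bsub>A\<^esub> a f))
      - (\<Sum>e\<in>F - {f}. frag_of (e, a e) - frag_of (e, a f)) \<in> tensor_rel L"
    using af FL F by (intro frag_subgroup_sum_diff[OF R] tensor_rel_right_diff[OF LB(4,1)]) auto
  have 5: "frag_of (\<Sum>F, a f) - (\<Sum>e\<in>F. frag_of (e, a f)) \<in> tensor_rel L"
    using tensor_rel_sum_left[OF LB(4,1) fin FL af[OF F(3)]] .
  have "expansion ?B ?a - expansion B a \<in> tensor_rel L"
    using frag_subgroup_add[OF R 4 5] unfolding 1 2 3 by (simp add: sum_subtractf algebra_simps)
  then show ?thesis
    unfolding tensor_sum_def frag_coset_eq_iff[OF subgroup_tensor_rel_basis]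
    by (rule frag_subgroup_sym[OF R])
qed

end

end

section \<open>Triples and their symbols\<close>

lemma image_mset_mset_set_restrict:
  assumes "finite B" "E \<subseteq> B" "\<And>e. e \<in> B - E \<Longrightarrow> f e = c"
  shows "image_mset f (mset_set B) = image_mset f (mset_set E) + replicate_mset (card B - card E) c"
proof -
  have "mset_set B = mset_set (E \<union> (B - E))"
    using assms by (simp add: Un_absorb1)
  also have "\<dots> = mset_set E + mset_set (B - E)"
    using assms by (intro mset_set_Union) (auto intro: finite_subset)
  moreover have "image_mset f (mset_set (B - E)) = image_mset (\<lambda>_. c) (mset_set (B - E))"
    using assms by (intro image_mset_cong) auto
  ultimately show ?thesis
    using assms by (simp add: image_mset_const_eq card_Diff_subset finite_subset)
qed

text \<open>The sizes agree, so some bijection exists; a permutation of \<open>B\<close> then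
  corrects it until the values match.\<close>

lemma image_mset_eq_imp_bij_betw:
  assumes "finite B" "finite C" "image_mset f (mset_set B) = image_mset g (mset_set C)"
  obtains h where "bij_betw h B C" "\<And>x. x \<in> B \<Longrightarrow> g (h x) = f x"
proof -
  have "card B = card C"
    using arg_cong[OF assms(3), of size] by simp
  then obtain k where k: "bij_betw k B C"
    using assms finite_same_card_bij by blast
  have "image_mset f (mset_set B) = image_mset (g \<circ> k) (mset_set B)"
    using k assms(3) by (simp add: bij_betw_def image_mset_mset_set flip: multiset.map_comp)
  then obtain p where p: "p permutes B" "\<forall>x\<in>B. f x = (g \<circ> k) (p x)"
    using image_mset_eq_implies_permutes[OF assms(1)] by metis
  have "bij_betw (k \<circ> p) B C"
    using permutes_imp_bij[OF p(1)] k by (rule bij_betw_trans)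
  then show ?thesis
    using that p(2) by simp
qed

section \<open>Triples in coordinates\<close>

context coefficient_group
begin

text \<open>A triple described by a full basis \<open>B\<close> containing the cone generators
  \<open>E\<close> and by the coefficients \<open>a\<close> of its tensor. The last two conditions
  are the support and surjectivity conditions, as translated by \<open>supported_on_iff\<close> and
  \<open>tensor_eval_image\<close>.\<close>

definition triple_datum :: "(real^'n) set \<Rightarrow> (real^'n) set \<Rightarrow> (real^'n) set \<Rightarrow> (real^'n \<Rightarrow> 'c) \<Rightarrow> bool"
  where "triple_datum L B E a \<longleftrightarrow> lattice_basis L B \<and> E \<subseteq> B \<and> a \<in> B \<rightarrow> carrier A
    \<and> (\<forall>e\<in>B - E. a e = \<one>\<^bsub>A\<^esub>) \<and> generate A (a ` B) = carrier A"

definition triple_of :: "(real^'n) set \<Rightarrow> (real^'n) set \<Rightarrow> (real^'n) set \<Rightarrow> (real^'n \<Rightarrow> 'c) \<Rightarrow> ('n, 'c) triple"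
  where "triple_of L B E a = (L, tensor_sum L B a, convex_cone hull E)"

lemma triple_datumD:
  assumes "triple_datum L B E a"
  shows "lattice_basis L B" "E \<subseteq> B" "a \<in> B \<rightarrow> carrier A" "\<And>e. e \<in> B - E \<Longrightarrow> a e = \<one>\<^bsub>A\<^esub>"
    "generate A (a ` B) = carrier A" "finite B" "part_of_basis L E"
  using assms by (auto simp: triple_datum_def part_of_basis_def dest: lattice_basisD)

lemma triple_of_in_triples:
  assumes "triple_datum L B E a"
  shows "triple_of L B E a \<in> triples A"
  using triple_datumD[OF assms] tensor_sum_closed[of L B B a] tensor_eval_image[of L B a] lattice_basisD(5)[of L B]
    supported_on_iff[of L B E a]
  by (auto simp: triples_def triple_of_def is_lattice_def smooth_cone_def)

lemma triple_datum_exists: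
  assumes "(L, \<xi>, \<Lambda>) \<in> triples A" "part_of_basis L E" "\<Lambda> = convex_cone hull E" "lattice_basis L B" "E \<subseteq> B"
  obtains a where "triple_datum L B E a" "\<xi> = tensor_sum L B a"
proof -
  obtain a where a: "a \<in> B \<rightarrow> carrier A" "\<xi> = tensor_sum L B a"
    using tensor_sum_exists[OF assms(4), of \<xi>] assms(1) unfolding triples_def by blast
  then have "triple_datum L B E a"
    using assms tensor_eval_image[OF assms(4) a(1)] supported_on_iff[OF assms(4,5) a(1)]
    by (auto simp: triple_datum_def triples_def)
  then show ?thesis
    using that a by blast
qed

lemma triples_cases:
  assumes "t \<in> triples A"
  obtains L B E a where "triple_datum L B E a" "t = triple_of L B E a"
proof -
  obtain L \<xi> \<Lambda> where t: "t = (L, \<xi>, \<Lambda>)" by (cases t)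
  obtain E B where "part_of_basis L E" "\<Lambda> = convex_cone hull E" "lattice_basis L B" "E \<subseteq> B"
    using assms by (auto simp: t triples_def smooth_cone_def part_of_basis_def)
  then show ?thesis
    using triple_datum_exists[of L \<xi> \<Lambda> E B] assms that unfolding t triple_of_def by blast
qed

text \<open>Two bases extending \<open>E\<close> give the same multiset: the coefficients on
  \<open>E\<close> agree by uniqueness of the expansion, and all others are neutral, equally many in
  both cases because the bases have the same size.\<close>

lemma triple_symbol_triple_of:
  assumes d: "triple_datum L B E a"
  shows "triple_symbol A (triple_of L B E a) = image_mset a (mset_set B)"
proof -
  note d = triple_datumD[OF d] and LB = lattice_basisD[OF d(1)]
  have gens: "lattice_generators L (convex_cone hull E) = E"
    using d by (simp add: lattice_generators_convex_cone_hull)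
  have fp: "(\<Otimes>\<^bsub>tensor_group (lattice_group L) A\<^esub>e\<in>B'. pure_tensor (lattice_group L) A e (a' e)) = tensor_sum L B' a'"
    if "lattice_basis L B'" "a' \<in> B' \<rightarrow> carrier A" for B' and a' :: "real^'a \<Rightarrow> 'c"
    using tensor_sum_finprod[OF lattice_basisD(4,1,5)[OF that(1)] that(2)] .
  have uniq: "image_mset a' (mset_set B') = image_mset a (mset_set B)"
    if B': "lattice_basis L B'" "E \<subseteq> B'" "a' \<in> B' \<rightarrow> carrier A" "tensor_sum L B a = tensor_sum L B' a'" for B' a'
  proof -
    have "supported_on A L (tensor_sum L B a) (convex_cone hull E)"
      using supported_on_iff[OF d(1,2,3)] d(4) by blast
    then have a'1: "a' e = \<one>\<^bsub>A\<^esub>" if "e \<in> B' - E" for e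
      using supported_on_iff[OF B'(1,2,3)] B'(4) that by auto
    \<comment> \<open>The coefficients \<open>a'\<close>, cut down to the shared part
      \<open>E\<close>, form a second expansion of the tensor in the original basis
      \<open>B\<close>, where uniqueness applies.\<close>
    let ?a = "\<lambda>e. if e \<in> E then a' e else \<one>\<^bsub>A\<^esub>"
    have "tensor_sum L B a = tensor_sum L E a'"
      using tensor_sum_restrict[OF B'(1,2) a'1] B'(4) by simp
    also have "\<dots> = tensor_sum L E ?a"
      by (rule tensor_sum_cong) simp
    also have "\<dots> = tensor_sum L B ?a"
      by (rule tensor_sum_restrict[OF d(1,2), symmetric]) simp
    finally have eq: "tensor_sum L B a = tensor_sum L B ?a" .
    have "?a \<in> B \<rightarrow> carrier A"
      using B'(2) funcset_mem[OF B'(3)] by auto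
    then have "a e = ?a e" if "e \<in> B" for e
      by (rule tensor_sum_eqD[OF d(1,3) _ eq that])
    then have "image_mset a (mset_set E) = image_mset a' (mset_set E)"
      using finite_subset[OF d(2,6)] d(2) by (intro image_mset_cong) (auto simp: subset_iff)
    then show ?thesis
      using image_mset_mset_set_restrict[OF d(6,2,4)]
        image_mset_mset_set_restrict[OF lattice_basisD(1)[OF B'(1)] B'(2) a'1] LB(3) lattice_basisD(3)[OF B'(1)]
      by simp
  qed
  show ?thesis
    unfolding triple_symbol_def triple_of_def prod.case gens
  proof (rule the_equality)
    show "\<exists>B' a'. lattice_basis L B' \<and> E \<subseteq> B' \<and> a' \<in> B' \<rightarrow> carrier A
      \<and> tensor_sum L B a = (\<Otimes>\<^bsub>tensor_group (lattice_group L) A\<^esub>e\<in>B'. pure_tensor (lattice_group L) A e (a' e))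
      \<and> image_mset a (mset_set B) = image_mset a' (mset_set B')"
      using d fp by (intro exI[of _ B] exI[of _ a]) simp
  qed (use fp uniq in auto)
qed

lemma symbol_in_symbols:
  fixes L :: "(real^'n) set"
  assumes "triple_datum L B E a"
  shows "image_mset a (mset_set B) \<in> symbols CARD('n) A"
  using triple_datumD[OF assms] lattice_basisD(3)[of L B] by (auto simp: symbols_def)

text \<open>The function \<open>b\<close> is prescribed only on the image of \<open>B\<close>. So
  the lemma serves both for coefficients transported by the inverse of \<open>g\<close> and for
  coefficients given beforehand on the target basis.\<close>

lemma triple_datum_linear_image:
  fixes g :: "real^'n \<Rightarrow> real^'n"
  assumes d: "triple_datum L B E a" and g: "linear g" "inj g" and b: "\<And>e. e \<in> B \<Longrightarrow> b (g e) = a e"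
  shows "triple_datum (g ` L) (g ` B) (g ` E) b"
    and "(triple_of L B E a, triple_of (g ` L) (g ` B) (g ` E) b) \<in> triple_iso A"
proof -
  note d' = triple_datumD[OF d]
  have "b ` g ` B = a ` B"
    using b by (auto simp: image_image)
  then show datum: "triple_datum (g ` L) (g ` B) (g ` E) b"
    using d' b lattice_basis_linear_image[OF d'(1) g] unfolding triple_datum_def
    by (auto simp: inj_image_mem_iff[OF g(2)])
  have inj: "inj_on g B"
    using g inj_on_subset by blast
  have "tensor_sum (g ` L) (g ` B) (\<lambda>e. a (inv_into B g e)) = tensor_sum (g ` L) (g ` B) b"
    by (rule tensor_sum_cong) (use b inj in auto)
  moreover have "bij g"
    using g by (simp add: bij_def linear_injective_imp_surjective)
  ultimately show "(triple_of L B E a, triple_of (g ` L) (g ` B) (g ` E) b) \<in> triple_iso A"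
    using triple_of_in_triples[OF d] triple_of_in_triples[OF datum] g tensor_map_tensor_sum[OF d'(1) g d'(3)]
    unfolding triple_iso_def triple_of_def by (auto simp: convex_cone_hull_linear_image)
qed

lemma triple_iso_cases:
  assumes "(triple_of L B E a, t) \<in> triple_iso A" and d: "triple_datum L B E a"
  obtains g where "linear g" "inj g" "t = triple_of (g ` L) (g ` B) (g ` E) (a \<circ> inv_into UNIV g)"
proof -
  obtain g where g: "linear g" "bij g"
    "t = (g ` L, tensor_map g (lattice_group (g ` L)) A (tensor_sum L B a), g ` (convex_cone hull E))"
    using assms by (auto simp: triple_iso_def triple_of_def)
  then have inj: "inj g"
    by (simp add: bij_def)
  have "tensor_sum (g ` L) (g ` B) (\<lambda>e. a (inv_into B g e)) = tensor_sum (g ` L) (g ` B) (a \<circ> inv_into UNIV g)"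
    by (rule tensor_sum_cong) (use inj inj_on_subset[OF inj] in auto)
  then have "t = triple_of (g ` L) (g ` B) (g ` E) (a \<circ> inv_into UNIV g)"
    using g tensor_map_tensor_sum[OF triple_datumD(1)[OF d] g(1) inj triple_datumD(3)[OF d]]
    by (simp add: triple_of_def convex_cone_hull_linear_image)
  then show ?thesis
    using that g inj by blast
qed

section \<open>Isomorphism of triples is an equivalence relation respected by symbols\<close>

lemma triple_iso_refl:
  assumes "t \<in> triples A"
  shows "(t, t) \<in> triple_iso A"
proof -
  obtain L B E a where d: "triple_datum L B E a" and t: "t = triple_of L B E a"
    using assms by (rule triples_cases)
  have "(triple_of L B E a, triple_of ((\<lambda>x. x) ` L) ((\<lambda>x. x) ` B) ((\<lambda>x. x) ` E) a) \<in> triple_iso A"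
    by (rule triple_datum_linear_image(2)[OF d]) (auto simp: linear_iff)
  then show ?thesis
    by (simp add: t)
qed

lemma triple_iso_sym:
  assumes "(s, t) \<in> triple_iso A"
  shows "(t, s) \<in> triple_iso A"
proof -
  have "s \<in> triples A"
    using assms by (auto simp: triple_iso_def)
  then obtain L B E a where d: "triple_datum L B E a" and s: "s = triple_of L B E a"
    by (rule triples_cases)
  obtain g where g: "linear g" "inj g" and t: "t = triple_of (g ` L) (g ` B) (g ` E) (a \<circ> inv_into UNIV g)"
    using triple_iso_cases assms d unfolding s by blast
  have d': "triple_datum (g ` L) (g ` B) (g ` E) (a \<circ> inv_into UNIV g)"
    using triple_datum_linear_image(1)[OF d g, of "a \<circ> inv_into UNIV g"] g by simp
  have surj: "surj g"
    using g by (simp add: linear_injective_imp_surjective)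
  have inv: "linear (inv_into UNIV g)" "inj (inv_into UNIV g)" "inv_into UNIV g ` g ` X = X" for X
    using g surj by (auto simp: inj_linear_imp_inv_linear surj_imp_inj_inv image_inv_f_f)
  have "(t, triple_of (inv_into UNIV g ` g ` L) (inv_into UNIV g ` g ` B) (inv_into UNIV g ` g ` E) a) \<in> triple_iso A"
    unfolding t by (rule triple_datum_linear_image(2)[OF d' inv(1,2)]) simp
  then show ?thesis
    by (simp add: inv(3) s)
qed

lemma triple_iso_trans:
  assumes "(s, t) \<in> triple_iso A" "(t, u) \<in> triple_iso A"
  shows "(s, u) \<in> triple_iso A"
proof -
  have "s \<in> triples A"
    using assms by (auto simp: triple_iso_def)
  then obtain L B E a where d: "triple_datum L B E a" and s: "s = triple_of L B E a"
    by (rule triples_cases)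
  obtain g where g: "linear g" "inj g" and t: "t = triple_of (g ` L) (g ` B) (g ` E) (a \<circ> inv_into UNIV g)"
    using triple_iso_cases assms(1) d unfolding s by blast
  have d': "triple_datum (g ` L) (g ` B) (g ` E) (a \<circ> inv_into UNIV g)"
    using triple_datum_linear_image(1)[OF d g, of "a \<circ> inv_into UNIV g"] g by simp
  obtain h where h: "linear h" "inj h"
    and u: "u = triple_of (h ` g ` L) (h ` g ` B) (h ` g ` E) (a \<circ> inv_into UNIV g \<circ> inv_into UNIV h)"
    using triple_iso_cases assms(2) d' unfolding t by blast
  have "(s, triple_of ((h \<circ> g) ` L) ((h \<circ> g) ` B) ((h \<circ> g) ` E) (a \<circ> inv_into UNIV g \<circ> inv_into UNIV h)) \<in> triple_iso A"
    unfolding s using g h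
    by (intro triple_datum_linear_image(2)[OF d]) (auto intro: linear_compose inj_compose)
  then show ?thesis
    by (simp add: u image_comp)
qed

lemma triple_class_eq:
  assumes "(s, t) \<in> triple_iso A"
  shows "triple_class A s = triple_class A t"
  unfolding triple_class_def using assms triple_iso_sym triple_iso_trans by blast

lemma triple_symbol_iso:
  assumes "(s, t) \<in> triple_iso A"
  shows "triple_symbol A s = triple_symbol A t"
proof -
  have "s \<in> triples A"
    using assms by (auto simp: triple_iso_def)
  then obtain L B E a where d: "triple_datum L B E a" and s: "s = triple_of L B E a"
    by (rule triples_cases)
  obtain g where g: "linear g" "inj g" and t: "t = triple_of (g ` L) (g ` B) (g ` E) (a \<circ> inv_into UNIV g)"
    using triple_iso_cases assms d unfolding s by blast
  have d': "triple_datum (g ` L) (g ` B) (g ` E) (a \<circ> inv_into UNIV g)"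
    using triple_datum_linear_image(1)[OF d g, of "a \<circ> inv_into UNIV g"] g by simp
  have "mset_set (g ` B) = image_mset g (mset_set B)"
    using g inj_on_subset by (metis image_mset_mset_set subset_UNIV)
  then have "image_mset (a \<circ> inv_into UNIV g) (mset_set (g ` B)) = image_mset a (mset_set B)"
    using g by (simp add: multiset.map_comp comp_def)
  then show ?thesis
    by (simp add: s t triple_symbol_triple_of[OF d] triple_symbol_triple_of[OF d'])
qed

lemma the_elem_triple_symbol_class:
  assumes "t \<in> triples A"
  shows "the_elem (triple_symbol A ` triple_class A t) = triple_symbol A t"
proof -
  have "triple_symbol A s = triple_symbol A t" if "s \<in> triple_class A t" for s
    using that triple_symbol_iso[of t s] by (simp add: triple_class_def)
  moreover have "t \<in> triple_class A t"
    using triple_iso_refl[OF assms] by (simp add: triple_class_def)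
  ultimately have "triple_symbol A ` triple_class A t = {triple_symbol A t}"
    by blast
  then show ?thesis by simp
qed

text \<open>A value-preserving bijection between the bases extends linearly and carries all the data
  along. That the cones are basic matters: a smaller cone may or may not contain a basis vector with
  neutral coefficient, and the symbol does not show which.\<close>

lemma basic_triples_isomorphic:
  assumes d: "triple_datum L B B a" and d': "triple_datum L' B' B' a'"
    and eq: "image_mset a (mset_set B) = image_mset a' (mset_set B')"
  shows "(triple_of L B B a, triple_of L' B' B' a') \<in> triple_iso A"
proof -
  note LB = lattice_basisD[OF triple_datumD(1)[OF d]] and LB' = lattice_basisD[OF triple_datumD(1)[OF d']]
  obtain h where h: "bij_betw h B B'" "\<And>e. e \<in> B \<Longrightarrow> a' (h e) = a e"
    using image_mset_eq_imp_bij_betw[OF LB(1) LB'(1) eq] by blast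
  obtain g where g: "linear g" "\<And>e. e \<in> B \<Longrightarrow> g e = h e"
    using linear_independent_extend[OF LB(2)] by blast
  have gB: "g ` B = B'"
    using g(2) h(1) by (auto simp: bij_betw_def)
  then have "g ` UNIV = UNIV"
    using linear_span_image[OF g(1), of B] LB LB' by simp
  then have inj: "inj g"
    using g(1) linear_surjective_imp_injective by blast
  have "g ` L = L'"
    using lattice_basisD(4)[OF lattice_basis_linear_image[OF triple_datumD(1)[OF d] g(1) inj]] LB'(4)
    by (simp add: gB)
  then show ?thesis
    using triple_datum_linear_image(2)[OF d g(1) inj, of a'] g h gB by simp
qed

end

section \<open>The general blow-up relation in \<open>\<B>\<^sub>n\<close>\<close>

context coefficient_group
begin

section \<open>Symbols under subtraction of an entry\<close>

lemma generate_eq_carrier: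
  assumes "generate A X = carrier A" "X \<subseteq> generate A Y" "Y \<subseteq> carrier A"
  shows "generate A Y = carrier A"
  using A.generate_subgroup_incl[OF assms(2) A.generate_is_subgroup[OF assms(3)]]
    A.generate_incl[OF assms(3)] assms(1) by blast

lemma symbols_exchange:
  assumes "M \<in> symbols n A" "size M' = size M" "set_mset M' \<subseteq> carrier A"
    "set_mset M \<subseteq> generate A (set_mset M')"
  shows "M' \<in> symbols n A"
  using assms generate_eq_carrier[of "set_mset M" "set_mset M'"] by (auto simp: symbols_def)

definition shift :: "'c \<Rightarrow> 'c multiset \<Rightarrow> 'c multiset"
  where "shift x M = image_mset (\<lambda>y. y \<otimes>\<^bsub>A\<^esub> inv\<^bsub>A\<^esub> x) M"

text \<open>\<open>M\<close> holds the coefficients on the face that is subdivided, \<open>N\<close>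
  the others. Exactly one copy of the pivot \<open>x\<close> is kept, as the coefficient of the new
  ray; further copies become the neutral element.\<close>

definition blowup_symbol :: "'c multiset \<Rightarrow> 'c multiset \<Rightarrow> 'c \<Rightarrow> 'c multiset"
  where "blowup_symbol M N x = add_mset x (shift x (M - {#x#})) + N"

lemma generate_shift:
  assumes "x \<in> carrier A" "y \<in> carrier A" "x \<in> Y" "y \<otimes>\<^bsub>A\<^esub> inv\<^bsub>A\<^esub> x \<in> Y" "Y \<subseteq> carrier A"
  shows "y \<in> generate A Y"
proof -
  have "y \<otimes>\<^bsub>A\<^esub> inv\<^bsub>A\<^esub> x \<otimes>\<^bsub>A\<^esub> x \<in> generate A Y"
    using assms by (intro generate.eng generate.incl)
  then show ?thesis
    using assms by (simp add: A.m_assoc)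
qed

text \<open>Additively \<open>(y - c) - (x - c) = y - x\<close>: shifting by \<open>c\<close> first
  does not affect the differences with respect to the pivot.\<close>

lemma shift_shift:
  assumes "x \<in> carrier A" "y \<in> carrier A" "c \<in> carrier A"
  shows "y \<otimes>\<^bsub>A\<^esub> inv\<^bsub>A\<^esub> c \<otimes>\<^bsub>A\<^esub> inv\<^bsub>A\<^esub> (x \<otimes>\<^bsub>A\<^esub> inv\<^bsub>A\<^esub> c) = y \<otimes>\<^bsub>A\<^esub> inv\<^bsub>A\<^esub> x"
proof -
  have "inv\<^bsub>A\<^esub> (x \<otimes>\<^bsub>A\<^esub> inv\<^bsub>A\<^esub> c) = c \<otimes>\<^bsub>A\<^esub> inv\<^bsub>A\<^esub> x"
    using assms by (simp add: A.inv_mult_group)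
  moreover have "y \<otimes>\<^bsub>A\<^esub> inv\<^bsub>A\<^esub> c \<otimes>\<^bsub>A\<^esub> (c \<otimes>\<^bsub>A\<^esub> inv\<^bsub>A\<^esub> x) = y \<otimes>\<^bsub>A\<^esub> (inv\<^bsub>A\<^esub> c \<otimes>\<^bsub>A\<^esub> c) \<otimes>\<^bsub>A\<^esub> inv\<^bsub>A\<^esub> x"
    using assms by (simp only: A.m_assoc A.m_closed A.inv_closed)
  ultimately show ?thesis
    using assms by simp
qed

text \<open>No generation is lost, since an old entry is recovered from its difference with the
  pivot and the pivot itself.\<close>

lemma blowup_symbol_in_symbols:
  assumes "M + N \<in> symbols n A" "x \<in># M"
  shows "blowup_symbol M N x \<in> symbols n A"
proof (rule symbols_exchange[OF assms(1)])
  have MN: "set_mset M \<subseteq> carrier A" "set_mset N \<subseteq> carrier A"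
    using assms(1) by (auto simp: symbols_def)
  obtain M0 where M: "M = add_mset x M0"
    using assms(2) by (metis insert_DiffM)
  show "size (blowup_symbol M N x) = size (M + N)"
    by (simp add: blowup_symbol_def shift_def M)
  show sub: "set_mset (blowup_symbol M N x) \<subseteq> carrier A"
    using MN by (auto simp: blowup_symbol_def shift_def M)
  show "set_mset (M + N) \<subseteq> generate A (set_mset (blowup_symbol M N x))"
  proof
    fix y assume "y \<in> set_mset (M + N)"
    then consider "y = x" | "y \<in># M0" | "y \<in># N"
      by (auto simp: M)
    then show "y \<in> generate A (set_mset (blowup_symbol M N x))"
    proof cases
      case 2
      then show ?thesis
        using MN by (intro generate_shift[of x] sub) (auto simp: blowup_symbol_def shift_def M)
    qed (auto intro!: generate.incl simp: blowup_symbol_def)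
  qed
qed

lemma shift_in_symbols:
  assumes "add_mset c M + N \<in> symbols n A"
  shows "shift c M + add_mset c N \<in> symbols n A"
  using blowup_symbol_in_symbols[OF assms, of c] by (simp add: blowup_symbol_def)

section \<open>The relation subgroup and blow-ups with many entries\<close>

context
  fixes n :: nat
begin

abbreviation symbol_rel :: "('c multiset \<Rightarrow>\<^sub>0 int) set"
  where "symbol_rel \<equiv> symbol_relations n A"

text \<open>The symbols on the right of both relations are blow-up symbols of a two-element
  multiset, so they are symbols again.\<close>

lemma symbol_relators_subset: "symbol_relators n A \<subseteq> carrier (symbol_group n A)"
proof
  fix r assume "r \<in> symbol_relators n A"
  then consider x y N where "{#x, y#} + N \<in> symbols n A"
      "r = frag_of ({#x, y#} + N) - (frag_of ({#x, y \<otimes>\<^bsub>A\<^esub> inv\<^bsub>A\<^esub> x#} + N) + frag_of ({#x \<otimes>\<^bsub>A\<^esub> inv\<^bsub>A\<^esub> y, y#} + N))"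
    | x N where "{#x, x#} + N \<in> symbols n A" "r = frag_of ({#x, x#} + N) - frag_of ({#\<one>\<^bsub>A\<^esub>, x#} + N)"
    unfolding symbol_relators_def by blast
  then show "r \<in> carrier (symbol_group n A)"
  proof cases
    case 1
    then have "{#x, y \<otimes>\<^bsub>A\<^esub> inv\<^bsub>A\<^esub> x#} + N \<in> symbols n A" "{#x \<otimes>\<^bsub>A\<^esub> inv\<^bsub>A\<^esub> y, y#} + N \<in> symbols n A"
      using blowup_symbol_in_symbols[of "{#x, y#}" N n x] blowup_symbol_in_symbols[of "{#x, y#}" N n y]
      by (simp_all add: blowup_symbol_def shift_def add_mset_commute)
    then show ?thesis
      using 1 by (auto simp: symbol_group_def keys_frag_of dest!: subsetD[OF keys_diff] subsetD[OF keys_add])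
  next
    case 2
    then have "x \<in> carrier A"
      by (auto simp: symbols_def)
    then have "{#\<one>\<^bsub>A\<^esub>, x#} + N \<in> symbols n A"
      using 2 blowup_symbol_in_symbols[of "{#x, x#}" N n x]
      by (simp add: blowup_symbol_def shift_def add_mset_commute)
    then show ?thesis
      using 2 by (auto simp: symbol_group_def keys_frag_of dest!: subsetD[OF keys_diff])
  qed
qed

lemma subgroup_symbol_rel: "subgroup symbol_rel (free_Abelian_group (symbols n A))"
  unfolding symbol_relations_def
  using group.generate_is_subgroup[OF _ symbol_relators_subset] by (simp add: symbol_group_def)

lemma symbol_relation_distinct:
  assumes "{#x, y#} + N \<in> symbols n A" "x \<noteq> y"
  shows "frag_of ({#x, y#} + N) - (frag_of ({#x, y \<otimes>\<^bsub>A\<^esub> inv\<^bsub>A\<^esub> x#} + N) + frag_of ({#x \<otimes>\<^bsub>A\<^esub> inv\<^bsub>A\<^esub> y, y#} + N)) \<in> symbol_rel"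
  unfolding symbol_relations_def symbol_relators_def using assms by (intro generate.incl) blast

lemma symbol_relation_equal:
  assumes "{#x, x#} + N \<in> symbols n A"
  shows "frag_of ({#x, x#} + N) - frag_of ({#\<one>\<^bsub>A\<^esub>, x#} + N) \<in> symbol_rel"
  unfolding symbol_relations_def symbol_relators_def using assms by (intro generate.incl) blast

text \<open>
  Induction on the size of \<open>M\<close>: split off one entry \<open>c\<close>, apply the induction hypothesis to the rest,
  and then the two-term relation to \<open>c\<close> and each pivot \<open>x\<close>. The extra symbols created by the last
  step add up, by the induction hypothesis for \<open>M\<close> shifted by \<open>c\<close>, to the term with pivot \<open>c\<close>.
\<close>

lemma blowup_relation:
  assumes "M \<noteq> {#}" "M + N \<in> symbols n A"
  shows "frag_of (M + N) - (\<Sum>x\<in>set_mset M. frag_of (blowup_symbol M N x)) \<in> symbol_rel"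
  using assms
proof (induction "size M" arbitrary: M N)
  case 0
  then show ?case by simp
next
  case (Suc k)
  note R = subgroup_symbol_rel
  obtain c M' where M: "M = add_mset c M'"
    using Suc.hyps(2) by (metis size_eq_Suc_imp_eq_union)
  have size: "k = size M'"
    using Suc.hyps(2) M by simp
  show ?case
  proof (cases "M' = {#}")
    case True
    then show ?thesis
      using frag_subgroup_zero[OF R] by (simp add: M blowup_symbol_def shift_def)
  next
    case False
    have carr: "set_mset M' \<subseteq> carrier A" "c \<in> carrier A"
      using Suc.prems(2) by (auto simp: symbols_def M)
    \<comment> \<open>\<open>T x\<close> is the term wanted for the pivot \<open>x\<close>, and
      \<open>V x\<close> the term that the induction hypothesis gives for \<open>M'\<close> with
      \<open>c\<close> moved over to \<open>N\<close>. \<open>U x\<close> is what is left when the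
      two-term relation splits \<open>V x\<close>; it is also the blow-up symbol of
      \<open>shift c M'\<close> with pivot \<open>x - c\<close>, written additively.\<close>
    define T where "T x = frag_of (blowup_symbol M N x)" for x
    define U where "U x = frag_of (add_mset (x \<otimes>\<^bsub>A\<^esub> inv\<^bsub>A\<^esub> c) (shift x (M' - {#x#})) + add_mset c N)" for x
    define V where "V x = frag_of (blowup_symbol M' (add_mset c N) x)" for x
    have MN: "M' + add_mset c N \<in> symbols n A"
      using Suc.prems(2) by (simp add: M)
    have IH1: "frag_of (M + N) - (\<Sum>x\<in>set_mset M'. V x) \<in> symbol_rel"
      using Suc.hyps(1)[OF size False MN] by (simp add: M V_def)
    have T_c: "T c = frag_of (shift c M' + add_mset c N)"
      by (simp add: T_def blowup_symbol_def M)
    have IH2: "T c - (\<Sum>x\<in>set_mset M'. U x) \<in> symbol_rel"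
    proof -
      have "shift c M' + add_mset c N \<in> symbols n A"
        using shift_in_symbols Suc.prems(2) by (simp add: M)
      then have "T c - (\<Sum>y\<in>set_mset (shift c M'). frag_of (blowup_symbol (shift c M') (add_mset c N) y)) \<in> symbol_rel"
        using Suc.hyps(1)[of "shift c M'" "add_mset c N"] size False by (simp add: T_c shift_def)
      moreover have "(\<Sum>y\<in>set_mset (shift c M'). frag_of (blowup_symbol (shift c M') (add_mset c N) y)) = (\<Sum>x\<in>set_mset M'. U x)"
      proof -
        \<comment> \<open>Distinct pivots stay distinct after subtracting \<open>c\<close>, so the
          sum over the shifted values can be indexed by the original ones.\<close>
        have "inj_on (\<lambda>y. y \<otimes>\<^bsub>A\<^esub> inv\<^bsub>A\<^esub> c) (set_mset M')"
          by (rule inj_on_subset[OF A.inj_on_multc carr(1)]) (simp add: carr(2))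
        moreover have "blowup_symbol (shift c M') (add_mset c N) (x \<otimes>\<^bsub>A\<^esub> inv\<^bsub>A\<^esub> c) =
            add_mset (x \<otimes>\<^bsub>A\<^esub> inv\<^bsub>A\<^esub> c) (shift x (M' - {#x#})) + add_mset c N" if x: "x \<in># M'" for x
        proof -
          obtain M0 where M0: "M' = add_mset x M0"
            using x by (metis insert_DiffM)
          have "y \<otimes>\<^bsub>A\<^esub> inv\<^bsub>A\<^esub> c \<otimes>\<^bsub>A\<^esub> inv\<^bsub>A\<^esub> (x \<otimes>\<^bsub>A\<^esub> inv\<^bsub>A\<^esub> c) = y \<otimes>\<^bsub>A\<^esub> inv\<^bsub>A\<^esub> x" if "y \<in># M0" for y
            using carr that by (intro shift_shift) (auto simp: M0)
          then show ?thesis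
            by (auto simp: blowup_symbol_def shift_def M0 multiset.map_comp comp_def intro!: image_mset_cong)
        qed
        moreover have "set_mset (shift c M') = (\<lambda>y. y \<otimes>\<^bsub>A\<^esub> inv\<^bsub>A\<^esub> c) ` set_mset M'"
          by (simp add: shift_def)
        ultimately show ?thesis
          by (simp add: sum.reindex U_def)
      qed
      ultimately show ?thesis by simp
    qed
    \<comment> \<open>For \<open>x = c\<close> the relation for equal entries has a single term on
      the right, so no remainder arises.\<close>
    have V_T: "V x - (T x + (if x = c then 0 else U x)) \<in> symbol_rel" if x: "x \<in># M'" for x
    proof -
      obtain M0 where M0: "M' = add_mset x M0"
        using x by (metis insert_DiffM)
      have xc: "x \<in> carrier A"
        using x carr by auto
      have V: "V x = frag_of ({#x, c#} + (shift x M0 + N))"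
        by (simp add: V_def blowup_symbol_def M0 add_mset_commute)
      have U: "U x = frag_of ({#x \<otimes>\<^bsub>A\<^esub> inv\<^bsub>A\<^esub> c, c#} + (shift x M0 + N))"
        by (simp add: U_def M0 add_mset_commute)
      have T: "T x = frag_of ({#x, c \<otimes>\<^bsub>A\<^esub> inv\<^bsub>A\<^esub> x#} + (shift x M0 + N))"
        by (simp add: T_def blowup_symbol_def M M0 shift_def add_mset_commute)
      have sym: "{#x, c#} + (shift x M0 + N) \<in> symbols n A"
        using blowup_symbol_in_symbols[OF MN x] by (simp add: blowup_symbol_def M0 add_mset_commute)
      show ?thesis
      proof (cases "x = c")
        case True
        then show ?thesis
          unfolding V T using symbol_relation_equal[of c "shift c M0 + N"] sym xc
          by (simp add: add_mset_commute)
      next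
        case False
        then show ?thesis
          using symbol_relation_distinct[OF sym False] by (simp add: V T U)
      qed
    qed
    have "(\<Sum>x\<in>set_mset M'. V x) - (\<Sum>x\<in>set_mset M'. T x + (if x = c then 0 else U x)) \<in> symbol_rel"
      by (rule frag_subgroup_sum_diff[OF R V_T])
    from frag_subgroup_trans[OF R IH1 this]
    have main: "frag_of (M + N) - ((\<Sum>x\<in>set_mset M'. T x) + (\<Sum>x\<in>set_mset M'. if x = c then 0 else U x)) \<in> symbol_rel"
      by (simp add: sum.distrib)
    have "frag_of (M + N) - (\<Sum>x\<in>set_mset M. T x) \<in> symbol_rel"
    proof (cases "c \<in># M'")
      case True
      then obtain M0 where M0: "M' = add_mset c M0"
        by (metis insert_DiffM)
      \<comment> \<open>If \<open>c\<close> occurs again in \<open>M'\<close>, it is already among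
        the pivots there and must not be counted twice. As \<open>U c\<close> equals
        \<open>T c\<close>, the second use of the induction hypothesis says that the other
        remainders sum to a relation.\<close>
      have U_c: "U c = T c"
        using carr by (simp add: U_def T_c M0 shift_def)
      have "(\<Sum>x\<in>set_mset M'. U x) = U c + (\<Sum>x\<in>set_mset M'. if x = c then 0 else U x)"
        using True by (subst (1 2) sum.remove[of _ c]) (auto intro!: sum.cong)
      then have "(\<Sum>x\<in>set_mset M'. if x = c then 0 else U x) \<in> symbol_rel"
        using frag_subgroup_minus[OF R IH2] by (simp add: U_c)
      from frag_subgroup_add[OF R main this]
      have "frag_of (M + N) - (\<Sum>x\<in>set_mset M'. T x) \<in> symbol_rel"
        by (simp add: algebra_simps)
      moreover have "set_mset M = set_mset M'"
        using True by (auto simp: M)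
      ultimately show ?thesis
        by simp
    next
      case False
      then have "(\<Sum>x\<in>set_mset M'. if x = c then 0 else U x) = (\<Sum>x\<in>set_mset M'. U x)"
        by (intro sum.cong) auto
      moreover have "(\<Sum>x\<in>set_mset M. T x) = T c + (\<Sum>x\<in>set_mset M'. T x)"
        using False by (simp add: M)
      ultimately show ?thesis
        using frag_subgroup_diff[OF R main IH2] by (simp add: algebra_simps)
    qed
    then show ?thesis
      by (simp add: T_def)
  qed
qed

end

end

text \<open>Expanding the product of \<open>- 1 + 1\<close> over \<open>S\<close> shows that the
  alternating sum over all subsets is zero, and the empty set contributes 1 to it. The exponent
  \<open>card I - 1\<close> is the drop in dimension when \<open>I\<close> is removed from the
  generators and one new ray is added; the identity computes the Euler characteristic of a
  simplex.\<close>

lemma sum_nonempty_subsets_sign: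
  assumes "finite S" "S \<noteq> {}"
  shows "(\<Sum>I | I \<subseteq> S \<and> I \<noteq> {}. (- 1) ^ (card I - 1)) = (1 :: int)"
proof -
  have "(\<Sum>I\<in>Pow S. (- 1) ^ card I) = (\<Prod>x\<in>S. - 1 + 1 :: int)"
    by (subst prod_add[OF assms(1)]) simp
  also have "\<dots> = 0"
    using assms by (simp add: card_gt_0_iff)
  finally have "0 = (\<Sum>I\<in>Pow S. (- 1 :: int) ^ card I)" ..
  also have "Pow S = insert {} {I. I \<subseteq> S \<and> I \<noteq> {}}"
    by auto
  also have "(\<Sum>I\<in>\<dots>. (- 1 :: int) ^ card I) = 1 + (\<Sum>I | I \<subseteq> S \<and> I \<noteq> {}. (- 1) ^ card I)"
    using assms(1) by (subst sum.insert) (auto intro: finite_subset[of _ "Pow S"])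
  also have "(\<Sum>I | I \<subseteq> S \<and> I \<noteq> {}. (- 1 :: int) ^ card I) = (\<Sum>I | I \<subseteq> S \<and> I \<noteq> {}. - ((- 1) ^ (card I - 1)))"
  proof (intro sum.cong refl)
    fix I assume "I \<in> {I. I \<subseteq> S \<and> I \<noteq> {}}"
    then have "card I \<noteq> 0"
      using finite_subset[OF _ assms(1)] by (auto simp: card_eq_0_iff)
    then show "(- 1 :: int) ^ card I = - ((- 1) ^ (card I - 1))"
      by (cases "card I") auto
  qed
  finally show ?thesis
    by (simp add: sum_negf)
qed

section \<open>The map on star subdivisions\<close>

lemma sum_frag_cmul: "(\<Sum>i\<in>I. frag_cmul (c i) u) = frag_cmul (\<Sum>i\<in>I. c i) u"
  by (induction I rule: infinite_finite_induct) (auto simp: frag_cmul_distrib)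

context coefficient_group
begin

lemma symbol_map_triple_class:
  "t \<in> triples A \<Longrightarrow> symbol_map A (frag_of (triple_class A t)) = frag_of (triple_symbol A t)"
  by (simp add: symbol_map_def the_elem_triple_symbol_class)

context
  fixes L :: "(real^'n) set" and B E F a
  assumes d: "triple_datum L B E a" and F: "F \<subseteq> E" "2 \<le> card F"
begin

private lemmas star_datumD = triple_datumD[OF d] and star_basisD = lattice_basisD[OF triple_datumD(1)[OF d]]

text \<open>Indexed by the set \<open>I\<close> of generators that are removed from the face. The
  proper subsets in \<open>star_subdivision\<close> are the complements \<open>F - I\<close>, so
  they correspond to nonempty \<open>I\<close>.\<close>

definition star_generators :: "(real^'n) set \<Rightarrow> (real^'n) set"
  where "star_generators I = insert (\<Sum>F) ((E - F) \<union> (F - I))"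

lemma F_subset: "F \<subseteq> B" and finite_F: "finite F" and finite_E: "finite E" and sum_F_notin: "\<Sum>F \<notin> B"
proof -
  show FB: "F \<subseteq> B" using F star_datumD by auto
  show "finite F" "finite E" using finite_subset[OF FB star_basisD(1)] finite_subset[OF star_datumD(2) star_basisD(1)] .
  show "\<Sum>F \<notin> B" by (rule sum_notin_independent[OF star_basisD(2,1) FB F(2)])
qed

lemma star_generators_subset_basis:
  assumes "f \<in> I" "I \<subseteq> F"
  shows "lattice_basis L (insert (\<Sum>F) (B - {f}))" "star_generators I \<subseteq> insert (\<Sum>F) (B - {f})"
    "part_of_basis L (star_generators I)"
proof -
  show *: "lattice_basis L (insert (\<Sum>F) (B - {f}))"
    using lattice_basis_replace_sum[OF star_datumD(1) F_subset F(2)] assms by blast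
  show "star_generators I \<subseteq> insert (\<Sum>F) (B - {f})"
    using assms F star_datumD(2) by (auto simp: star_generators_def)
  with * show "part_of_basis L (star_generators I)"
    by (auto simp: part_of_basis_def)
qed

text \<open>All of \<open>I\<close> leaves and one new generator enters.\<close>

lemma card_star_generators:
  assumes "I \<subseteq> F" "I \<noteq> {}"
  shows "card E - card (star_generators I) = card I - 1"
proof -
  have fin: "finite I"
    using assms finite_F finite_subset by blast
  have "card (star_generators I) = Suc (card (E - I))"
  proof -
    have "(E - F) \<union> (F - I) = E - I"
      using assms F by auto
    moreover have "\<Sum>F \<notin> E - I"
      using sum_F_notin star_datumD(2) by auto
    ultimately show ?thesis
      using finite_E by (simp add: star_generators_def)
  qed
  also have "card (E - I) = card E - card I"
    using assms F fin by (intro card_Diff_subset) auto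
  finally show ?thesis
    using card_mono[OF finite_E, of I] assms F fin card_gt_0_iff[of I] by auto
qed

lemma dim_star_cone:
  assumes "I \<subseteq> F" "I \<noteq> {}"
  shows "dim (convex_cone hull E) - dim (convex_cone hull (star_generators I)) = card I - 1"
proof -
  obtain f where f: "f \<in> I" using assms by auto
  have "independent E"
    using real_vector.dependent_mono[of E B] star_datumD(2) star_basisD(2) by blast
  moreover have "independent (star_generators I)"
    using real_vector.dependent_mono star_generators_subset_basis(2)[OF f assms(1)]
      lattice_basisD(2)[OF star_generators_subset_basis(1)[OF f assms(1)]] by blast
  ultimately show ?thesis
    using card_star_generators[OF assms] by (simp add: dim_convex_cone_hull)
qed

text \<open>The coefficients of the unchanged tensor in the basis where \<open>\<Sum>F\<close> takes
  the place of \<open>f\<close>.\<close>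

definition star_coefficients :: "real^'n \<Rightarrow> real^'n \<Rightarrow> 'c"
  where "star_coefficients f =
    (\<lambda>e. if e = \<Sum>F then a f else if e \<in> F then a e \<otimes>\<^bsub>A\<^esub> inv\<^bsub>A\<^esub> a f else a e)"

lemma star_coefficients_closed:
  "f \<in> F \<Longrightarrow> star_coefficients f \<in> insert (\<Sum>F) (B - {f}) \<rightarrow> carrier A"
  using F_subset funcset_mem[OF star_datumD(3)] by (auto simp: star_coefficients_def subset_iff)

lemma tensor_sum_star:
  "f \<in> F \<Longrightarrow> tensor_sum L B a = tensor_sum L (insert (\<Sum>F) (B - {f})) (star_coefficients f)"
  unfolding star_coefficients_def by (rule tensor_sum_replace_sum[OF star_datumD(1) F_subset F(2) _ star_datumD(3)])

text \<open>In the basis with some \<open>f\<close> of \<open>I\<close> exchanged, the vectors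
  missing from the cone are those outside \<open>E\<close>, where the coefficients are neutral
  anyway, and those of \<open>I - {f}\<close>, where they are the differences from
  \<open>a f\<close>. So a cone survives when the coefficients are constant on the removed
  generators.\<close>

lemma supported_on_star_iff:
  assumes f: "f \<in> I" and I: "I \<subseteq> F"
  shows "supported_on A L (tensor_sum L B a) (convex_cone hull (star_generators I)) \<longleftrightarrow> (\<forall>e\<in>I. a e = a f)"
proof -
  have fF: "f \<in> F" using f I by auto
  have "supported_on A L (tensor_sum L B a) (convex_cone hull (star_generators I)) \<longleftrightarrow>
      (\<forall>e\<in>insert (\<Sum>F) (B - {f}) - star_generators I. star_coefficients f e = \<one>\<^bsub>A\<^esub>)"
    unfolding tensor_sum_star[OF fF]
    by (rule supported_on_iff[OF star_generators_subset_basis(1,2)[OF f I] star_coefficients_closed[OF fF]])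
  also have "insert (\<Sum>F) (B - {f}) - star_generators I = (B - E) \<union> (I - {f})"
    using sum_F_notin F I star_datumD(2) f by (auto simp: star_generators_def)
  also have "(\<forall>e\<in>(B - E) \<union> (I - {f}). star_coefficients f e = \<one>\<^bsub>A\<^esub>) \<longleftrightarrow>
      (\<forall>e\<in>I - {f}. a e \<otimes>\<^bsub>A\<^esub> inv\<^bsub>A\<^esub> a f = \<one>\<^bsub>A\<^esub>)"
  proof -
    have "star_coefficients f e = \<one>\<^bsub>A\<^esub>" if "e \<in> B - E" for e
      using that star_datumD(4) sum_F_notin F by (auto simp: star_coefficients_def)
    moreover have "star_coefficients f e = a e \<otimes>\<^bsub>A\<^esub> inv\<^bsub>A\<^esub> a f" if "e \<in> I" for e
      using that I F_subset sum_F_notin by (auto simp: star_coefficients_def)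
    ultimately show ?thesis
      unfolding ball_Un by (metis (no_types, lifting) DiffD1)
  qed
  also have "\<dots> \<longleftrightarrow> (\<forall>e\<in>I. a e = a f)"
  proof -
    have "a e \<otimes>\<^bsub>A\<^esub> inv\<^bsub>A\<^esub> a f = \<one>\<^bsub>A\<^esub> \<longleftrightarrow> a e = a f" if "e \<in> I" for e
    proof -
      have ae: "a e \<in> carrier A" "a f \<in> carrier A"
        using that I f F_subset funcset_mem[OF star_datumD(3)] by auto
      then have "a e \<otimes>\<^bsub>A\<^esub> inv\<^bsub>A\<^esub> a f = \<one>\<^bsub>A\<^esub> \<Longrightarrow> a e = a f"
        using A.inv_equality[of "a e" "inv\<^bsub>A\<^esub> a f"] by simp
      then show ?thesis
        using ae by auto
    qed
    then show ?thesis by auto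
  qed
  finally show ?thesis .
qed

text \<open>The tensor itself has not changed, so support and generation need no computation with
  the new coefficients: both are read off from the tensor through its original expansion.\<close>

lemma triple_datum_star:
  assumes f: "f \<in> I" and I: "I \<subseteq> F" "\<forall>e\<in>I. a e = a f"
  shows "triple_datum L (insert (\<Sum>F) (B - {f})) (star_generators I) (star_coefficients f)"
proof -
  have fF: "f \<in> F" using f I by auto
  note star = star_generators_subset_basis[OF f I(1)]
  have "supported_on A L (tensor_sum L (insert (\<Sum>F) (B - {f})) (star_coefficients f))
      (convex_cone hull (star_generators I))"
    using supported_on_star_iff[OF f I(1)] I(2) by (simp add: tensor_sum_star[OF fF])
  then have "\<forall>e\<in>insert (\<Sum>F) (B - {f}) - star_generators I. star_coefficients f e = \<one>\<^bsub>A\<^esub>"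
    using supported_on_iff[OF star(1,2) star_coefficients_closed[OF fF]] by simp
  moreover have "generate A (star_coefficients f ` insert (\<Sum>F) (B - {f})) = carrier A"
    using tensor_eval_image[OF star(1) star_coefficients_closed[OF fF]] tensor_eval_image[OF star_datumD(1,3)] star_datumD(5)
    by (simp add: tensor_sum_star[OF fF])
  ultimately show ?thesis
    using star star_coefficients_closed[OF fF] by (simp add: triple_datum_def)
qed

lemma star_symbol:
  assumes f: "f \<in> F"
  shows "image_mset (star_coefficients f) (mset_set (insert (\<Sum>F) (B - {f}))) =
    blowup_symbol (image_mset a (mset_set F)) (image_mset a (mset_set (B - F))) (a f)"
proof -
  have "B - {f} = (F - {f}) \<union> (B - F)"
    using f F_subset by auto
  moreover have "mset_set ((F - {f}) \<union> (B - F)) = mset_set (F - {f}) + mset_set (B - F)"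
    using finite_F star_basisD(1) by (intro mset_set_Union) auto
  moreover have "mset_set (insert (\<Sum>F) (B - {f})) = add_mset (\<Sum>F) (mset_set (B - {f}))"
    using sum_F_notin star_basisD(1) by simp
  ultimately have "mset_set (insert (\<Sum>F) (B - {f})) = add_mset (\<Sum>F) (mset_set (F - {f}) + mset_set (B - F))"
    by (simp only:)
  moreover have "image_mset (star_coefficients f) (mset_set (F - {f})) =
      image_mset (\<lambda>e. a e \<otimes>\<^bsub>A\<^esub> inv\<^bsub>A\<^esub> a f) (mset_set (F - {f}))"
    using finite_F F_subset sum_F_notin by (intro image_mset_cong) (auto simp: star_coefficients_def)
  moreover have "image_mset (star_coefficients f) (mset_set (B - F)) = image_mset a (mset_set (B - F))"
    using star_basisD(1) sum_F_notin by (intro image_mset_cong) (auto simp: star_coefficients_def)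
  moreover have "star_coefficients f (\<Sum>F) = a f"
    by (simp add: star_coefficients_def)
  moreover have "image_mset a (mset_set F) = add_mset (a f) (image_mset a (mset_set (F - {f})))"
    using mset_set.remove[OF finite_F f] by simp
  ultimately show ?thesis
    by (simp add: blowup_symbol_def shift_def multiset.map_comp comp_def)
qed

lemma symbol_map_star:
  assumes f: "f \<in> I" and I: "I \<subseteq> F" "\<forall>e\<in>I. a e = a f"
  shows "(L, tensor_sum L B a, convex_cone hull (star_generators I)) \<in> triples A"
    and "symbol_map A (frag_of (triple_class A (L, tensor_sum L B a, convex_cone hull (star_generators I)))) =
      frag_of (blowup_symbol (image_mset a (mset_set F)) (image_mset a (mset_set (B - F))) (a f))"
proof -
  have fF: "f \<in> F" using f I by auto
  have eq: "(L, tensor_sum L B a, convex_cone hull (star_generators I)) =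
      triple_of L (insert (\<Sum>F) (B - {f})) (star_generators I) (star_coefficients f)"
    by (simp add: triple_of_def tensor_sum_star[OF fF])
  show *: "(L, tensor_sum L B a, convex_cone hull (star_generators I)) \<in> triples A"
    unfolding eq by (rule triple_of_in_triples[OF triple_datum_star[OF assms]])
  show "symbol_map A (frag_of (triple_class A (L, tensor_sum L B a, convex_cone hull (star_generators I)))) =
      frag_of (blowup_symbol (image_mset a (mset_set F)) (image_mset a (mset_set (B - F))) (a f))"
    unfolding symbol_map_triple_class[OF *] unfolding eq
    by (simp add: triple_symbol_triple_of[OF triple_datum_star[OF assms]] star_symbol[OF fF])
qed

text \<open>The relation sums over a set of cones; to sum over index sets instead, different
  \<open>I\<close> must give different cones. \<open>I\<close> is recovered as the part of
  \<open>F\<close> missing from the generators, which the cone determines.\<close>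

lemma supported_star_subdivision:
  "bij_betw (\<lambda>I. convex_cone hull (star_generators I)) {I. I \<subseteq> F \<and> I \<noteq> {} \<and> (\<forall>e\<in>I. \<forall>e'\<in>I. a e = a e')}
    {\<Lambda> \<in> star_subdivision E F. supported_on A L (tensor_sum L B a) \<Lambda>}"
  unfolding bij_betw_def
proof
  show "inj_on (\<lambda>I. convex_cone hull (star_generators I)) {I. I \<subseteq> F \<and> I \<noteq> {} \<and> (\<forall>e\<in>I. \<forall>e'\<in>I. a e = a e')}"
  proof (rule inj_onI, clarify)
    fix I J assume I: "I \<subseteq> F" "I \<noteq> {}" and J: "J \<subseteq> F" "J \<noteq> {}"
      and eq: "convex_cone hull (star_generators I) = convex_cone hull (star_generators J)"
    have "part_of_basis L (star_generators I)" "part_of_basis L (star_generators J)"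
      using I J star_generators_subset_basis(3) by (metis ex_in_conv)+
    then have "star_generators I = star_generators J"
      using part_of_basis_eq_if_cone_eq eq by blast
    then have "star_generators I \<inter> F = star_generators J \<inter> F"
      by simp
    moreover have "star_generators K \<inter> F = F - K" for K
      using sum_F_notin F_subset by (auto simp: star_generators_def)
    ultimately show "I = J"
      using I J by auto
  qed
  show "(\<lambda>I. convex_cone hull (star_generators I)) ` {I. I \<subseteq> F \<and> I \<noteq> {} \<and> (\<forall>e\<in>I. \<forall>e'\<in>I. a e = a e')} =
    {\<Lambda> \<in> star_subdivision E F. supported_on A L (tensor_sum L B a) \<Lambda>}"
  proof (rule subset_antisym; rule subsetI)
    fix \<Lambda> assume "\<Lambda> \<in> (\<lambda>I. convex_cone hull (star_generators I)) ` {I. I \<subseteq> F \<and> I \<noteq> {} \<and> (\<forall>e\<in>I. \<forall>e'\<in>I. a e = a e')}"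
    then obtain I where I': "I \<subseteq> F" "I \<noteq> {}" "\<forall>e\<in>I. \<forall>e'\<in>I. a e = a e'" "\<Lambda> = convex_cone hull (star_generators I)"
      by blast
    then obtain f where "f \<in> I"
      by blast
    with I' have I: "I \<subseteq> F" "f \<in> I" "\<forall>e\<in>I. a e = a f" "\<Lambda> = convex_cone hull (star_generators I)"
      by blast+
    have "F - I \<subset> F"
      using I by auto
    then have "\<Lambda> \<in> star_subdivision E F"
      unfolding star_subdivision_def I(4) star_generators_def by blast
    moreover have "supported_on A L (tensor_sum L B a) \<Lambda>"
      unfolding I(4) supported_on_star_iff[OF I(2,1)] by (rule I(3))
    ultimately show "\<Lambda> \<in> {\<Lambda> \<in> star_subdivision E F. supported_on A L (tensor_sum L B a) \<Lambda>}"
      by blast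
  next
    fix \<Lambda> assume *: "\<Lambda> \<in> {\<Lambda> \<in> star_subdivision E F. supported_on A L (tensor_sum L B a) \<Lambda>}"
    then obtain F' where F': "F' \<subset> F" "\<Lambda> = convex_cone hull (insert (\<Sum>F) ((E - F) \<union> F'))"
      by (auto simp: star_subdivision_def)
    then have "F - (F - F') = F'"
      by auto
    then have \<Lambda>: "\<Lambda> = convex_cone hull (star_generators (F - F'))"
      by (simp add: F'(2) star_generators_def)
    obtain f where f: "f \<in> F - F'"
      using F' by auto
    have "\<forall>e\<in>F - F'. a e = a f"
      using supported_on_star_iff[OF f] * by (simp add: \<Lambda>)
    then have ae: "a e = a f" if "e \<in> F - F'" for e
      using that by blast
    have "a e = a e'" if "e \<in> F - F'" "e' \<in> F - F'" for e e'
      using ae[OF that(1)] ae[OF that(2)] by simp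
    then have "F - F' \<in> {I. I \<subseteq> F \<and> I \<noteq> {} \<and> (\<forall>e\<in>I. \<forall>e'\<in>I. a e = a e')}"
      using f by blast
    then show "\<Lambda> \<in> (\<lambda>I. convex_cone hull (star_generators I)) ` {I. I \<subseteq> F \<and> I \<noteq> {} \<and> (\<forall>e\<in>I. \<forall>e'\<in>I. a e = a e')}"
      unfolding \<Lambda> by (rule imageI)
  qed
qed

text \<open>
  The star cones with the same value \<open>x\<close> of \<open>a\<close> on the removed generators all have the same symbol,
  and their signs add up to \<open>1\<close>.
\<close>

lemma symbol_map_star_relator:
  "symbol_map A (frag_of (triple_class A (triple_of L B E a))
      - (\<Sum>\<Lambda> \<in> {\<Lambda> \<in> star_subdivision E F. supported_on A L (tensor_sum L B a) \<Lambda>}.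
            frag_cmul ((-1) ^ (dim (convex_cone hull E) - dim \<Lambda>))
              (frag_of (triple_class A (L, tensor_sum L B a, \<Lambda>))))) =
    frag_of (image_mset a (mset_set F) + image_mset a (mset_set (B - F)))
      - (\<Sum>x\<in>set_mset (image_mset a (mset_set F)).
          frag_of (blowup_symbol (image_mset a (mset_set F)) (image_mset a (mset_set (B - F))) x))"
proof -
  let ?M = "image_mset a (mset_set F)" and ?N = "image_mset a (mset_set (B - F))"
  let ?\<S> = "{\<Lambda> \<in> star_subdivision E F. supported_on A L (tensor_sum L B a) \<Lambda>}"
  let ?\<I> = "{I. I \<subseteq> F \<and> I \<noteq> {} \<and> (\<forall>e\<in>I. \<forall>e'\<in>I. a e = a e')}"
  let ?C = "\<lambda>I. convex_cone hull (star_generators I)"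
  let ?g = "\<lambda>\<Lambda>. frag_cmul ((-1) ^ (dim (convex_cone hull E) - dim \<Lambda>))
              (frag_of (triple_class A (L, tensor_sum L B a, \<Lambda>)))"
  define S where "S x = {e \<in> F. a e = x}" for x
  have fin: "finite ?\<I>"
    using finite_F by (auto intro: finite_subset[of _ "Pow F"])
  have g: "symbol_map A (?g (?C I)) = frag_cmul ((-1) ^ (card I - 1)) (frag_of (blowup_symbol ?M ?N x))"
    if I: "I \<subseteq> S x" "I \<noteq> {}" for I x
  proof -
    obtain f where f: "f \<in> I" using I by auto
    have IF: "I \<subseteq> F" "\<forall>e\<in>I. a e = a f" "a f = x"
      using I f by (auto simp: S_def)
    show ?thesis
      using symbol_map_star(2)[OF f IF(1,2)] dim_star_cone[OF IF(1) I(2)] IF(3)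
      by (simp add: symbol_map_def frag_extend_cmul)
  qed
  have "(\<Sum>\<Lambda>\<in>?\<S>. ?g \<Lambda>) = (\<Sum>I\<in>?\<I>. ?g (?C I))"
    by (rule sum.reindex_bij_betw[OF supported_star_subdivision, symmetric])
  then have "symbol_map A (\<Sum>\<Lambda>\<in>?\<S>. ?g \<Lambda>) = (\<Sum>I\<in>?\<I>. symbol_map A (?g (?C I)))"
    using fin by (simp add: symbol_map_def frag_extend_sum o_def)
  \<comment> \<open>A nonempty set on which \<open>a\<close> is constant lies in exactly one fibre
    of \<open>a\<close> on \<open>F\<close>, so the sum splits according to the value.\<close>
  also have "?\<I> = (\<Union>x\<in>a ` F. {I. I \<subseteq> S x \<and> I \<noteq> {}})"
  proof (rule subset_antisym; rule subsetI)
    fix I assume I: "I \<in> ?\<I>"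
    then obtain f where "f \<in> I" by blast
    with I have "a f \<in> a ` F" "I \<subseteq> S (a f)" "I \<noteq> {}"
      unfolding S_def by blast+
    then show "I \<in> (\<Union>x\<in>a ` F. {I. I \<subseteq> S x \<and> I \<noteq> {}})"
      by blast
  next
    fix I assume "I \<in> (\<Union>x\<in>a ` F. {I. I \<subseteq> S x \<and> I \<noteq> {}})"
    then obtain x where x: "I \<subseteq> S x" "I \<noteq> {}"
      by blast
    have ae: "a e = x" if "e \<in> I" for e
      using x(1) that by (auto simp: S_def)
    have "a e = a e'" if "e \<in> I" "e' \<in> I" for e e'
      using ae[OF that(1)] ae[OF that(2)] by simp
    moreover have "I \<subseteq> F"
      using x(1) by (auto simp: S_def)
    ultimately show "I \<in> ?\<I>"
      using x(2) by blast
  qed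
  also have "(\<Sum>I\<in>\<dots>. symbol_map A (?g (?C I))) = (\<Sum>x\<in>a ` F. \<Sum>I | I \<subseteq> S x \<and> I \<noteq> {}. symbol_map A (?g (?C I)))"
  proof (rule sum.UNION_disjoint)
    show "finite (a ` F)" using finite_F by simp
    show "\<forall>x\<in>a ` F. finite {I. I \<subseteq> S x \<and> I \<noteq> {}}"
      using finite_F by (auto intro!: finite_subset[of _ "Pow F"] simp: S_def)
    show "\<forall>x\<in>a ` F. \<forall>y\<in>a ` F. x \<noteq> y \<longrightarrow> {I. I \<subseteq> S x \<and> I \<noteq> {}} \<inter> {I. I \<subseteq> S y \<and> I \<noteq> {}} = {}"
    proof (intro ballI impI)
      fix x y :: 'c assume "x \<noteq> y"
      then have "S x \<inter> S y = {}"
        by (auto simp: S_def)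
      then have "I = {}" if "I \<subseteq> S x" "I \<subseteq> S y" for I
        using that by (metis Int_greatest subset_empty)
      then show "{I. I \<subseteq> S x \<and> I \<noteq> {}} \<inter> {I. I \<subseteq> S y \<and> I \<noteq> {}} = {}"
        by blast
    qed
  qed
  also have "\<dots> = (\<Sum>x\<in>a ` F. frag_of (blowup_symbol ?M ?N x))"
  proof (rule sum.cong[OF refl])
    fix x assume "x \<in> a ` F"
    then have S: "finite (S x)" "S x \<noteq> {}"
      using finite_F by (auto simp: S_def)
    have "(\<Sum>I | I \<subseteq> S x \<and> I \<noteq> {}. symbol_map A (?g (?C I))) =
        (\<Sum>I | I \<subseteq> S x \<and> I \<noteq> {}. frag_cmul ((-1) ^ (card I - 1)) (frag_of (blowup_symbol ?M ?N x)))"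
    proof (rule sum.cong[OF refl])
      fix I assume "I \<in> {I. I \<subseteq> S x \<and> I \<noteq> {}}"
      then have "I \<subseteq> S x" "I \<noteq> {}" by simp_all
      then show "symbol_map A (?g (?C I)) = frag_cmul ((-1) ^ (card I - 1)) (frag_of (blowup_symbol ?M ?N x))"
        by (rule g)
    qed
    also have "\<dots> = frag_of (blowup_symbol ?M ?N x)"
      unfolding sum_frag_cmul sum_nonempty_subsets_sign[OF S] by simp
    finally show "(\<Sum>I | I \<subseteq> S x \<and> I \<noteq> {}. symbol_map A (?g (?C I))) = frag_of (blowup_symbol ?M ?N x)" .
  qed
  finally have sum: "symbol_map A (\<Sum>\<Lambda>\<in>?\<S>. ?g \<Lambda>) = (\<Sum>x\<in>a ` F. frag_of (blowup_symbol ?M ?N x))" .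
  have "B = F \<union> (B - F)"
    using F_subset by auto
  then have "mset_set B = mset_set F + mset_set (B - F)"
    using finite_F star_basisD(1) mset_set_Union[of F "B - F"] by auto
  then have "symbol_map A (frag_of (triple_class A (triple_of L B E a))) = frag_of (?M + ?N)"
    using symbol_map_triple_class[OF triple_of_in_triples[OF d]] triple_symbol_triple_of[OF d] by simp
  with sum show ?thesis
    using finite_F by (simp add: symbol_map_def frag_extend_diff)
qed

end

end

section \<open>The isomorphism\<close>

lemma image_mset_mset_set_surj:
  assumes "finite B" "size M = card B"
  obtains a where "image_mset a (mset_set B) = M"
proof -
  have "\<exists>a. image_mset a (mset_set B) = M"
    using assms
  proof (induction B arbitrary: M rule: finite_induct)
    case (insert b B)
    then obtain x M' where M: "M = add_mset x M'"
      by (metis card.insert size_eq_Suc_imp_eq_union)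
    with insert obtain a where a: "image_mset a (mset_set B) = M'"
      by fastforce
    have "image_mset (a(b := x)) (mset_set B) = image_mset a (mset_set B)"
      using insert.hyps by (intro image_mset_cong) auto
    then have "image_mset (a(b := x)) (mset_set (insert b B)) = M"
      using insert.hyps by (simp add: M a)
    then show ?case by blast
  qed simp
  then show ?thesis using that by blast
qed

text \<open>The case \<open>x = y\<close> is included: multiplicity two still yields two different
  elements of \<open>B\<close>, found one after the other. This gives a genuine two-dimensional
  face.\<close>

lemma mset_set_image_pairE:
  assumes "finite B" "image_mset a (mset_set B) = add_mset x (add_mset y N)"
  obtains e f where "e \<in> B" "f \<in> B" "e \<noteq> f" "a e = x" "a f = y" "image_mset a (mset_set (B - {e, f})) = N"
proof -
  have "x \<in># image_mset a (mset_set B)"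
    by (simp add: assms(2))
  then obtain e where e: "e \<in> B" "a e = x"
    using assms(1) by auto
  then have N: "image_mset a (mset_set (B - {e})) = add_mset y N"
    using assms mset_set.remove[OF assms(1) e(1)] by simp
  then have "y \<in># image_mset a (mset_set (B - {e}))"
    by simp
  then obtain f where f: "f \<in> B - {e}" "a f = y"
    using assms(1) by auto
  have "finite (B - {e})"
    using assms(1) by simp
  then have "image_mset a (mset_set (B - {e} - {f})) = N"
    using N f mset_set.remove[of "B - {e}" f] by simp
  moreover have "B - {e} - {f} = B - {e, f}"
    by auto
  ultimately show ?thesis
    using that[of e f] e f by auto
qed

lemma real_vec_lattice_basis: "lattice_basis (int_span (Basis :: (real^'n) set)) Basis"
  by (simp add: lattice_basis_def independent_Basis)

context coefficient_group
begin

text \<open>The entries are distributed over the standard basis of the standard lattice, in any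
  order.\<close>

lemma symbol_triple_exists:
  assumes "M \<in> symbols CARD('n) A"
  obtains L and B :: "(real^'n) set" and a where "triple_datum L B B a" "image_mset a (mset_set B) = M"
proof -
  let ?B = "Basis :: (real^'n) set"
  have "size M = card ?B"
    using assms by (simp add: symbols_def)
  then obtain a where a: "image_mset a (mset_set ?B) = M"
    using image_mset_mset_set_surj finite_Basis by metis
  then have "set_mset M = a ` ?B"
    by (metis finite_Basis finite_set_mset_mset_set set_image_mset)
  then have "triple_datum (int_span ?B) ?B ?B a"
    using assms by (auto simp: triple_datum_def real_vec_lattice_basis symbols_def)
  then show ?thesis
    using that a by blast
qed

lemma triple_symbol_in_symbols:
  fixes t :: "('n::finite, 'c) triple"
  assumes "t \<in> triples A"
  shows "triple_symbol A t \<in> symbols CARD('n) A"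
  using assms by (elim triples_cases) (simp add: triple_symbol_triple_of symbol_in_symbols)

lemma class_in_T_group:
  fixes t :: "('n::finite, 'c) triple"
  assumes "t \<in> triples A"
  shows "frag_of (triple_class A t) \<in> carrier (T_group TYPE('n) A)"
  using assms by (simp add: T_group_def triple_class_def quotientI)

lemma T_group_classE:
  assumes "C \<in> triples A // triple_iso A"
  obtains t where "t \<in> triples A" "C = triple_class A t"
  using assms that by (auto simp: quotient_def triple_class_def)

lemma symbol_map_hom:
  "symbol_map A \<in> hom (T_group TYPE('n::finite) A) (symbol_group CARD('n) A)"
  unfolding symbol_map_def T_group_def symbol_group_def
proof (rule frag_extend_frag_of_hom)
  fix C :: "('n, 'c) triple set" assume "C \<in> triples A // triple_iso A"
  then obtain t where "t \<in> triples A" "C = triple_class A t"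
    by (rule T_group_classE)
  then show "frag_of (the_elem (triple_symbol A ` C)) \<in> carrier (free_Abelian_group (symbols CARD('n) A))"
    by (simp add: the_elem_triple_symbol_class triple_symbol_in_symbols)
qed

definition star_relator :: "(real^'n::finite) set \<Rightarrow> (real^'n) set \<Rightarrow> (real^'n) set \<Rightarrow> (real^'n) set \<Rightarrow> (real^'n \<Rightarrow> 'c)
    \<Rightarrow> (('n, 'c) triple set \<Rightarrow>\<^sub>0 int)"
  where "star_relator L B E F a = frag_of (triple_class A (triple_of L B E a))
      - (\<Sum>\<Lambda> \<in> {\<Lambda> \<in> star_subdivision E F. supported_on A L (tensor_sum L B a) \<Lambda>}.
            frag_cmul ((-1) ^ (dim (convex_cone hull E) - dim \<Lambda>))
              (frag_of (triple_class A (L, tensor_sum L B a, \<Lambda>))))"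

text \<open>Brings both families into coordinates. In the second, the face is spanned by the vectors
  of \<open>B\<close> that it contains, so the basis of the basic cone serves both triples, with one
  and the same coefficient function.\<close>

lemma subdivision_relators_cases:
  assumes "r \<in> subdivision_relators TYPE('n::finite) A"
  obtains (star) L and B :: "(real^'n) set" and E F a where "triple_datum L B E a" "F \<subseteq> E" "2 \<le> card F"
      "r = star_relator L B E F a"
  | (face) L and B :: "(real^'n) set" and E a where "triple_datum L B E a"
      "r = frag_of (triple_class A (triple_of L B E a)) - frag_of (triple_class A (triple_of L B B a))"
proof -
  consider (1) L and \<xi> and \<Lambda>' and E F :: "(real^'n) set" where "(L, \<xi>, \<Lambda>') \<in> triples A" "part_of_basis L E"
      "\<Lambda>' = convex_cone hull E" "F \<subseteq> E" "2 \<le> card F"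
      "r = frag_of (triple_class A (L, \<xi>, \<Lambda>'))
       - (\<Sum>\<Lambda> \<in> {\<Lambda> \<in> star_subdivision E F. supported_on A L \<xi> \<Lambda>}.
            frag_cmul ((-1) ^ (dim \<Lambda>' - dim \<Lambda>)) (frag_of (triple_class A (L, \<xi>, \<Lambda>))))"
    | (2) L \<xi> and \<Lambda>' \<Lambda> :: "(real^'n) set" where "(L, \<xi>, \<Lambda>') \<in> triples A" "basic_cone L \<Lambda>" "\<Lambda>' face_of \<Lambda>"
      "r = frag_of (triple_class A (L, \<xi>, \<Lambda>')) - frag_of (triple_class A (L, \<xi>, \<Lambda>))"
    using assms unfolding subdivision_relators_def by blast
  then show ?thesis
  proof cases
    case 1
    obtain B where B: "lattice_basis L B" "E \<subseteq> B"
      using 1(2) by (auto simp: part_of_basis_def)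
    obtain a where "triple_datum L B E a" "\<xi> = tensor_sum L B a"
      using triple_datum_exists[OF 1(1,2,3) B] .
    then show ?thesis
      using star[of L B E a F] 1 by (simp add: star_relator_def triple_of_def)
  next
    case 2
    obtain B where B: "lattice_basis L B" "\<Lambda> = convex_cone hull B"
      using 2(2) by (auto simp: basic_cone_def)
    have "convex_cone \<Lambda>'"
      using 2(1) convex_cone_convex_cone_hull by (auto simp: triples_def smooth_cone_def)
    then have \<Lambda>': "\<Lambda>' = convex_cone hull (B \<inter> \<Lambda>')"
      using face_of_convex_cone_hull_eq[OF lattice_basisD(2)[OF B(1)]] 2(3) B(2) by blast
    have "part_of_basis L (B \<inter> \<Lambda>')"
      using B(1) by (auto simp: part_of_basis_def)
    then obtain a where "triple_datum L B (B \<inter> \<Lambda>') a" "\<xi> = tensor_sum L B a"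
      using triple_datum_exists[OF 2(1) _ \<Lambda>' B(1) Int_lower1] by blast
    then show ?thesis
      using face[of L B "B \<inter> \<Lambda>'" a] 2(4) B(2) \<Lambda>' by (simp add: triple_of_def)
  qed
qed

lemma triple_datum_full: "triple_datum L B E a \<Longrightarrow> triple_datum L B B a"
  by (simp add: triple_datum_def)

lemma star_relator_in_relators:
  fixes L :: "(real^'n::finite) set"
  assumes d: "triple_datum L B E a" and F: "F \<subseteq> E" "2 \<le> card F"
  shows "star_relator L B E F a \<in> subdivision_relators TYPE('n) A"
proof -
  have "(L, tensor_sum L B a, convex_cone hull E) \<in> triples A"
    using triple_of_in_triples[OF d] by (simp add: triple_of_def)
  then show ?thesis
    unfolding subdivision_relators_def star_relator_def triple_of_def
    using triple_datumD(7)[OF d] F by blast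
qed

lemma face_relator_in_relators:
  fixes L :: "(real^'n::finite) set"
  assumes d: "triple_datum L B E a"
  shows "frag_of (triple_class A (triple_of L B E a)) - frag_of (triple_class A (triple_of L B B a))
    \<in> subdivision_relators TYPE('n) A"
proof -
  note d' = triple_datumD[OF d]
  have "(L, tensor_sum L B a, convex_cone hull E) \<in> triples A"
    using triple_of_in_triples[OF d] by (simp add: triple_of_def)
  moreover have "basic_cone L (convex_cone hull B)"
    using d'(1) by (auto simp: basic_cone_def)
  moreover have "convex_cone hull E face_of convex_cone hull B"
    using convex_cone_hull_face_of[OF lattice_basisD(2)[OF d'(1)] d'(2)] .
  ultimately show ?thesis
    unfolding subdivision_relators_def triple_of_def by blast
qed

text \<open>Only cones passing the support condition enter the sum, and for these the subdivided
  triple is again a triple.\<close>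

lemma star_relator_closed:
  fixes L :: "(real^'n::finite) set"
  assumes d: "triple_datum L B E a" and F: "F \<subseteq> E" "2 \<le> card F"
  shows "star_relator L B E F a \<in> carrier (T_group TYPE('n) A)"
proof -
  let ?T = "T_group TYPE('n) A"
  have T: "subgroup (carrier ?T) (free_Abelian_group (triples A // triple_iso A))"
    unfolding T_group_def by (rule group.subgroup_self) simp
  have "frag_of (triple_class A (L, tensor_sum L B a, \<Lambda>)) \<in> carrier ?T"
    if \<Lambda>: "\<Lambda> \<in> star_subdivision E F" "supported_on A L (tensor_sum L B a) \<Lambda>" for \<Lambda>
  proof -
    obtain I where I: "I \<subseteq> F" "I \<noteq> {}" "\<forall>e\<in>I. \<forall>e'\<in>I. a e = a e'"
      "\<Lambda> = convex_cone hull (star_generators E F I)"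
      using \<Lambda> supported_star_subdivision[OF d F] unfolding bij_betw_def by blast
    then obtain f where f: "f \<in> I" "\<forall>e\<in>I. a e = a f"
      by blast
    then show ?thesis
      using class_in_T_group[OF symbol_map_star(1)[OF d F f(1) I(1) f(2)]] I(4) by blast
  qed
  then have "frag_cmul c (frag_of (triple_class A (L, tensor_sum L B a, \<Lambda>))) \<in> carrier ?T"
    if "\<Lambda> \<in> star_subdivision E F" "supported_on A L (tensor_sum L B a) \<Lambda>" for c \<Lambda>
    using that keys_cmul by (fastforce simp: T_group_def)
  then show ?thesis
    unfolding star_relator_def
    using class_in_T_group[OF triple_of_in_triples[OF d]]
    by (intro frag_subgroup_diff[OF T] frag_subgroup_sum[OF T]) blast+
qed

lemma subdivision_relators_subset:
  "subdivision_relators TYPE('n::finite) A \<subseteq> carrier (T_group TYPE('n) A)"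
proof
  fix r assume "r \<in> subdivision_relators TYPE('n) A"
  then show "r \<in> carrier (T_group TYPE('n) A)"
  proof (cases rule: subdivision_relators_cases)
    case (star L B E F a)
    then show ?thesis using star_relator_closed by simp
  next
    case (face L B E a)
    have T: "subgroup (carrier (T_group TYPE('n) A)) (free_Abelian_group (triples A // triple_iso A))"
      unfolding T_group_def by (rule group.subgroup_self) simp
    show ?thesis
      unfolding face(2)
      using class_in_T_group triple_of_in_triples[OF face(1)] triple_of_in_triples[OF triple_datum_full[OF face(1)]]
      by (intro frag_subgroup_diff[OF T]) blast+
  qed
qed

lemma subgroup_subdivision_relations:
  "subgroup (subdivision_relations TYPE('n::finite) A) (T_group TYPE('n) A)"
  unfolding subdivision_relations_def
  by (rule group.generate_is_subgroup[OF _ subdivision_relators_subset]) (simp add: T_group_def)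

text \<open>Well-definedness on the quotient. A star relator maps to a blow-up relation; a face
  relator maps to zero already in \<open>\<S>\<^sub>n\<close>, as its two triples share the basis
  and the coefficients.\<close>

lemma symbol_map_relations_subset:
  "symbol_map A ` subdivision_relations TYPE('n::finite) A \<subseteq> symbol_relations CARD('n) A"
proof -
  have "symbol_map A ` subdivision_relators TYPE('n) A \<subseteq> symbol_relations CARD('n) A"
  proof clarify
    fix r assume "r \<in> subdivision_relators TYPE('n) A"
    then show "symbol_map A r \<in> symbol_relations CARD('n) A"
    proof (cases rule: subdivision_relators_cases)
      case (star L B E F a)
      let ?M = "image_mset a (mset_set F)" and ?N = "image_mset a (mset_set (B - F))"
      note d = triple_datumD[OF star(1)]
      have F: "F \<subseteq> B" "finite F" "F \<noteq> {}"
        using star(2,3) d(2) finite_subset[OF _ d(6), of F] by auto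
      then have "mset_set B = mset_set F + mset_set (B - F)"
        using mset_set_Union[of F "B - F"] d(6) by (auto simp: Un_absorb1)
      then have "?M + ?N \<in> symbols CARD('n) A"
        using symbol_in_symbols[OF star(1)] by simp
      moreover have "?M \<noteq> {#}"
        using F by (simp add: mset_set_empty_iff)
      ultimately show ?thesis
        unfolding star(4) star_relator_def symbol_map_star_relator[OF star(1,2,3)] by (intro blowup_relation)
    next
      case (face L B E a)
      have "symbol_map A r = 0"
        unfolding face(2) using triple_of_in_triples[OF face(1)] triple_of_in_triples[OF triple_datum_full[OF face(1)]]
          symbol_map_triple_class triple_symbol_triple_of[OF face(1)] triple_symbol_triple_of[OF triple_datum_full[OF face(1)]]
        by (simp add: symbol_map_def frag_extend_diff the_elem_triple_symbol_class)
      then show ?thesis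
        using frag_subgroup_zero[OF subgroup_symbol_rel] by simp
    qed
  qed
  then show ?thesis
    unfolding subdivision_relations_def
    using frag_hom_generate_subset[of "symbol_map A" "triples A // triple_iso A" "symbol_group CARD('n) A"]
      symbol_map_hom[where 'n = 'n] subdivision_relators_subset[where 'n = 'n] subgroup_symbol_rel[of "CARD('n)"]
    by (simp add: T_group_def symbol_group_def)
qed

text \<open>Each defining relator is hit exactly, not merely up to relations: place the symbol on a
  basic cone and subdivide the face spanned by two generators carrying the chosen entries.\<close>

lemma symbol_relations_subset_image:
  "symbol_relations CARD('n::finite) A \<subseteq> symbol_map A ` subdivision_relations TYPE('n) A"
proof -
  interpret h: group_hom "T_group TYPE('n) A" "symbol_group CARD('n) A" "symbol_map A"
    using symbol_map_hom[where 'n = 'n]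
    by (simp add: group_hom_def group_hom_axioms_def T_group_def symbol_group_def)
  \<comment> \<open>The sum runs over a set: for \<open>x = y\<close> it has one term and gives the
    relator for equal entries, otherwise two terms and the relator for distinct ones.\<close>
  have relator: "\<exists>q \<in> subdivision_relators TYPE('n) A. symbol_map A q =
      frag_of ({#x, y#} + N) - (\<Sum>z\<in>{x, y}. frag_of (blowup_symbol {#x, y#} N z))"
    if xy: "{#x, y#} + N \<in> symbols CARD('n) A" for x y N
  proof -
    obtain L and B :: "(real^'n) set" and a where d: "triple_datum L B B a"
      and a: "image_mset a (mset_set B) = {#x, y#} + N"
      using symbol_triple_exists[OF xy] .
    obtain e f where ef: "e \<in> B" "f \<in> B" "e \<noteq> f" "a e = x" "a f = y" "image_mset a (mset_set (B - {e, f})) = N"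
      using mset_set_image_pairE[OF triple_datumD(6)[OF d], of a x y N] a by auto
    have F: "{e, f} \<subseteq> B" "2 \<le> card {e, f}" "image_mset a (mset_set {e, f}) = {#x, y#}"
      using ef by auto
    show ?thesis
      using star_relator_in_relators[OF d F(1,2)] symbol_map_star_relator[OF d F(1,2)]
      by (intro bexI) (auto simp: star_relator_def F(3) ef(6))
  qed
  have "symbol_relators CARD('n) A \<subseteq> symbol_map A ` subdivision_relations TYPE('n) A"
  proof
    fix r assume "r \<in> symbol_relators CARD('n) A"
    then consider x y N where "{#x, y#} + N \<in> symbols CARD('n) A" "x \<noteq> y"
        "r = frag_of ({#x, y#} + N) - (frag_of ({#x, y \<otimes>\<^bsub>A\<^esub> inv\<^bsub>A\<^esub> x#} + N) + frag_of ({#x \<otimes>\<^bsub>A\<^esub> inv\<^bsub>A\<^esub> y, y#} + N))"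
      | x N where "{#x, x#} + N \<in> symbols CARD('n) A" "r = frag_of ({#x, x#} + N) - frag_of ({#\<one>\<^bsub>A\<^esub>, x#} + N)"
      unfolding symbol_relators_def by blast
    then have "\<exists>q \<in> subdivision_relators TYPE('n) A. symbol_map A q = r"
    proof cases
      case 1
      then show ?thesis
        using relator[OF 1(1)] by (simp add: blowup_symbol_def shift_def add_mset_commute)
    next
      case 2
      then have "x \<in> carrier A"
        by (auto simp: symbols_def)
      then show ?thesis
        using relator[OF 2(1)] 2(2) by (simp add: blowup_symbol_def shift_def add_mset_commute)
    qed
    then show "r \<in> symbol_map A ` subdivision_relations TYPE('n) A"
      unfolding subdivision_relations_def by (auto intro: generate.incl)
  qed
  then show ?thesis
    unfolding symbol_relations_def
    using h.subgroup_img_is_subgroup[OF subgroup_subdivision_relations]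
    by (intro h.H.generate_subgroup_incl)
qed

text \<open>\<open>\<sigma>\<close> sends a symbol to the class of its basic triple. Applying the
  symbol map and then \<open>\<sigma>\<close> enlarges the cone of a triple to a basic cone
  containing it as a face, which is a relation of the second family.\<close>

lemma basic_symbol_section:
  "\<exists>\<sigma>. \<forall>x \<in> carrier (T_group TYPE('n::finite) A).
    x - frag_extend \<sigma> (symbol_map A x) \<in> subdivision_relations TYPE('n) A"
proof -
  note Q = subgroup_subdivision_relations[where 'n = 'n, unfolded T_group_def]
  \<comment> \<open>Claimed for every multiset so that the chosen function is total; where no basic
    triple has the symbol \<open>M\<close>, the condition is vacuous.\<close>
  have "\<exists>C. \<forall>L (B :: (real^'n) set) a. triple_datum L B B a \<and> image_mset a (mset_set B) = M
      \<longrightarrow> C = triple_class A (triple_of L B B a)" for M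
    using triple_class_eq[OF basic_triples_isomorphic] by metis
  then obtain \<tau> where \<tau>: "triple_datum L B B a \<Longrightarrow>
      \<tau> (image_mset a (mset_set B)) = triple_class A (triple_of L B B a)" for L and B :: "(real^'n) set" and a
    by metis
  define \<sigma> where "\<sigma> = frag_of \<circ> \<tau>"
  have "x - frag_extend \<sigma> (symbol_map A x) \<in> subdivision_relations TYPE('n) A"
    if "x \<in> carrier (T_group TYPE('n) A)" for x
  proof (rule free_Abelian_group_induct[of x "triples A // triple_iso A"])
    show "Poly_Mapping.keys x \<subseteq> triples A // triple_iso A"
      using that by (simp add: T_group_def)
    show "0 - frag_extend \<sigma> (symbol_map A 0) \<in> subdivision_relations TYPE('n) A"
      using frag_subgroup_zero[OF Q] by (simp add: symbol_map_def)
  next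
    fix x y
    assume "x - frag_extend \<sigma> (symbol_map A x) \<in> subdivision_relations TYPE('n) A"
      "y - frag_extend \<sigma> (symbol_map A y) \<in> subdivision_relations TYPE('n) A"
    from frag_subgroup_diff[OF Q this]
    show "x - y - frag_extend \<sigma> (symbol_map A (x - y)) \<in> subdivision_relations TYPE('n) A"
      by (simp add: symbol_map_def frag_extend_diff algebra_simps)
  next
    fix C :: "('n, 'c) triple set" assume "C \<in> triples A // triple_iso A"
    then obtain t where t: "t \<in> triples A" "C = triple_class A t"
      by (rule T_group_classE)
    obtain L B E a where d: "triple_datum L B E a" "t = triple_of L B E a"
      using triples_cases[OF t(1)] .
    have "frag_extend \<sigma> (symbol_map A (frag_of C)) = frag_of (triple_class A (triple_of L B B a))"
      using t d \<tau>[OF triple_datum_full[OF d(1)]]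
      by (simp add: symbol_map_triple_class triple_symbol_triple_of \<sigma>_def)
    then show "frag_of C - frag_extend \<sigma> (symbol_map A (frag_of C)) \<in> subdivision_relations TYPE('n) A"
      unfolding subdivision_relations_def using face_relator_in_relators[OF d(1)] t d
      by (simp add: generate.incl)
  qed
  then show ?thesis by blast
qed

text \<open>A relation lifts to some \<open>q\<close> among the subdivision relations with the same
  symbol as \<open>x\<close>. Both \<open>x\<close> and \<open>q\<close> are congruent to the common
  value of the section, so \<open>x\<close> is a subdivision relation too.\<close>

lemma symbol_map_in_relations_iff:
  assumes x: "x \<in> carrier (T_group TYPE('n::finite) A)"
  shows "symbol_map A x \<in> symbol_relations CARD('n) A \<longleftrightarrow> x \<in> subdivision_relations TYPE('n) A"
proof
  note Q = subgroup_subdivision_relations[where 'n = 'n, unfolded T_group_def]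
  assume "symbol_map A x \<in> symbol_relations CARD('n) A"
  then obtain q where q: "q \<in> subdivision_relations TYPE('n) A" "symbol_map A x = symbol_map A q"
    using symbol_relations_subset_image[where 'n = 'n] by blast
  obtain \<sigma> where \<sigma>: "\<And>x. x \<in> carrier (T_group TYPE('n) A) \<Longrightarrow>
      x - frag_extend \<sigma> (symbol_map A x) \<in> subdivision_relations TYPE('n) A"
    using basic_symbol_section[where 'n = 'n] by blast
  have "q \<in> carrier (T_group TYPE('n) A)"
    using subgroup.mem_carrier[OF subgroup_subdivision_relations q(1)] .
  from frag_subgroup_diff[OF Q q(1) \<sigma>[OF this]]
  have "frag_extend \<sigma> (symbol_map A x) \<in> subdivision_relations TYPE('n) A"
    by (simp add: q(2))
  from frag_subgroup_add[OF Q \<sigma>[OF x] this]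
  show "x \<in> subdivision_relations TYPE('n) A"
    by simp
qed (use symbol_map_relations_subset[where 'n = 'n] in auto)

lemma symbol_map_surj:
  "symbol_map A ` carrier (T_group TYPE('n::finite) A) = carrier (symbol_group CARD('n) A)"
proof
  show "symbol_map A ` carrier (T_group TYPE('n) A) \<subseteq> carrier (symbol_group CARD('n) A)"
    using symbol_map_hom hom_carrier by blast
  show "carrier (symbol_group CARD('n) A) \<subseteq> symbol_map A ` carrier (T_group TYPE('n) A)"
  proof
    fix y assume "y \<in> carrier (symbol_group CARD('n) A)"
    then have "Poly_Mapping.keys y \<subseteq> symbols CARD('n) A"
      by (simp add: symbol_group_def)
    then show "y \<in> symbol_map A ` carrier (T_group TYPE('n) A)"
    proof (rule free_Abelian_group_induct)
      show "0 \<in> symbol_map A ` carrier (T_group TYPE('n) A)"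
        by (intro image_eqI[of _ _ 0]) (auto simp: symbol_map_def T_group_def)
    next
      fix y z
      assume "y \<in> symbol_map A ` carrier (T_group TYPE('n) A)" "z \<in> symbol_map A ` carrier (T_group TYPE('n) A)"
      then obtain u v where "u \<in> carrier (T_group TYPE('n) A)" "v \<in> carrier (T_group TYPE('n) A)"
        "y = symbol_map A u" "z = symbol_map A v" by blast
      then show "y - z \<in> symbol_map A ` carrier (T_group TYPE('n) A)"
        using keys_diff[of u v]
        by (intro image_eqI[of _ _ "u - v"]) (auto simp: symbol_map_def frag_extend_diff T_group_def)
    next
      fix M assume M: "M \<in> symbols CARD('n) A"
      obtain L and B :: "(real^'n) set" and a where d: "triple_datum L B B a" "image_mset a (mset_set B) = M"
        using symbol_triple_exists[OF M] .
      then show "frag_of M \<in> symbol_map A ` carrier (T_group TYPE('n) A)"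
        using symbol_map_triple_class[OF triple_of_in_triples[OF d(1)]] triple_symbol_triple_of[OF d(1)]
          class_in_T_group[OF triple_of_in_triples[OF d(1)]]
        by (intro image_eqI[of _ _ "frag_of (triple_class A (triple_of L B B a))"]) simp_all
    qed
  qed
qed

text \<open>The first isomorphism theorem, once the kernel is known from
  \<open>symbol_map_in_relations_iff\<close> and surjectivity from
  \<open>symbol_map_surj\<close>.\<close>

proposition psi_tilde_iso:
  "psi_tilde A \<in> hom (T_group TYPE('n::finite) A) (B_group CARD('n) A)
    \<and> (\<exists>\<psi> \<in> iso (T_group TYPE('n) A Mod subdivision_relations TYPE('n) A) (B_group CARD('n) A).
        \<forall>x \<in> carrier (T_group TYPE('n) A).
          \<psi> (subdivision_relations TYPE('n) A #>\<^bsub>T_group TYPE('n) A\<^esub> x) = psi_tilde A x)"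
proof -
  let ?T = "T_group TYPE('n) A" and ?S = "symbol_group CARD('n) A" and ?B = "B_group CARD('n) A"
  let ?Q = "subdivision_relations TYPE('n) A" and ?R = "symbol_relations CARD('n) A"
  interpret S: comm_group ?S
    unfolding symbol_group_def by (rule abelian_free_Abelian_group)
  interpret T: comm_group ?T
    unfolding T_group_def by (rule abelian_free_Abelian_group)
  interpret R: normal ?R ?S
    using subgroup_symbol_rel[of "CARD('n)"] S.normal_iff_subgroup by (simp add: symbol_group_def)
  interpret Q: normal ?Q ?T
    using subgroup_subdivision_relations T.normal_iff_subgroup by blast
  have psi: "psi_tilde A = (\<lambda>x. ?R #>\<^bsub>?S\<^esub> x) \<circ> (symbol_map A :: (('n, 'c) triple set \<Rightarrow>\<^sub>0 int) \<Rightarrow> _)"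
    by (rule ext) (simp add: psi_tilde_def)
  have hom: "psi_tilde A \<in> hom ?T ?B"
    unfolding psi B_group_def using symbol_map_hom R.r_coset_hom_Mod by (rule hom_compose)
  interpret psi: group_hom ?T ?B "psi_tilde A"
    using hom R.factorgroup_is_group T.is_group by (simp add: group_hom_def group_hom_axioms_def B_group_def)
  have R_sub: "subgroup ?R (free_Abelian_group (symbols CARD('n) A))"
    by (rule subgroup_symbol_rel)
  have coset_eq: "?R #>\<^bsub>?S\<^esub> u = ?R \<longleftrightarrow> u \<in> ?R" for u
    using frag_coset_eq_iff[OF R_sub, of "symbols CARD('n) A" u 0] S.coset_mult_one[OF R.subset]
    by (simp add: symbol_group_def)
  have "x \<in> kernel ?T ?B (psi_tilde A) \<longleftrightarrow> x \<in> ?Q" for x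
    using symbol_map_in_relations_iff[of x] coset_eq[of "symbol_map A x"] Q.mem_carrier[of x]
    by (auto simp: kernel_def B_group_def psi_tilde_def)
  then have ker: "kernel ?T ?B (psi_tilde A) = ?Q"
    by blast
  have "psi_tilde A ` carrier ?T = carrier ?B"
    unfolding psi image_comp[symmetric] symbol_map_surj by (simp add: B_group_def carrier_FactGroup)
  then have iso: "(\<lambda>X. the_elem (psi_tilde A ` X)) \<in> iso (?T Mod ?Q) ?B"
    using psi.FactGroup_iso_set by (simp add: ker)
  \<comment> \<open>The isomorphism comes as extraction from the image of a coset; it remains to see
    that \<open>psi_tilde\<close> is constant on cosets of its kernel, so that this is the induced
    map.\<close>
  have val: "the_elem (psi_tilde A ` (?Q #>\<^bsub>?T\<^esub> x)) = psi_tilde A x" if x: "x \<in> carrier ?T" for x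
  proof -
    have "psi_tilde A y = psi_tilde A x" if y: "y \<in> ?Q #>\<^bsub>?T\<^esub> x" for y
    proof -
      obtain q where q: "q \<in> ?Q" "y = q \<otimes>\<^bsub>?T\<^esub> x"
        using y by (auto simp: r_coset_def)
      then have "q \<in> carrier ?T" "psi_tilde A q = \<one>\<^bsub>?B\<^esub>"
        using ker by (auto simp: kernel_def)
      then show ?thesis
        using x q(2) by simp
    qed
    moreover have "x \<in> ?Q #>\<^bsub>?T\<^esub> x"
      by (rule T.rcos_self[OF x Q.subgroup_axioms])
    ultimately have "psi_tilde A ` (?Q #>\<^bsub>?T\<^esub> x) = {psi_tilde A x}"
      by blast
    then show ?thesis by simp
  qed
  show ?thesis
    by (intro conjI hom bexI[OF _ iso] ballI val)
qed

end

section \<open>The character group as coefficient group\<close>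

lemma comm_group_character_group:
  assumes "group G"
  shows "comm_group (character_group G)"
proof -
  interpret G: group G by fact
  have one: "restrict (\<lambda>x. 1) (carrier G) \<in> carrier (character_group G)"
    by (auto simp: character_group_def complex_units_def hom_def)
  have mult: "restrict (\<lambda>x. \<phi> x * \<psi> x) (carrier G) \<in> carrier (character_group G)"
    if "\<phi> \<in> carrier (character_group G)" "\<psi> \<in> carrier (character_group G)" for \<phi> \<psi>
    using that by (auto simp: character_group_def complex_units_def hom_def Pi_def)
  show ?thesis
  proof (rule comm_groupI)
    fix \<phi> assume \<phi>: "\<phi> \<in> carrier (character_group G)"
    have ne: "\<phi> x \<noteq> 0" if "x \<in> carrier G" for x
      using \<phi> that by (auto simp: character_group_def complex_units_def hom_def)
    show "\<one>\<^bsub>character_group G\<^esub> \<otimes>\<^bsub>character_group G\<^esub> \<phi> = \<phi>"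
      using \<phi> by (auto simp: character_group_def extensional_def)
    have "restrict (\<lambda>x. inverse (\<phi> x)) (carrier G) \<in> carrier (character_group G)"
      \<comment> \<open>The inverse is taken pointwise, which is possible as characters have nonzero
        values; restriction to the carrier keeps it extensional, so that equality of characters is
        equality of functions.\<close>
      using \<phi> by (auto simp: character_group_def complex_units_def hom_def Pi_def)
    moreover have "restrict (\<lambda>x. inverse (\<phi> x)) (carrier G) \<otimes>\<^bsub>character_group G\<^esub> \<phi> = \<one>\<^bsub>character_group G\<^esub>"
      using ne by (auto simp: character_group_def restrict_def)
    ultimately show "\<exists>\<psi>\<in>carrier (character_group G). \<psi> \<otimes>\<^bsub>character_group G\<^esub> \<phi> = \<one>\<^bsub>character_group G\<^esub>"
      by blast
  qed (use one mult in \<open>auto simp: character_group_def restrict_def mult.assoc mult.commute\<close>)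
qed

theorem mainTheorem4:
  fixes G :: "('g, 'm) monoid_scheme"
  assumes "comm_group G" and "finite (carrier G)" and "CARD('n::finite) \<ge> 2"
  shows "psi_tilde (character_group G)
           \<in> hom (T_group TYPE('n) (character_group G)) (B_group CARD('n) (character_group G))
    \<and> (\<exists>\<psi> \<in> iso (T_group TYPE('n) (character_group G)
                    Mod subdivision_relations TYPE('n) (character_group G))
                 (B_group CARD('n) (character_group G)).
        \<forall>x \<in> carrier (T_group TYPE('n) (character_group G)).
          \<psi> (subdivision_relations TYPE('n) (character_group G)
               #>\<^bsub>T_group TYPE('n) (character_group G)\<^esub> x)
          = psi_tilde (character_group G) x)"
proof -
  interpret coefficient_group "character_group G"
    using comm_group_character_group[OF comm_group.axioms(2)[OF assms(1)]] by (simp add: coefficient_group_def)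
  show ?thesis
    by (rule psi_tilde_iso)
qed

end
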